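(* Let $\Lambda=\Lambda_0\oplus\Lambda_1$ be a finite-dimensional real commutative superalgebra satisfying conditions $(A_0)$ and $(A_1)$. Let $D$ be a domain (connected open subset) of $\Lambda_0^n\times\Lambda_1^m$ and let $f:D\to\Lambda$ be a function which is separately qS-differentiable on $D$ with respect to each of its variables $y_1,\dots,y_n\in\Lambda_0$ and $\theta_1,\dots,\theta_m\in\Lambda_1$ (that is, for each of these $n+m$ variables, the function obtained by fixing arbitrarily all the other variables is qS-differentiable in that variable on the corresponding open slice of $D$). Then $f$ is qS-differentiable on $D$.
   Context: A real commutative superalgebra (CSA) is an associative unital real algebra with a grading $\Lambda=\Lambda_0\oplus\Lambda_1$, $\Lambda_i\Lambda_j\subset\Lambda_{i+j \bmod 2}$, such that $ab=(-1)^{\sigma(a)\sigma(b)}ba$ for homogeneous $a,b$, where $\sigma(a)=i$ for $a\in\Lambda_i$. Condition $(A_0)$: there is a basis $(e_0=1,e_1,\dots,e_p)$ of $\Lambda_0$ with $\sum_{k=0}^p e_k^2=0$. Condition $(A_1)$: there are a basis $(\varepsilon_1,\dots,\varepsilon_q)$ of $\Lambda_1$, integers $1=s_1<s_2<\dots<s_r<s_{r+1}=q+1$ and elements $a_1,\dots,a_q\in\Lambda_0$ such that $\varepsilon_j=a_j\varepsilon_{s_k}$ whenever $s_k\le j<s_{k+1}$, $a_{s_1}=\dots=a_{s_r}=e_0$, and $\sum_{j=s_k}^{s_{k+1}-1}a_j^2=0$ for every $k=1,\dots,r$. Such bases and elements are fixed. A point of $\Lambda_0^n\times\Lambda_1^m$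 is written $(y_1,\dots,y_n,\theta_1,\dots,\theta_m)$ with $y_i=\sum_{k=0}^p y_i^k e_k$, $\theta_i=\sum_{l=1}^q\theta_i^l\varepsilon_l$, where $y_i^k,\theta_i^l$ are real coordinates. For a Fréchet-differentiable (over $\mathbb R$) function $f$ with values in $\Lambda$ put $$d''f=\sum_{i=1}^n\sum_{j=1}^p \Big(\frac{\partial f}{\partial y_i^j}-e_j\frac{\partial f}{\partial y_i^0}\Big)dy_i^j+\sum_{i=1}^m\sum_{k=1}^r\sum_{t=s_k+1}^{s_{k+1}-1}\Big(\frac{\partial f}{\partial\theta_i^t}-a_t\frac{\partial f}{\partial\theta_i^{s_k}}\Big)d\theta_i^t .$$ A function is qS-differentiable on an open set if it is Fréchet-differentiable there and $d''f\equiv0$. The same definition with $(n,m)=(1,0)$ or $(0,1)$ gives qS-differentiability in one variable of $\Lambda_0$ or of $\Lambda_1$. *)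

theory Defs
  imports "HOL-Analysis.Analysis"
begin

text \<open>
  The superalgebra is a type of sort \<open>{real_algebra_1, euclidean_space}\<close>, graded by two subspaces
  \<open>L0\<close> and \<open>L1\<close>. The Euclidean structure only supplies finite dimension and the
  standard topology: no compatibility between norm and product is required, and Frechet
  differentiability in finite dimension does not depend on the norm.
\<close>

definition comm_superalgebra :: "'a::real_algebra_1 set \<Rightarrow> 'a set \<Rightarrow> bool" where
  "comm_superalgebra L0 L1 \<longleftrightarrow>
     subspace L0 \<and> subspace L1 \<and> L0 \<inter> L1 = {0} \<and> (\<forall>x. \<exists>a\<in>L0. \<exists>b\<in>L1. x = a + b) \<and>
     (\<forall>a\<in>L0. \<forall>b\<in>L0. a * b \<in> L0 \<and> a * b = b * a) \<and>
     (\<forall>a\<in>L0. \<forall>b\<in>L1. a * b \<in> L1 \<and> b * a \<in> L1 \<and> a * b = b * a) \<and>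
     (\<forall>a\<in>L1. \<forall>b\<in>L1. a * b \<in> L0 \<and> a * b = - (b * a))"

definition indexed_basis :: "nat set \<Rightarrow> (nat \<Rightarrow> 'a::real_vector) \<Rightarrow> 'a set \<Rightarrow> bool" where
  "indexed_basis I b V \<longleftrightarrow> inj_on b I \<and> independent (b ` I) \<and> span (b ` I) = V"

definition condition_A0 :: "'a::real_algebra_1 set \<Rightarrow> nat \<Rightarrow> (nat \<Rightarrow> 'a) \<Rightarrow> bool" where
  "condition_A0 L0 p e \<longleftrightarrow>
     indexed_basis {0..p} e L0 \<and> e 0 = 1 \<and> (\<Sum>k=0..p. (e k)\<^sup>2) = 0"

text \<open>For \<open>L1 = {0}\<close> the next condition holds with \<open>q = r = 0\<close>.\<close>

definition condition_A1 ::
  "'a::real_algebra_1 set \<Rightarrow> 'a set \<Rightarrow> nat \<Rightarrow> (nat \<Rightarrow> 'a) \<Rightarrow> nat \<Rightarrow> (nat \<Rightarrow> nat) \<Rightarrow> (nat \<Rightarrow> 'a) \<Rightarrow> bool"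
where
  "condition_A1 L0 L1 q \<epsilon> r s a \<longleftrightarrow>
     indexed_basis {1..q} \<epsilon> L1 \<and>
     s 1 = 1 \<and> strict_mono_on {1..r+1} s \<and> s (r+1) = q + 1 \<and>
     (\<forall>j\<in>{1..q}. a j \<in> L0) \<and>
     (\<forall>k\<in>{1..r}. \<forall>j\<in>{s k..<s (k+1)}. \<epsilon> j = a j * \<epsilon> (s k)) \<and>
     (\<forall>k\<in>{1..r}. a (s k) = 1) \<and>
     (\<forall>k\<in>{1..r}. (\<Sum>j\<in>{s k..<s (k+1)}. (a j)\<^sup>2) = 0)"

text \<open>
  The variables are indexed by a finite type \<open>'k\<close>; those in \<open>E\<close> are the even ones
  \<open>y_1, ..., y_n\<close>, the others are the odd ones \<open>\<theta>_1, ..., \<theta>_m\<close>, so that \<open>n = card E\<close> and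
  \<open>m = card (- E)\<close>. This allows \<open>n = 0\<close> or \<open>m = 0\<close>, hence contains the one-variable cases
  \<open>(1,0)\<close> and \<open>(0,1)\<close>, for which \<open>'k\<close> is the one-element type.
\<close>

definition superspace :: "'a set \<Rightarrow> 'a set \<Rightarrow> 'k set \<Rightarrow> ('a ^ 'k) set" where
  "superspace L0 L1 E = {x. \<forall>v. x $ v \<in> (if v \<in> E then L0 else L1)}"

text \<open>
  The derivative of \<open>f\<close> at \<open>x\<close> in the real coordinate along the basis vector \<open>b\<close> of the
  variable \<open>v\<close>.
\<close>

definition real_partial ::
  "('a::real_normed_vector ^ 'k \<Rightarrow> 'b::real_normed_vector) \<Rightarrow> 'a ^ 'k \<Rightarrow> 'k::finite \<Rightarrow> 'a \<Rightarrow> 'b"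
where
  "real_partial f x v b = vector_derivative (\<lambda>t. f (x + t *\<^sub>R axis v b)) (at 0)"

text \<open>
  The 1-form \<open>d''f\<close>, at the point \<open>x\<close> and evaluated on the tangent vector \<open>h\<close>: the real number
  \<open>dy_v^j(h)\<close> is the \<open>j\<close>-th coordinate of \<open>h $ v\<close> in the basis \<open>e\<close>, and \<open>d\<theta>_v^t(h)\<close> is its
  \<open>t\<close>-th coordinate in the basis \<open>\<epsilon>\<close>.
\<close>

definition d_second ::
  "nat \<Rightarrow> (nat \<Rightarrow> 'a) \<Rightarrow> nat \<Rightarrow> (nat \<Rightarrow> 'a) \<Rightarrow> nat \<Rightarrow> (nat \<Rightarrow> nat) \<Rightarrow> (nat \<Rightarrow> 'a) \<Rightarrow> 'k set \<Rightarrow>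
   ('a::{real_algebra_1, euclidean_space} ^ 'k::finite \<Rightarrow> 'a) \<Rightarrow> 'a ^ 'k \<Rightarrow> 'a ^ 'k \<Rightarrow> 'a"
where
  "d_second p e q \<epsilon> r s a E f x h =
     (\<Sum>v\<in>E. \<Sum>j=1..p.
        representation (e ` {0..p}) (h $ v) (e j) *\<^sub>R
          (real_partial f x v (e j) - e j * real_partial f x v (e 0)))
   + (\<Sum>v\<in>-E. \<Sum>k=1..r. \<Sum>t\<in>{s k + 1..<s (k+1)}.
        representation (\<epsilon> ` {1..q}) (h $ v) (\<epsilon> t) *\<^sub>R
          (real_partial f x v (\<epsilon> t) - a t * real_partial f x v (\<epsilon> (s k))))"

text \<open>
  The next definition is meant for \<open>D\<close> open in \<open>superspace L0 L1 E\<close>; then differentiability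
  within \<open>D\<close> is Frechet differentiability on that real vector space.
\<close>

definition qS_differentiable_on ::
  "'a set \<Rightarrow> 'a set \<Rightarrow>
   nat \<Rightarrow> (nat \<Rightarrow> 'a) \<Rightarrow> nat \<Rightarrow> (nat \<Rightarrow> 'a) \<Rightarrow> nat \<Rightarrow> (nat \<Rightarrow> nat) \<Rightarrow> (nat \<Rightarrow> 'a) \<Rightarrow> 'k set \<Rightarrow>
   ('a::{real_algebra_1, euclidean_space} ^ 'k::finite \<Rightarrow> 'a) \<Rightarrow> ('a ^ 'k) set \<Rightarrow> bool"
where
  "qS_differentiable_on L0 L1 p e q \<epsilon> r s a E f D \<longleftrightarrow>
     (\<forall>x\<in>D. f differentiable (at x within D)) \<and>
     (\<forall>x\<in>D. \<forall>h\<in>superspace L0 L1 E. d_second p e q \<epsilon> r s a E f x h = 0)"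

definition replace_var :: "'a ^ 'k \<Rightarrow> 'k \<Rightarrow> 'a ^ 1 \<Rightarrow> 'a ^ 'k" where
  "replace_var x v u = (\<chi> w. if w = v then u $ 1 else x $ w)"

definition separately_qS_differentiable_on ::
  "'a set \<Rightarrow> 'a set \<Rightarrow>
   nat \<Rightarrow> (nat \<Rightarrow> 'a) \<Rightarrow> nat \<Rightarrow> (nat \<Rightarrow> 'a) \<Rightarrow> nat \<Rightarrow> (nat \<Rightarrow> nat) \<Rightarrow> (nat \<Rightarrow> 'a) \<Rightarrow> 'k set \<Rightarrow>
   ('a::{real_algebra_1, euclidean_space} ^ 'k::finite \<Rightarrow> 'a) \<Rightarrow> ('a ^ 'k) set \<Rightarrow> bool"
where
  "separately_qS_differentiable_on L0 L1 p e q \<epsilon> r s a E f D \<longleftrightarrow>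
     (\<forall>v. \<forall>x\<in>superspace L0 L1 E.
        qS_differentiable_on L0 L1 p e q \<epsilon> r s a (if v \<in> E then UNIV else {})
          (\<lambda>u. f (replace_var x v u)) {u. replace_var x v u \<in> D})"

end

theory Submission
  imports Defs "HOL-Analysis.Analysis" "HOL-Computational_Algebra.Polynomial"
begin

text \<open>Along an even variable, and along each block of coordinates of an odd variable, the condition
  is a first-order system \<open>Df(h) = A h f'\<close> with commuting operators \<open>A h\<close>, \<open>A u0 = 1\<close>, such that the
  squares \<open>(A u)\<^sup>2\<close> sum to 0 over an orthonormal basis. Goursat's argument gives local primitives, and
  the vanishing sum of squares gives a mean value property against a radial kernel; this yields
  regularity of f', Cauchy estimates and Taylor expansions within each block.

  Joint differentiability is then Hartogs' theorem without a complex structure. By Baire's theorem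
  f is bounded on a smaller polydisc that is thin in all blocks but the last. The Taylor
  coefficients in the last block have pointwise geometric bounds in the other blocks, and a crude
  Remez inequality on real lines, in place of Hartogs' lemma on subharmonic functions, makes these
  bounds locally uniform at the cost of a constant factor in the rate. Hence f is locally bounded,
  bounded separately regular functions are differentiable by telescoping, and each term of d''f
  involves a single variable.\<close>

section \<open>Goursat's lemma\<close>

text \<open>Each component of an \<open>A\<close>-differentiable function is harmonic: once
  \<open>G'\<close> has an \<open>A\<close>-derivative \<open>G''\<close>, the second derivative
  along \<open>u\<close> is \<open>A u (A u G'')\<close>, and these sum to 0 over an orthonormal
  basis. This cannot be used at the outset, since only Frechet differentiability is given and the
  derivative might be discontinuous. A primitive, whose derivative is the given continuous function,
  is the way around this. The second obstacle is that an estimate in one block need not be uniform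
  in the others. The classical remedy rests on \<open>log (norm f)\<close> being subharmonic, and
  there is no reason for this when the norm is not multiplicative. A constant factor lost in the
  rate of convergence is harmless all the same: it depends only on the number of blocks and their
  dimension, so the point of expansion furnished by Baire's theorem can be required beforehand to
  lie so close to the centre that the weakened rate still suffices there.\<close>

locale elliptic_symbol =
  fixes A :: "'e::euclidean_space \<Rightarrow> ('m::euclidean_space \<Rightarrow>\<^sub>L 'm)" and u0 :: 'e
  assumes linear_A: "linear A"
    and A_commute: "A h o\<^sub>L A k = A k o\<^sub>L A h"
    and u0_Basis: "u0 \<in> Basis"
    and A_u0: "A u0 = id_blinfun"
    and A_squares: "(\<Sum>u\<in>Basis. A u o\<^sub>L A u) = 0"
begin

lemma bounded_linear_A: "bounded_linear A"
  using linear_A linear_conv_bounded_linear by blast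

lemmas A_simps = linear_add[OF linear_A] linear_diff[OF linear_A] linear_scale[OF linear_A]
  linear_0[OF linear_A] linear_neg[OF linear_A]

lemma A_commute': "A h (A k x) = A k (A h x)"
  by (metis A_commute blinfun_apply_blinfun_compose)

lemma A_u0': "A u0 x = x"
  by (simp add: A_u0)

lemma norm_A_bound: obtains K where "K \<ge> 1" "\<And>h. norm (A h) \<le> K * norm h"
proof -
  obtain K where K: "\<And>h. norm (A h) \<le> norm h * K" "K > 0"
    using bounded_linear.pos_bounded[OF bounded_linear_A] by blast
  have "norm (A h) \<le> max 1 K * norm h" for h
    using K(1)[of h] by (metis max.cobounded2 mult.commute mult_right_mono norm_ge_zero order_trans)
  then show thesis using that[of "max 1 K"] by auto
qed

lemma continuous_on_A [continuous_intros]: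
  "continuous_on S f \<Longrightarrow> continuous_on S (\<lambda>x. A (f x))"
  using bounded_linear.continuous_on[OF bounded_linear_A] by blast

text \<open>The analogue of holomorphy: multiplication by a complex derivative becomes
  \<open>h \<mapsto> A h (G' x)\<close>. Since \<open>A u0\<close> is the identity,
  \<open>G' x\<close> is the derivative in the direction \<open>u0\<close> and hence determined on
  \<open>U\<close>; outside \<open>U\<close> the function \<open>G'\<close> is arbitrary.\<close>

definition A_derivative_on :: "'e set \<Rightarrow> ('e \<Rightarrow> 'm) \<Rightarrow> ('e \<Rightarrow> 'm) \<Rightarrow> bool" where
  "A_derivative_on U G G' \<longleftrightarrow> (\<forall>x\<in>U. (G has_derivative (\<lambda>h. A h (G' x))) (at x))"

lemma A_derivative_onD:
  "A_derivative_on U G G' \<Longrightarrow> x \<in> U \<Longrightarrow> (G has_derivative (\<lambda>h. A h (G' x))) (at x within S)"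
  by (auto simp: A_derivative_on_def intro: has_derivative_at_withinI)

lemma A_derivative_on_subset: "A_derivative_on U G G' \<Longrightarrow> V \<subseteq> U \<Longrightarrow> A_derivative_on V G G'"
  by (auto simp: A_derivative_on_def)

lemma A_derivative_on_continuous: "A_derivative_on U G G' \<Longrightarrow> continuous_on U G"
  by (auto intro!: continuous_at_imp_continuous_on has_derivative_continuous simp: A_derivative_on_def)

lemma A_derivative_on_minus:
  "A_derivative_on U G G' \<Longrightarrow> A_derivative_on U H H' \<Longrightarrow>
    A_derivative_on U (\<lambda>x. G x - H x) (\<lambda>x. G' x - H' x)"
  by (auto simp: A_derivative_on_def blinfun.diff_right intro!: has_derivative_diff)

lemma A_derivative_on_scaleR:
  "A_derivative_on U G G' \<Longrightarrow> A_derivative_on U (\<lambda>x. c *\<^sub>R G x) (\<lambda>x. c *\<^sub>R G' x)"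
  by (auto simp: A_derivative_on_def blinfun.scaleR_right intro!: has_derivative_scaleR_right)

lemma A_derivative_on_unique:
  assumes "A_derivative_on U G G'" "A_derivative_on U G G''" "x \<in> U"
  shows "G' x = G'' x"
proof -
  have "(\<lambda>h. A h (G' x)) = (\<lambda>h. A h (G'' x))"
    using assms has_derivative_unique unfolding A_derivative_on_def by blast
  from fun_cong[OF this, of u0] show ?thesis by (simp add: A_u0')
qed

section \<open>Integrals of the operator-valued form \<open>A dx\<close>, applied to a function,
  along segments and triangles\<close>

definition segment_integral :: "('e \<Rightarrow> 'm) \<Rightarrow> 'e \<Rightarrow> 'e \<Rightarrow> 'm" where
  "segment_integral G a b = integral {0..1} (\<lambda>t. A (b - a) (G (a + t *\<^sub>R (b - a))))"

lemma segment_integrable: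
  assumes "continuous_on K G" "convex K" "a \<in> K" "b \<in> K"
  shows "(\<lambda>t. A (b - a) (G (a + t *\<^sub>R (b - a)))) integrable_on {0..1}"
proof (rule integrable_continuous_interval)
  have "(\<lambda>t. a + t *\<^sub>R (b - a)) ` {0..1} \<subseteq> K"
  proof
    fix y assume "y \<in> (\<lambda>t. a + t *\<^sub>R (b - a)) ` {0..1}"
    then obtain t where t: "t \<in> {0..1}" "y = (1 - t) *\<^sub>R a + t *\<^sub>R b"
      by (auto simp: algebra_simps)
    then show "y \<in> K" using assms convexD_alt by fastforce
  qed
  then have "continuous_on {0..1} (\<lambda>t. G (a + t *\<^sub>R (b - a)))"
    by (intro continuous_on_compose2[OF assms(1)] continuous_intros) auto
  then show "continuous_on {0..1} (\<lambda>t. A (b - a) (G (a + t *\<^sub>R (b - a))))"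
    by (intro continuous_intros)
qed

lemma segment_in_convex:
  assumes "convex K" "a \<in> K" "b \<in> K" "t \<in> {0..1}"
  shows "(a::'e) + t *\<^sub>R (b - a) \<in> K"
  using convexD_alt[OF assms(1-3), of t] assms(4) by (simp add: algebra_simps)

lemma segment_integral_exact:
  assumes "\<And>t. t \<in> {0..1} \<Longrightarrow>
     (\<Psi> has_derivative (\<lambda>h. A h (G (a + t *\<^sub>R (b - a))))) (at (a + t *\<^sub>R (b - a)))"
  shows "segment_integral G a b = \<Psi> b - \<Psi> a"
proof -
  have "((\<lambda>t. A (b - a) (G (a + t *\<^sub>R (b - a)))) has_integral
      \<Psi> (a + 1 *\<^sub>R (b - a)) - \<Psi> (a + 0 *\<^sub>R (b - a))) {0..1}"
  proof (rule fundamental_theorem_of_calculus)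
    fix t :: real assume t: "t \<in> {0..1}"
    have "((\<lambda>t. a + t *\<^sub>R (b - a)) has_derivative (\<lambda>s. s *\<^sub>R (b - a))) (at t within {0..1})"
      by (auto intro!: derivative_eq_intros)
    from has_derivative_compose[OF this assms[OF t]]
    show "((\<lambda>t. \<Psi> (a + t *\<^sub>R (b - a))) has_vector_derivative
        A (b - a) (G (a + t *\<^sub>R (b - a)))) (at t within {0..1})"
      by (simp add: has_vector_derivative_def A_simps blinfun.scaleR_left)
  qed auto
  then show ?thesis by (simp add: segment_integral_def integral_unique)
qed

text \<open>One antiderivative \<open>\<Gamma>\<close> of the integrand along the line handles all
  subsegments at once, so that reversing and halving a segment become arithmetic with values of
  \<open>\<Gamma>\<close>.\<close>

lemma segment_integral_parts:
  assumes G: "continuous_on K G" "convex K" "a \<in> K" "b \<in> K"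
  obtains \<Gamma> where "\<And>s s'. s \<in> {0..1} \<Longrightarrow> s' \<in> {0..1} \<Longrightarrow>
    segment_integral G (a + s *\<^sub>R (b - a)) (a + s' *\<^sub>R (b - a)) = \<Gamma> s' - \<Gamma> s"
proof -
  define g where "g t = A (b - a) (G (a + t *\<^sub>R (b - a)))" for t
  have "continuous_on {0..1} g"
    unfolding g_def using segment_in_convex[OF G(2-4)]
    by (intro continuous_intros continuous_on_compose2[OF G(1)]) auto
  then obtain \<Gamma> where \<Gamma>: "\<And>t. t \<in> {0..1} \<Longrightarrow> (\<Gamma> has_vector_derivative g t) (at t within {0..1})"
    using antiderivative_continuous by metis
  have "segment_integral G (a + s *\<^sub>R (b - a)) (a + s' *\<^sub>R (b - a)) = \<Gamma> s' - \<Gamma> s"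
    if s: "s \<in> {0..1}" "s' \<in> {0..1}" for s s'
  proof -
    have mem: "s + t * (s' - s) \<in> {0..1}" if "t \<in> {0..1}" for t
      using convexD_alt[of "{0..1::real}" s s' t] s that by (auto simp: algebra_simps)
    have "((\<lambda>t. (s' - s) *\<^sub>R g (s + t * (s' - s))) has_integral
      \<Gamma> (s + 1 * (s' - s)) - \<Gamma> (s + 0 * (s' - s))) {0..1}"
    proof (rule fundamental_theorem_of_calculus)
      fix t :: real assume t: "t \<in> {0..1}"
      have 1: "((\<lambda>t. s + t * (s' - s)) has_derivative (\<lambda>h. h * (s' - s))) (at t within {0..1})"
        by (auto intro!: derivative_eq_intros)
      have "(\<Gamma> has_derivative (\<lambda>h. h *\<^sub>R g (s + t * (s' - s))))
          (at (s + t * (s' - s)) within (\<lambda>t. s + t * (s' - s)) ` {0..1})"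
        by (rule has_derivative_subset[OF \<Gamma>[OF mem[OF t], unfolded has_vector_derivative_def]])
          (rule image_subsetI, rule mem)
      from has_derivative_in_compose[OF 1 this]
      show "((\<lambda>t. \<Gamma> (s + t * (s' - s))) has_vector_derivative
          (s' - s) *\<^sub>R g (s + t * (s' - s))) (at t within {0..1})"
        by (simp add: has_vector_derivative_def mult.commute)
    qed auto
    moreover have "A (a + s' *\<^sub>R (b - a) - (a + s *\<^sub>R (b - a)))
        (G (a + s *\<^sub>R (b - a) + t *\<^sub>R (a + s' *\<^sub>R (b - a) - (a + s *\<^sub>R (b - a)))))
      = (s' - s) *\<^sub>R g (s + t * (s' - s))" for t
    proof -
      have "a + s' *\<^sub>R (b - a) - (a + s *\<^sub>R (b - a)) = (s' - s) *\<^sub>R (b - a)"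
        by (simp add: algebra_simps)
      moreover have "a + s *\<^sub>R (b - a) + t *\<^sub>R ((s' - s) *\<^sub>R (b - a)) = a + (s + t * (s' - s)) *\<^sub>R (b - a)"
        by (simp add: algebra_simps)
      ultimately show ?thesis
        unfolding g_def by (simp only: linear_scale[OF linear_A] blinfun.scaleR_left)
    qed
    ultimately show ?thesis
      unfolding segment_integral_def by (simp only: integral_unique) simp
  qed
  then show thesis using that by blast
qed

lemma segment_integral_swap:
  assumes "continuous_on K G" "convex K" "a \<in> K" "b \<in> K"
  shows "segment_integral G b a = - segment_integral G a b"
proof -
  obtain \<Gamma> where \<Gamma>: "\<And>s s'. s \<in> {0..1} \<Longrightarrow> s' \<in> {0..1} \<Longrightarrow>
    segment_integral G (a + s *\<^sub>R (b - a)) (a + s' *\<^sub>R (b - a)) = \<Gamma> s' - \<Gamma> s"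
    using segment_integral_parts[OF assms] by blast
  show ?thesis using \<Gamma>[of 0 1] \<Gamma>[of 1 0] by simp
qed

lemma segment_integral_midpoint:
  assumes "continuous_on K G" "convex K" "a \<in> K" "b \<in> K"
  shows "segment_integral G a b = segment_integral G a (midpoint a b) + segment_integral G (midpoint a b) b"
proof -
  obtain \<Gamma> where \<Gamma>: "\<And>s s'. s \<in> {0..1} \<Longrightarrow> s' \<in> {0..1} \<Longrightarrow>
    segment_integral G (a + s *\<^sub>R (b - a)) (a + s' *\<^sub>R (b - a)) = \<Gamma> s' - \<Gamma> s"
    using segment_integral_parts[OF assms] by blast
  have m: "a + (1/2) *\<^sub>R (b - a) = midpoint a b"
    by (simp add: midpoint_def euclidean_eq_iff[where 'a='e] algebra_simps)
  show ?thesis using \<Gamma>[of 0 1] \<Gamma>[of 0 "1/2"] \<Gamma>[of "1/2" 1] by (simp add: m)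
qed

lemma segment_integral_bound:
  assumes "continuous_on K G" "convex K" "a \<in> K" "b \<in> K"
    and "\<And>t. t \<in> {0..1} \<Longrightarrow> norm (G (a + t *\<^sub>R (b - a))) \<le> M"
  shows "norm (segment_integral G a b) \<le> norm (A (b - a)) * M"
proof -
  have "norm (A (b - a) (G (a + t *\<^sub>R (b - a)))) \<le> norm (A (b - a)) * M" if "t \<in> {0..1}" for t
    using norm_blinfun[of "A (b - a)"] assms(5)[OF that] by (meson mult_left_mono norm_ge_zero order_trans)
  moreover have "0 \<le> norm (A (b - a)) * M"
    using assms(5)[of 0] by (simp add: order_trans[OF norm_ge_zero])
  ultimately show ?thesis
    using has_integral_bound_real[OF _ finite.emptyI integrable_integral[OF segment_integrable[OF assms(1-4)]],
        of "norm (A (b - a)) * M"] by (simp add: segment_integral_def)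
qed

definition triangle_integral :: "('e \<Rightarrow> 'm) \<Rightarrow> 'e \<times> 'e \<times> 'e \<Rightarrow> 'm" where
  "triangle_integral G = (\<lambda>(a, b, c). segment_integral G a b + segment_integral G b c + segment_integral G c a)"

text \<open>Each side of the medial triangle is traversed twice, in opposite directions, and the
  sides of the given triangle split at their midpoints.\<close>

lemma triangle_quadrisection:
  assumes G: "continuous_on K G" "convex K" and K: "a \<in> K" "b \<in> K" "c \<in> K"
  defines "a' \<equiv> midpoint b c" and "b' \<equiv> midpoint c a" and "c' \<equiv> midpoint a b"
  shows "triangle_integral G (a, b, c) = triangle_integral G (a, c', b') + triangle_integral G (c', b, a')
    + triangle_integral G (b', a', c) + triangle_integral G (a', b', c')"
proof -
  have K': "a' \<in> K" "b' \<in> K" "c' \<in> K"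
    using K closed_segment_subset[OF _ _ G(2)] midpoint_in_closed_segment
    unfolding a'_def b'_def c'_def by (metis in_mono)+
  note sw = segment_integral_swap[OF G]
  show ?thesis
    using segment_integral_midpoint[OF G K(1,2)] segment_integral_midpoint[OF G K(2,3)]
      segment_integral_midpoint[OF G K(3,1)] sw[OF K'(1,2)] sw[OF K'(2,3)] sw[OF K'(3,1)]
    unfolding a'_def[symmetric] b'_def[symmetric] c'_def[symmetric] triangle_integral_def
    by (simp add: algebra_simps)
qed

text \<open>The exact case of Goursat's argument: a first-order Taylor polynomial of the admissible
  form has a quadratic primitive \<open>\<Psi>\<close>. Commutativity of the operators merges the
  two terms of the product rule, and the factor 1/2 absorbs the result.\<close>

lemma triangle_integral_affine:
  "triangle_integral (\<lambda>y. g + A (y - x) g') (a, b, c) = 0"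
proof -
  define \<Psi> where "\<Psi> y = A (y - x) g + (1/2) *\<^sub>R A (y - x) (A (y - x) g')" for y
  have "(\<Psi> has_derivative (\<lambda>h. A h (g + A (y - x) g'))) (at y)" for y
  proof -
    have d: "((\<lambda>y. A (y - x)) has_derivative A) (at y)"
      by (rule bounded_linear.has_derivative[OF bounded_linear_A, of "\<lambda>y. y - x" "\<lambda>h. h"])
        (auto intro!: derivative_eq_intros)
    have d1: "((\<lambda>y. A (y - x) v) has_derivative (\<lambda>h. A h v)) (at y)" for v
      using bounded_linear.has_derivative[OF blinfun.bounded_linear_left d] .
    have "((\<lambda>y. A (y - x) (A (y - x) g')) has_derivative
        (\<lambda>h. A (y - x) (A h g') + A h (A (y - x) g'))) (at y)"
      using blinfun.FDERIV[OF d d1[of g']] .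
    then have "((\<lambda>y. A (y - x) (A (y - x) g')) has_derivative
        (\<lambda>h. 2 *\<^sub>R A h (A (y - x) g'))) (at y)"
      by (simp add: A_commute'[of "y - x"] scaleR_2)
    from has_derivative_add[OF d1[of g] has_derivative_scaleR_right[OF this, of "1/2"]]
    show ?thesis by (simp add: \<Psi>_def[abs_def] blinfun.add_right)
  qed
  then show ?thesis
    using segment_integral_exact[of \<Psi> "\<lambda>y. g + A (y - x) g'"]
    unfolding triangle_integral_def by simp
qed


lemma segment_integral_diff:
  assumes "continuous_on K G" "continuous_on K H" "convex K" "a \<in> K" "b \<in> K"
  shows "segment_integral (\<lambda>y. G y - H y) a b = segment_integral G a b - segment_integral H a b"
  unfolding segment_integral_def blinfun.diff_right
  using segment_integrable[OF assms(1,3-5)] segment_integrable[OF assms(2-5)]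
  by (rule Henstock_Kurzweil_Integration.integral_diff)

text \<open>The perimeter serves in place of the diameter because it is exactly halved when a
  triangle is cut at the midpoints of its sides.\<close>

lemma convex_hull3_dist:
  assumes "x \<in> convex hull {a, b, c}" "y \<in> convex hull {a, b, c :: 'e}"
  shows "dist x y \<le> dist a b + dist b c + dist c a"
proof -
  define p where "p = dist a b + dist b c + dist c a"
  have "convex hull {a, b, c} \<subseteq> cball v p" if "v \<in> {a, b, c}" for v
    by (rule hull_minimal) (use that in \<open>auto simp: p_def dist_commute\<close>)
  then have "convex hull {a, b, c} \<subseteq> cball x p"
    using assms(1) by (intro hull_minimal) (auto simp: dist_commute subset_iff)
  then show ?thesis using assms(2) by (auto simp: p_def)
qed

text \<open>Subtracting the first-order model changes nothing, since its triangle integral vanishes;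
  what remains is the error times the length of the path, times the norm bound of
  \<open>A\<close>.\<close>

lemma triangle_integral_approx:
  assumes G: "continuous_on (convex hull {a, b, c}) G"
    and e: "\<And>y. y \<in> convex hull {a, b, c} \<Longrightarrow> norm (G y - (g + A (y - x) g')) \<le> M"
    and K: "\<And>h. norm (A h) \<le> K * norm h"
  shows "norm (triangle_integral G (a, b, c)) \<le> K * (dist a b + dist b c + dist c a) * M"
proof -
  let ?C = "convex hull {a, b, c}"
  let ?H = "\<lambda>y. g + A (y - x) g'"
  have cx: "convex ?C" and mem: "a \<in> ?C" "b \<in> ?C" "c \<in> ?C"
    by (auto intro: hull_inc)
  have Hc: "continuous_on ?C ?H" by (intro continuous_intros)
  have "M \<ge> 0" using e[OF mem(1)] norm_ge_zero order_trans by blast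
  have seg: "norm (segment_integral (\<lambda>y. G y - ?H y) v w) \<le> K * dist v w * M"
    if "v \<in> ?C" "w \<in> ?C" for v w
  proof -
    have "norm (segment_integral (\<lambda>y. G y - ?H y) v w) \<le> norm (A (w - v)) * M"
      using segment_in_convex[OF cx that] e
      by (intro segment_integral_bound[OF continuous_on_diff[OF G Hc] cx that]) auto
    also have "\<dots> \<le> K * norm (w - v) * M"
      using K \<open>M \<ge> 0\<close> by (intro mult_right_mono) auto
    finally show ?thesis by (simp add: dist_norm norm_minus_commute)
  qed
  have "triangle_integral G (a, b, c) = triangle_integral G (a, b, c) - triangle_integral ?H (a, b, c)"
    by (simp add: triangle_integral_affine)
  also have "\<dots> = segment_integral (\<lambda>y. G y - ?H y) a b + segment_integral (\<lambda>y. G y - ?H y) b c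
      + segment_integral (\<lambda>y. G y - ?H y) c a"
    by (simp add: triangle_integral_def segment_integral_diff[OF G Hc cx] mem)
  also have "norm \<dots> \<le> K * dist a b * M + K * dist b c * M + K * dist c a * M"
    by (intro norm_triangle_le add_mono seg mem)
  finally show ?thesis by (simp add: algebra_simps)
qed

lemma triangle_bisect:
  assumes G: "continuous_on (convex hull {a, b, c}) G" and t: "norm (triangle_integral G (a, b, c)) \<ge> t"
  obtains x y z where "convex hull {x, y, z} \<subseteq> convex hull {a, b, c}"
    "dist x y + dist y z + dist z x = (dist a b + dist b c + dist c a) / 2"
    "norm (triangle_integral G (x, y, z)) \<ge> t / 4"
proof -
  let ?C = "convex hull {a, b, c}"
  define a' b' c' where "a' = midpoint b c" and "b' = midpoint c a" and "c' = midpoint a b"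
  have mem: "a \<in> ?C" "b \<in> ?C" "c \<in> ?C" by (auto intro: hull_inc)
  have K': "a' \<in> ?C" "b' \<in> ?C" "c' \<in> ?C"
    using mem closed_segment_subset[OF _ _ convex_convex_hull] midpoint_in_closed_segment
    unfolding a'_def b'_def c'_def by (metis in_mono)+
  have hull: "convex hull {x, y, z} \<subseteq> ?C" if "x \<in> ?C" "y \<in> ?C" "z \<in> ?C" for x y z
    using that by (intro hull_minimal) auto
  have half: "dist (midpoint u v) (midpoint w u) = dist v w / 2" for u v w :: 'e
  proof -
    have "midpoint u v - midpoint w u = (1/2) *\<^sub>R (v - w)"
      by (simp add: midpoint_def algebra_simps)
    then show ?thesis by (simp add: dist_norm)
  qed
  have half2: "dist u (midpoint u v) = dist u v / 2" "dist (midpoint u v) v = dist u v / 2" for u v :: 'e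
    by (simp_all add: dist_midpoint)
  have ds: "dist a c' = dist a b / 2" "dist c' b = dist a b / 2" "dist b a' = dist b c / 2" "dist a' c = dist b c / 2"
     "dist c b' = dist c a / 2" "dist b' a = dist c a / 2"
     "dist c' b' = dist b c / 2" "dist a' c' = dist c a / 2" "dist b' a' = dist a b / 2"
     "dist b' c' = dist b c / 2" "dist c' a' = dist c a / 2" "dist a' b' = dist a b / 2"
    using half[of a b c] half[of b c a] half[of c a b]
    unfolding a'_def b'_def c'_def by (simp_all only: half2 dist_commute[of "midpoint b c" "midpoint c a"]
      dist_commute[of "midpoint c a" "midpoint a b"] dist_commute[of "midpoint a b" "midpoint b c"])
  have "norm (triangle_integral G (a, b, c)) \<le> norm (triangle_integral G (a, c', b'))
     + norm (triangle_integral G (c', b, a')) + norm (triangle_integral G (b', a', c)) + norm (triangle_integral G (a', b', c'))"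
    unfolding triangle_quadrisection[OF G convex_convex_hull mem] a'_def[symmetric] b'_def[symmetric] c'_def[symmetric]
    by (intro norm_triangle_mono order_refl)
  then consider "norm (triangle_integral G (a, c', b')) \<ge> t / 4" | "norm (triangle_integral G (c', b, a')) \<ge> t / 4"
    | "norm (triangle_integral G (b', a', c)) \<ge> t / 4" | "norm (triangle_integral G (a', b', c')) \<ge> t / 4"
    using t by linarith
  then show thesis
  proof cases
    case 1 show ?thesis
      by (rule that[OF hull _ 1]) (simp_all add: mem K' ds add_divide_distrib)
  next
    case 2 show ?thesis
      by (rule that[OF hull _ 2]) (simp_all add: mem K' ds add_divide_distrib)
  next
    case 3 show ?thesis
      by (rule that[OF hull _ 3]) (simp_all add: mem K' ds add_divide_distrib)
  next
    case 4 show ?thesis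
      by (rule that[OF hull _ 4]) (simp_all add: mem K' ds add_divide_distrib)
  qed
qed

text \<open>Both sides of the estimate scale by 1/4 per bisection: the integral loses at most this
  factor, while the perimeter and the Taylor error, which is \<open>e\<close> times the perimeter,
  are each halved. Differentiability at the single common point \<open>l\<close> of the nested
  triangles then contradicts a nonzero integral.\<close>

theorem goursat:
  assumes der: "A_derivative_on U G G'" and sub: "convex hull {a, b, c} \<subseteq> U"
  shows "triangle_integral G (a, b, c) = 0"
proof (rule ccontr)
  assume "triangle_integral G (a, b, c) \<noteq> 0"
  define \<eta> where "\<eta> = norm (triangle_integral G (a, b, c))"
  define d where "d = dist a b + dist b c + dist c a"
  have \<eta>: "\<eta> > 0" using \<open>triangle_integral G (a, b, c) \<noteq> 0\<close> by (simp add: \<eta>_def)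
  have Gc: "continuous_on V G" if "V \<subseteq> U" for V
    using continuous_on_subset[OF A_derivative_on_continuous[OF der] that] .
  define hul where "hul = (\<lambda>(x, y, z). convex hull {x, y, z :: 'e})"
  define per where "per = (\<lambda>(x, y, z :: 'e). dist x y + dist y z + dist z x)"
  have "\<exists>\<tau>. \<forall>n. (hul (\<tau> n) \<subseteq> U \<and> per (\<tau> n) = d / 2 ^ n \<and> norm (triangle_integral G (\<tau> n)) \<ge> \<eta> / 4 ^ n)
      \<and> hul (\<tau> (Suc n)) \<subseteq> hul (\<tau> n)"
  proof (rule dependent_nat_choice)
    show "\<exists>x. hul x \<subseteq> U \<and> per x = d / 2 ^ 0 \<and> norm (triangle_integral G x) \<ge> \<eta> / 4 ^ 0"
      by (rule exI[of _ "(a, b, c)"]) (use sub in \<open>simp add: hul_def per_def d_def \<eta>_def\<close>)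
  next
    fix \<tau> n assume *: "hul \<tau> \<subseteq> U \<and> per \<tau> = d / 2 ^ n \<and> norm (triangle_integral G \<tau>) \<ge> \<eta> / 4 ^ n"
    obtain u v w where \<tau>: "\<tau> = (u, v, w)" by (cases \<tau>)
    obtain x y z where xyz: "convex hull {x, y, z} \<subseteq> convex hull {u, v, w}"
      "dist x y + dist y z + dist z x = (dist u v + dist v w + dist w u) / 2"
      "norm (triangle_integral G (x, y, z)) \<ge> \<eta> / 4 ^ n / 4"
      using triangle_bisect[of u v w G "\<eta> / 4 ^ n"] * Gc by (auto simp: \<tau> hul_def)
    show "\<exists>y. (hul y \<subseteq> U \<and> per y = d / 2 ^ Suc n \<and> norm (triangle_integral G y) \<ge> \<eta> / 4 ^ Suc n) \<and> hul y \<subseteq> hul \<tau>"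
      by (rule exI[of _ "(x, y, z)"]) (use xyz * in \<open>auto simp: \<tau> hul_def per_def mult.commute\<close>)
  qed
  then obtain \<tau> where \<tau>: "\<And>n. hul (\<tau> n) \<subseteq> U" "\<And>n. per (\<tau> n) = d / 2 ^ n"
      "\<And>n. norm (triangle_integral G (\<tau> n)) \<ge> \<eta> / 4 ^ n" "\<And>n. hul (\<tau> (Suc n)) \<subseteq> hul (\<tau> n)"
    by blast
  have "\<Inter>(range (\<lambda>n. hul (\<tau> n))) \<noteq> {}"
  proof (rule compact_nest)
    show "compact (hul (\<tau> n))" for n by (auto simp: hul_def split: prod.splits intro!: finite_imp_compact_convex_hull)
    show "hul (\<tau> n) \<noteq> {}" for n by (auto simp: hul_def split: prod.splits)
    show "hul (\<tau> n) \<subseteq> hul (\<tau> m)" if "m \<le> n" for m n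
      using that by (induction n rule: dec_induct) (use \<tau>(4) in blast)+
  qed
  then obtain l where l: "\<And>n. l \<in> hul (\<tau> n)" by blast
  obtain K where K: "K \<ge> 1" "\<And>h. norm (A h) \<le> K * norm h" using norm_A_bound by blast
  \<comment> \<open>The summand 1 keeps \<open>k\<close> positive for a degenerate triangle, where
    \<open>d = 0\<close>.\<close>
  define k where "k = K * d\<^sup>2 + 1"
  have Kd: "k > 0" using K by (simp add: k_def add_nonneg_pos)
  define e where "e = \<eta> / (2 * k)"
  have e: "e > 0" using \<eta> Kd by (simp add: e_def)
  have "(G has_derivative (\<lambda>h. A h (G' l))) (at l)"
    using der l[of 0] \<tau>(1)[of 0] by (auto simp: A_derivative_on_def)
  then obtain \<delta> where \<delta>: "\<delta> > 0" "\<And>y. norm (y - l) < \<delta> \<Longrightarrow> norm (G y - G l - A (y - l) (G' l)) \<le> e * norm (y - l)"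
    using e unfolding has_derivative_at_alt by blast
  have "(\<lambda>n. d * (1 / 2) ^ n) \<longlonglongrightarrow> 0" by (intro tendsto_mult_right_zero LIMSEQ_power_zero) auto
  then have "\<forall>\<^sub>F n in sequentially. d * (1 / 2) ^ n < \<delta>" using order_tendstoD(2) \<delta>(1) by blast
  then obtain n where "d * (1 / 2) ^ n < \<delta>" using eventually_happens'[OF sequentially_bot] by blast
  then have n: "d / 2 ^ n < \<delta>" by (simp add: power_divide)
  obtain u v w where uvw: "\<tau> n = (u, v, w)" by (cases "\<tau> n")
  have dn: "dist u v + dist v w + dist w u = d / 2 ^ n" using \<tau>(2)[of n] by (simp add: uvw per_def)
  have "norm (triangle_integral G (u, v, w)) \<le> K * (dist u v + dist v w + dist w u) * (e * (d / 2 ^ n))"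
  proof (rule triangle_integral_approx[OF _ _ K(2)])
    show "continuous_on (convex hull {u, v, w}) G" using Gc \<tau>(1)[of n] by (auto simp: uvw hul_def)
    fix y assume "y \<in> convex hull {u, v, w}"
    then have dy: "norm (y - l) \<le> d / 2 ^ n"
      using convex_hull3_dist[of y u v w l] l[of n] dn by (simp add: uvw hul_def dist_norm)
    then have "norm (G y - G l - A (y - l) (G' l)) \<le> e * norm (y - l)"
      using n by (intro \<delta>(2)) auto
    also have "\<dots> \<le> e * (d / 2 ^ n)" using dy e by (intro mult_left_mono) auto
    finally show "norm (G y - (G l + A (y - l) (G' l))) \<le> e * (d / 2 ^ n)"
      by (simp add: algebra_simps)
  qed
  then have "\<eta> / 4 ^ n \<le> K * (d / 2 ^ n) * (e * (d / 2 ^ n))"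
    using \<tau>(3)[of n] by (simp add: uvw dn)
  also have "\<dots> = K * d\<^sup>2 * e / 4 ^ n"
    by (simp add: power2_eq_square power_mult_distrib[symmetric])
  finally have "\<eta> \<le> K * d\<^sup>2 * e" by (simp add: divide_le_cancel)
  also have "\<dots> \<le> k * e" using e by (intro mult_right_mono) (auto simp: k_def)
  also have "\<dots> = \<eta> / 2" using Kd by (simp add: e_def)
  finally show False using \<eta> by simp
qed

text \<open>The primitive is the integral from the centre. Goursat's lemma for the triangle
  \<open>x0\<close>, \<open>x\<close>, \<open>y\<close> rewrites its increment as an integral over
  the short segment from \<open>x\<close> to \<open>y\<close>, where continuity of \<open>G\<close>
  applies. The gain is that \<open>P\<close> has a continuous \<open>A\<close>-derivative, which
  \<open>G\<close> is not yet known to have; this permits differentiation under integral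
  signs.\<close>

theorem A_primitive_ball:
  assumes der: "A_derivative_on (ball x0 r) G G'"
  obtains P where "A_derivative_on (ball x0 r) P G"
proof -
  let ?U = "ball x0 r"
  define P where "P x = segment_integral G x0 x" for x
  have Gc: "continuous_on ?U G" using A_derivative_on_continuous[OF der] .
  obtain K where K: "K \<ge> 1" "\<And>h. norm (A h) \<le> K * norm h" using norm_A_bound by blast
  have "(P has_derivative (\<lambda>h. A h (G x))) (at x)" if x: "x \<in> ?U" for x
    unfolding has_derivative_at_alt
  proof (intro conjI allI impI)
    show "bounded_linear (\<lambda>h. A h (G x))"
      using bounded_linear_compose[OF blinfun.bounded_linear_left bounded_linear_A] .
    fix e :: real assume "e > 0"
    then have "e / K > 0" using K by simp
    then obtain \<delta> where \<delta>: "\<delta> > 0" "\<And>y. y \<in> ?U \<Longrightarrow> dist y x < \<delta> \<Longrightarrow> dist (G y) (G x) < e / K"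
      using Gc x unfolding continuous_on_iff by blast
    obtain \<delta>' where \<delta>': "\<delta>' > 0" "ball x \<delta>' \<subseteq> ?U" using x openE[OF open_ball] by blast
    have "norm (P y - P x - A (y - x) (G x)) \<le> e * norm (y - x)" if y: "norm (y - x) < min \<delta> \<delta>'" for y
    proof -
      have yU: "y \<in> ?U" using y \<delta>' by (auto simp: dist_norm norm_minus_commute)
      have x0U: "x0 \<in> ?U" using x by (auto intro: le_less_trans[OF zero_le_dist])
      have "convex hull {x0, x, y} \<subseteq> ?U" using x yU x0U by (intro hull_minimal) auto
      from goursat[OF der this]
      have "P y - P x = segment_integral G x y"
        using segment_integral_swap[OF Gc convex_ball x0U yU]
        by (simp add: triangle_integral_def P_def algebra_simps)
      moreover have "segment_integral (\<lambda>_. G x) x y = A (y - x) (G x)"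
        by (simp add: segment_integral_def)
      ultimately have "P y - P x - A (y - x) (G x) = segment_integral (\<lambda>z. G z - G x) x y"
        using segment_integral_diff[OF Gc continuous_on_const convex_ball x yU, of "G x"] by simp
      also have "norm \<dots> \<le> norm (A (y - x)) * (e / K)"
      proof (rule segment_integral_bound[OF _ convex_ball x yU])
        show "continuous_on ?U (\<lambda>z. G z - G x)" by (intro continuous_intros Gc)
        fix t :: real assume t: "t \<in> {0..1}"
        have "norm (t *\<^sub>R (y - x)) \<le> norm (y - x)" using t by (simp add: mult_left_le_one_le)
        then have "dist (x + t *\<^sub>R (y - x)) x < \<delta>" using y by (simp add: dist_norm)
        then show "norm (G (x + t *\<^sub>R (y - x)) - G x) \<le> e / K"
          using \<delta>(2) segment_in_convex[OF convex_ball x yU t] by (simp add: dist_norm less_imp_le)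
      qed
      also have "\<dots> \<le> K * norm (y - x) * (e / K)"
        using K \<open>e > 0\<close> by (intro mult_right_mono) auto
      finally show ?thesis using K(1) by (simp add: field_simps)
    qed
    then show "\<exists>d>0. \<forall>y. norm (y - x) < d \<longrightarrow> norm (P y - P x - A (y - x) (G x)) \<le> e * norm (y - x)"
      using \<delta>(1) \<delta>'(1) by (intro exI[of _ "min \<delta> \<delta>'"]) auto
  qed
  then show thesis using that[of P] by (simp add: A_derivative_on_def)
qed

end

section \<open>The mean value property and Cauchy estimates\<close>

text \<open>This radial kernel is supported in the unit ball for \<open>n > 0\<close>, and its
  gradient is a multiple of \<open>y\<close> times the kernel of the next lower order. The first
  moments against one kernel are thus integrals against derivatives of another one.\<close>

definition bump :: "nat \<Rightarrow> 'e::euclidean_space \<Rightarrow> real" where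
  "bump n y = (max 0 (1 - y \<bullet> y)) ^ n"

lemma has_derivative_pos_part_power:
  "((\<lambda>t::real. max 0 t ^ (n + 2)) has_field_derivative (real n + 2) * max 0 t ^ (n + 1)) (at t)"
proof -
  have pos: ?thesis if t: "t > 0"
  proof -
    have "((\<lambda>t::real. t ^ (n + 2)) has_field_derivative real (n + 2) * t ^ (n + 2 - Suc 0)) (at t)"
      by (rule DERIV_pow)
    then have "((\<lambda>t::real. max 0 t ^ (n + 2)) has_field_derivative real (n + 2) * t ^ (n + 2 - Suc 0)) (at t)"
      by (rule has_field_derivative_transform_within_open[of _ _ _ "{0<..}"]) (use t in \<open>simp_all add: max_def\<close>)
    then show ?thesis using t by (simp add: max_def add_ac)
  qed
  have neg: ?thesis if t: "t < 0"
  proof -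
    have "((\<lambda>t::real. 0) has_field_derivative (0::real)) (at t)" by (rule DERIV_const)
    then have "((\<lambda>t::real. max 0 t ^ (n + 2)) has_field_derivative 0) (at t)"
      by (rule has_field_derivative_transform_within_open[of _ _ _ "{..<0}"]) (use t in \<open>simp_all add: max_def\<close>)
    then show ?thesis using t by (simp add: max_def)
  qed
  have zero: "((\<lambda>t::real. max 0 t ^ (n + 2)) has_field_derivative (real n + 2) * max 0 0 ^ (n + 1)) (at 0)"
  proof -
    have l: "((\<lambda>h::real. max 0 h ^ (n + 1)) \<longlongrightarrow> max 0 0 ^ (n + 1)) (at 0)"
      by (rule tendsto_power[OF tendsto_max[OF tendsto_const tendsto_ident_at]])
    have "max 0 h ^ (n + 1) = max 0 h ^ (n + 2) / h" if "h \<noteq> 0" for h :: real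
      using that by (simp add: max_def)
    with l have "((\<lambda>h::real. max 0 h ^ (n + 2) / h) \<longlongrightarrow> max 0 0 ^ (n + 1)) (at 0)"
      by (rule_tac Lim_transform_within[where d=1]) simp_all
    then show ?thesis by (simp add: DERIV_def)
  qed
  have "((\<lambda>t::real. max 0 t ^ (n + 2)) has_field_derivative (real n + 2) * max 0 t ^ (n + 1)) (at t)" if "t = 0"
    unfolding that by (rule zero)
  with pos neg show ?thesis by (meson linorder_cases)
qed

lemma bump_eq_0: "norm y \<ge> 1 \<Longrightarrow> n > 0 \<Longrightarrow> bump n y = 0"
  by (simp add: bump_def dot_square_norm)

lemma continuous_on_bump [continuous_intros]: "continuous_on S f \<Longrightarrow> continuous_on S (\<lambda>y. bump n (f y))"
  unfolding bump_def by (intro continuous_intros)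

lemma has_derivative_bump:
  "(bump (n + 2) has_derivative (\<lambda>h. - (2 * (real n + 2)) * bump (n + 1) y * (y \<bullet> h))) (at y)"
proof -
  have "((\<lambda>y. 1 - y \<bullet> y) has_derivative (\<lambda>h. - (2 * (y \<bullet> h)))) (at y)"
    by (auto intro!: derivative_eq_intros simp: inner_commute)
  from has_derivative_compose[OF this has_derivative_pos_part_power[of n, unfolded has_field_derivative_def]]
  show ?thesis
    unfolding bump_def[abs_def] by (rule has_derivative_eq_rhs) (simp add: fun_eq_iff algebra_simps)
qed

text \<open>The cube contains the ball of radius 2, so functions supported in the unit ball may be
  shifted by vectors of norm at most 1 without their support leaving it.\<close>

abbreviation box2 :: "'e::euclidean_space set" where "box2 \<equiv> cbox (- (2 *\<^sub>R One)) (2 *\<^sub>R One)"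

lemma box2_norm:
  assumes "norm y \<le> 2"
  shows "y \<in> (box2 :: 'e::euclidean_space set)"
  unfolding mem_box
proof
  fix i :: 'e assume i: "i \<in> Basis"
  have "\<bar>y \<bullet> i\<bar> \<le> 2" using Basis_le_norm[OF i, of y] assms by linarith
  then show "- (2 *\<^sub>R One) \<bullet> i \<le> y \<bullet> i \<and> y \<bullet> i \<le> (2 *\<^sub>R One) \<bullet> i" using i by (auto simp: abs_le_iff)
qed

lemma integral_box2_shift:
  fixes \<phi> :: "'e::euclidean_space \<Rightarrow> 'm::euclidean_space"
  assumes "continuous_on UNIV \<phi>" "\<And>y. norm y \<ge> 1 \<Longrightarrow> \<phi> y = 0" "norm c \<le> 1"
  shows "integral box2 (\<lambda>y. \<phi> (y + c)) = integral box2 \<phi>"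
proof -
  let ?I = "integral box2 \<phi>" and ?\<psi> = "\<lambda>y. \<phi> (y + c)"
  have "(\<phi> has_integral ?I) box2"
    using assms(1) by (intro integrable_integral integrable_continuous continuous_on_subset[OF assms(1)]) auto
  from has_integral_shift_cbox[OF this, of c]
  have "(?\<psi> has_integral ?I) UNIV"
  proof (rule has_integral_on_superset)
    fix y assume "y \<notin> cbox (- (2 *\<^sub>R One) - c) (2 *\<^sub>R One - c)"
    then have "y + c \<notin> box2" by (auto simp: mem_box algebra_simps)
    then have "norm (y + c) > 2" using box2_norm by force
    then show "\<phi> (y + c) = 0" using assms(2) by auto
  qed simp
  moreover have "(\<lambda>y. if y \<in> box2 then ?\<psi> y else 0) = ?\<psi>"
  proof
    fix y
    have "\<phi> (y + c) = 0" if "y \<notin> box2"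
    proof -
      have "norm y > 2" using box2_norm that by force
      then have "norm (y + c) \<ge> 1" using assms(3) norm_diff_ineq[of y c] by linarith
      then show ?thesis using assms(2) by auto
    qed
    then show "(if y \<in> box2 then ?\<psi> y else 0) = ?\<psi> y" by auto
  qed
  ultimately have "(?\<psi> has_integral ?I) box2"
    using has_integral_restrict_UNIV[of box2 ?\<psi> ?I] by simp
  then show ?thesis by (rule integral_unique)
qed

text \<open>By translation invariance the integral of \<open>\<phi>\<close> shifted by
  \<open>t h\<close> does not depend on \<open>t\<close>; its derivative at \<open>t = 0\<close> is
  the integral in question. This takes the place of the divergence theorem.\<close>

lemma integral_box2_derivative_eq_0:
  fixes \<phi> :: "'e::euclidean_space \<Rightarrow> 'm::euclidean_space"
  assumes der: "\<And>y. (\<phi> has_derivative \<phi>' y) (at y)" and cont: "continuous_on UNIV (\<lambda>y. \<phi>' y h)"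
    and supp: "\<And>y. norm y \<ge> 1 \<Longrightarrow> \<phi> y = 0" and h: "norm h \<le> 1"
  shows "integral box2 (\<lambda>y. \<phi>' y h) = 0"
proof -
  let ?g = "\<lambda>t. integral box2 (\<lambda>y. \<phi> (y + t *\<^sub>R h))"
  let ?U = "{-1..1::real}"
  have \<phi>c: "continuous_on UNIV \<phi>"
    using der by (intro continuous_at_imp_continuous_on) (auto intro: has_derivative_continuous)
  have "(?g has_vector_derivative integral box2 (\<lambda>y. \<phi>' (y + 0 *\<^sub>R h) h)) (at 0 within ?U)"
  proof (rule leibniz_rule_vector_derivative)
    fix t :: real and y :: 'e
    have "((\<lambda>t. y + t *\<^sub>R h) has_derivative (\<lambda>s. s *\<^sub>R h)) (at t within ?U)"
      by (auto intro!: derivative_eq_intros)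
    from has_derivative_compose[OF this der]
    show "((\<lambda>t. \<phi> (y + t *\<^sub>R h)) has_vector_derivative \<phi>' (y + t *\<^sub>R h) h) (at t within ?U)"
      using linear_scale[OF has_derivative_linear[OF der]] by (simp add: has_vector_derivative_def)
  next
    fix t :: real
    show "(\<lambda>y. \<phi> (y + t *\<^sub>R h)) integrable_on box2"
      by (intro integrable_continuous continuous_on_compose2[OF \<phi>c] continuous_intros) auto
  next
    show "continuous_on (?U \<times> box2) (\<lambda>(t, y). \<phi>' (y + t *\<^sub>R h) h)"
      unfolding split_beta by (intro continuous_on_compose2[OF cont] continuous_intros) auto
  qed auto
  moreover have "(?g has_vector_derivative 0) (at 0 within ?U)"
  proof -
    have "?g t = integral box2 \<phi>" if "t \<in> ?U" for t
      using that h by (intro integral_box2_shift \<phi>c supp) (auto intro!: mult_le_one)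
    then show ?thesis
      by (intro has_vector_derivative_transform[OF _ _ has_vector_derivative_const[of "integral box2 \<phi>"]]) simp_all
  qed
  ultimately have "integral box2 (\<lambda>y. \<phi>' (y + 0 *\<^sub>R h) h) = 0"
    by (intro vector_derivative_unique_within_closed_interval[of "-1" 1 0 ?g]) simp_all
  then show ?thesis by simp
qed

text \<open>Two open sets cover the domain: where \<open>g t y\<close> lies in \<open>V\<close> the
  product is continuous, and where \<open>norm y > 1\<close> it is 0. So \<open>F\<close> may behave
  arbitrarily outside \<open>V\<close>.\<close>

lemma continuous_on_cutoff:
  fixes g :: "'t::topological_space \<Rightarrow> 'y::euclidean_space \<Rightarrow> 'e::topological_space"
    and F :: "'e \<Rightarrow> 'm::real_normed_vector"
  assumes \<kappa>: "continuous_on UNIV \<kappa>" "\<And>y. norm y > 1 \<Longrightarrow> \<kappa> y = 0"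
    and F: "continuous_on V F" "open V" and T: "open T"
    and g: "continuous_on (T \<times> UNIV) (\<lambda>(t, y). g t y)"
    and V: "\<And>t y. t \<in> T \<Longrightarrow> norm y \<le> 1 \<Longrightarrow> g t y \<in> V"
  shows "continuous_on (T \<times> UNIV) (\<lambda>(t, y). \<kappa> y *\<^sub>R F (g t y))"
proof -
  let ?A = "{z \<in> T \<times> UNIV. (\<lambda>(t, y). g t y) z \<in> V}" and ?B = "T \<times> {y::'y. norm y > 1}"
  have op: "open (T \<times> (UNIV :: 'y set))" using T by (intro open_Times) auto
  have A: "open ?A"
    using continuous_open_preimage[OF g op F(2)] by (simp only: vimage_def Int_def mem_Collect_eq)
  have "open {y::'y. norm y > 1}" by (intro open_Collect_less continuous_intros)
  then have B: "open ?B" using T by (intro open_Times) auto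
  have "continuous_on ?A (\<lambda>z. F ((\<lambda>(t, y). g t y) z))"
    by (rule continuous_on_compose2[OF F(1) continuous_on_subset[OF g]]) auto
  moreover have "continuous_on ?A (\<lambda>z. \<kappa> (snd z))"
    by (intro continuous_on_compose2[OF \<kappa>(1)] continuous_intros) auto
  ultimately have cA: "continuous_on ?A (\<lambda>(t, y). \<kappa> y *\<^sub>R F (g t y))"
    unfolding split_beta by (intro continuous_intros)
  have cB: "continuous_on ?B (\<lambda>(t, y). \<kappa> y *\<^sub>R F (g t y))"
    by (rule continuous_on_eq[OF continuous_on_const[of _ 0]]) (auto simp: \<kappa>(2))
  have "T \<times> UNIV \<subseteq> ?A \<union> ?B" using V by (auto simp: not_less)
  with continuous_on_open_Un[OF A B cA cB] show ?thesis by (rule continuous_on_subset)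
qed

lemma continuous_on_cutoff1:
  fixes g :: "'y::euclidean_space \<Rightarrow> 'e::topological_space" and F :: "'e \<Rightarrow> 'm::real_normed_vector"
  assumes "continuous_on UNIV \<kappa>" "\<And>y. norm y > 1 \<Longrightarrow> \<kappa> y = 0"
    and "continuous_on V F" "open V" "continuous_on UNIV g" "\<And>y. norm y \<le> 1 \<Longrightarrow> g y \<in> V"
  shows "continuous_on S (\<lambda>y. \<kappa> y *\<^sub>R F (g y))"
proof -
  have "continuous_on (UNIV \<times> UNIV) (\<lambda>(t::real, y). g y)"
    unfolding split_beta by (rule continuous_on_compose2[OF assms(5)]) (auto intro!: continuous_intros)
  from continuous_on_cutoff[OF assms(1-4) open_UNIV this assms(6)]
  have "continuous_on (UNIV \<times> UNIV) (\<lambda>(t::real, y). \<kappa> y *\<^sub>R F (g y))" by blast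
  moreover have "continuous_on S (\<lambda>y::'y. (0::real, y))" by (intro continuous_intros)
  ultimately show ?thesis
    using continuous_on_compose2[of "UNIV \<times> UNIV" "\<lambda>(t::real, y). \<kappa> y *\<^sub>R F (g y)" S "\<lambda>y. (0, y)"] by simp
qed

section \<open>Convolution with kernels, integration by parts and the mean value property\<close>

context elliptic_symbol
begin

lemma A_expand: "A y v = (\<Sum>u\<in>Basis. (y \<bullet> u) *\<^sub>R A u v)"
proof -
  have "A y = A (\<Sum>u\<in>Basis. (y \<bullet> u) *\<^sub>R u)" by (simp add: euclidean_representation)
  also have "\<dots> = (\<Sum>u\<in>Basis. (y \<bullet> u) *\<^sub>R A u)" by (simp add: linear_sum[OF linear_A] linear_scale[OF linear_A])
  finally show ?thesis by (simp add: blinfun.sum_left blinfun.scaleR_left)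
qed

lemma sum_A_squares: "(\<Sum>u\<in>Basis. A u (A u v)) = 0"
proof -
  have "(\<Sum>u\<in>Basis. A u (A u v)) = (\<Sum>u\<in>Basis. A u o\<^sub>L A u) v" by (simp add: blinfun.sum_left)
  then show ?thesis by (simp add: A_squares)
qed

text \<open>Differentiation under the integral sign, after which the constant operator
  \<open>A h\<close> moves out of the integral. The condition
  \<open>\<rho> + \<delta> \<le> R\<close> keeps the points \<open>x + \<rho> y\<close> with
  \<open>norm y \<le> 1\<close> inside the ball where \<open>P\<close> is controlled.\<close>

lemma A_smoothing:
  assumes P: "A_derivative_on (ball x0 R) P G" and G: "continuous_on (ball x0 R) G"
    and \<rho>: "\<rho> \<ge> 0" "\<rho> + \<delta> \<le> R"
    and \<kappa>: "continuous_on UNIV \<kappa>" "\<And>y. norm y > 1 \<Longrightarrow> \<kappa> y = 0"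
  shows "A_derivative_on (ball x0 \<delta>) (\<lambda>x. integral box2 (\<lambda>y. \<kappa> y *\<^sub>R P (x + \<rho> *\<^sub>R y)))
    (\<lambda>x. integral box2 (\<lambda>y. \<kappa> y *\<^sub>R G (x + \<rho> *\<^sub>R y)))"
  unfolding A_derivative_on_def
proof
  fix x assume x: "x \<in> ball x0 \<delta>"
  let ?U = "ball x0 \<delta>"
  have mem: "x + \<rho> *\<^sub>R y \<in> ball x0 R" if "x \<in> ?U" "norm y \<le> 1" for x y
  proof -
    have "\<rho> * norm y \<le> \<rho>" using that \<rho>(1) by (simp add: mult_left_le)
    then have "norm (\<rho> *\<^sub>R y) \<le> \<rho>" using \<rho>(1) by simp
    then have "dist x0 (x + \<rho> *\<^sub>R y) < \<delta> + \<rho>"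
      using that(1) dist_triangle[of x0 "x + \<rho> *\<^sub>R y" x] by (simp add: dist_norm)
    then show ?thesis using \<rho> by simp
  qed
  have cont: "continuous_on S (\<lambda>y. \<kappa> y *\<^sub>R F (x + \<rho> *\<^sub>R y))"
    if "continuous_on (ball x0 R) F" "x \<in> ?U" for F :: "'e \<Rightarrow> 'm" and x S
    using mem[OF that(2)] by (intro continuous_on_cutoff1[OF \<kappa> that(1)] continuous_intros) auto
  have Pc: "continuous_on (ball x0 R) P" using A_derivative_on_continuous[OF P] .
  \<comment> \<open>The map \<open>h \<mapsto> A h v\<close> as a bounded operator, the form in
    which the Leibniz rule takes derivatives.\<close>
  define app where "app v = Blinfun (\<lambda>h. A h v)" for v
  have app: "app v h = A h v" for v h
    unfolding app_def by (intro bounded_linear_Blinfun_apply[THEN fun_cong]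
        bounded_linear_compose[OF blinfun.bounded_linear_left bounded_linear_A])
  have appc: "continuous_on (?U \<times> box2) (\<lambda>(x, y). app (\<kappa> y *\<^sub>R G (x + \<rho> *\<^sub>R y)))"
  proof (rule continuous_on_blinfun_componentwise)
    fix i :: 'e
    have "continuous_on (?U \<times> UNIV) (\<lambda>(x, y). x + \<rho> *\<^sub>R y)"
      unfolding split_beta by (intro continuous_intros)
    from continuous_on_cutoff[OF \<kappa> G open_ball open_ball this mem]
    have "continuous_on (?U \<times> box2) (\<lambda>(x, y). \<kappa> y *\<^sub>R G (x + \<rho> *\<^sub>R y))"
      by (rule continuous_on_subset) auto
    then show "continuous_on (?U \<times> box2) (\<lambda>z. (case z of (x, y) \<Rightarrow> app (\<kappa> y *\<^sub>R G (x + \<rho> *\<^sub>R y))) i)"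
      unfolding split_beta app by (intro blinfun.continuous_on continuous_on_const)
  qed
  have "((\<lambda>x. integral box2 (\<lambda>y. \<kappa> y *\<^sub>R P (x + \<rho> *\<^sub>R y))) has_derivative
      integral box2 (\<lambda>y. app (\<kappa> y *\<^sub>R G (x + \<rho> *\<^sub>R y)))) (at x within ?U)"
  proof (rule leibniz_rule[OF _ _ appc x convex_ball])
    fix x y assume x: "x \<in> ?U"
    show "((\<lambda>x. \<kappa> y *\<^sub>R P (x + \<rho> *\<^sub>R y)) has_derivative app (\<kappa> y *\<^sub>R G (x + \<rho> *\<^sub>R y))) (at x within ?U)"
    proof (cases "norm y \<le> 1")
      case True
      have 1: "((\<lambda>x. x + \<rho> *\<^sub>R y) has_derivative (\<lambda>h. h)) (at x within ?U)"
        by (auto intro!: derivative_eq_intros)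
      have "(P has_derivative (\<lambda>h. A h (G (x + \<rho> *\<^sub>R y)))) (at (x + \<rho> *\<^sub>R y))"
        using A_derivative_onD[OF P mem[OF x True]] .
      from has_derivative_scaleR_right[OF has_derivative_compose[OF 1 this], of "\<kappa> y"]
      show ?thesis by (simp add: app[abs_def] blinfun.scaleR_right fun_eq_iff[symmetric])
    next
      case False
      then show ?thesis using \<kappa>(2)[of y] by (simp add: app[abs_def])
    qed
    show "(\<lambda>y. \<kappa> y *\<^sub>R P (x + \<rho> *\<^sub>R y)) integrable_on box2"
      by (intro integrable_continuous cont Pc x)
  qed
  moreover have "integral box2 (\<lambda>y. app (\<kappa> y *\<^sub>R G (x + \<rho> *\<^sub>R y))) h =
      A h (integral box2 (\<lambda>y. \<kappa> y *\<^sub>R G (x + \<rho> *\<^sub>R y)))" for h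
  proof -
    have "continuous_on box2 (\<lambda>y. app (\<kappa> y *\<^sub>R G (x + \<rho> *\<^sub>R y)))"
      using continuous_on_compose2[OF appc continuous_on_Pair[OF continuous_on_const continuous_on_id], of x box2] x
      by (simp add: image_subset_iff)
    then have "integral box2 (\<lambda>y. app (\<kappa> y *\<^sub>R G (x + \<rho> *\<^sub>R y))) h = integral box2 (\<lambda>y. A h (\<kappa> y *\<^sub>R G (x + \<rho> *\<^sub>R y)))"
      by (subst blinfun_apply_integral) (auto simp: app intro: integrable_continuous)
    also have "\<dots> = A h (integral box2 (\<lambda>y. \<kappa> y *\<^sub>R G (x + \<rho> *\<^sub>R y)))"
      by (intro integral_blinfun_apply integrable_continuous cont G x)
    finally show ?thesis .
  qed
  ultimately show "((\<lambda>x. integral box2 (\<lambda>y. \<kappa> y *\<^sub>R P (x + \<rho> *\<^sub>R y))) has_derivative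
      (\<lambda>h. A h (integral box2 (\<lambda>y. \<kappa> y *\<^sub>R G (x + \<rho> *\<^sub>R y))))) (at x)"
    using x unfolding at_within_open[OF x open_ball] by (auto elim!: has_derivative_eq_rhs)
qed

text \<open>The product of \<open>\<kappa>\<close> and the rescaled \<open>P\<close> has compact
  support, so its derivative along \<open>h\<close> has integral 0; the chain rule for
  \<open>x + \<epsilon> y\<close> contributes the factor \<open>\<epsilon>\<close>.\<close>

lemma A_integration_by_parts:
  fixes \<kappa> :: "'e \<Rightarrow> real" and \<kappa>' :: "'e \<Rightarrow> 'e \<Rightarrow> real"
  assumes P: "A_derivative_on (ball x R) P G" and G: "continuous_on (ball x R) G"
    and \<epsilon>: "0 \<le> \<epsilon>" "\<epsilon> < R"
    and \<kappa>: "\<And>y. (\<kappa> has_derivative \<kappa>' y) (at y)" "continuous_on UNIV (\<lambda>y. \<kappa>' y h)"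
      "\<And>y. norm y \<ge> 1 \<Longrightarrow> \<kappa> y = 0" "\<And>y. norm y \<ge> 1 \<Longrightarrow> \<kappa>' y h = 0"
    and h: "norm (h::'e) \<le> 1"
  shows "integral box2 (\<lambda>y. \<kappa>' y h *\<^sub>R P (x + \<epsilon> *\<^sub>R y))
    = - (\<epsilon> *\<^sub>R blinfun_apply (A h) (integral box2 (\<lambda>y. \<kappa> y *\<^sub>R G (x + \<epsilon> *\<^sub>R y))))"
proof -
  have mem: "x + \<epsilon> *\<^sub>R y \<in> ball x R" if "norm y \<le> 1" for y
    using that \<epsilon> by (simp add: dist_norm) (meson le_less_trans mult_left_le)
  have Pc: "continuous_on (ball x R) P" using A_derivative_on_continuous[OF P] .
  have \<kappa>c: "continuous_on UNIV \<kappa>"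
    using \<kappa>(1) by (intro continuous_at_imp_continuous_on) (auto intro: has_derivative_continuous)
  have c1: "continuous_on S (\<lambda>y. \<kappa>' y h *\<^sub>R P (x + \<epsilon> *\<^sub>R y))" for S
    using \<kappa>(4) mem by (intro continuous_on_cutoff1[OF \<kappa>(2) _ Pc] continuous_intros) auto
  have c2: "continuous_on S (\<lambda>y. \<kappa> y *\<^sub>R G (x + \<epsilon> *\<^sub>R y))" for S
    using \<kappa>(3) mem by (intro continuous_on_cutoff1[OF \<kappa>c _ G] continuous_intros) auto
  \<comment> \<open>Outside the unit ball the product vanishes identically, whereas \<open>P\<close>
    may fail to be differentiable at the rescaled point; hence the derivative is defined by
    cases.\<close>
  define \<phi>' where "\<phi>' y = (if norm y > 1 then (\<lambda>h. 0)
     else (\<lambda>k. \<kappa> y *\<^sub>R A (\<epsilon> *\<^sub>R k) (G (x + \<epsilon> *\<^sub>R y)) + \<kappa>' y k *\<^sub>R P (x + \<epsilon> *\<^sub>R y)))" for y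
  have \<phi>'h: "\<phi>' y h = \<epsilon> *\<^sub>R A h (\<kappa> y *\<^sub>R G (x + \<epsilon> *\<^sub>R y)) + \<kappa>' y h *\<^sub>R P (x + \<epsilon> *\<^sub>R y)" for y
    using \<kappa>(3)[of y] \<kappa>(4)[of y]
    by (auto simp: \<phi>'_def blinfun.scaleR_right blinfun.scaleR_left linear_scale[OF linear_A])
  have "integral box2 (\<lambda>y. \<phi>' y h) = 0"
  proof (rule integral_box2_derivative_eq_0[of "\<lambda>y. \<kappa> y *\<^sub>R P (x + \<epsilon> *\<^sub>R y)"])
    fix y :: 'e
    show "((\<lambda>y. \<kappa> y *\<^sub>R P (x + \<epsilon> *\<^sub>R y)) has_derivative \<phi>' y) (at y)"
    proof (cases "norm y > 1")
      case True
      have op: "open {y::'e. norm y > 1}" by (intro open_Collect_less continuous_intros)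
      have "((\<lambda>y. 0) has_derivative (\<lambda>h. 0)) (at y)" by simp
      then have "((\<lambda>y. \<kappa> y *\<^sub>R P (x + \<epsilon> *\<^sub>R y)) has_derivative (\<lambda>h. 0)) (at y)"
        by (rule has_derivative_transform_within_open[OF _ op]) (use True \<kappa>(3) in auto)
      then show ?thesis using True by (simp add: \<phi>'_def)
    next
      case False
      have 1: "((\<lambda>y. x + \<epsilon> *\<^sub>R y) has_derivative (\<lambda>h. \<epsilon> *\<^sub>R h)) (at y)"
        by (auto intro!: derivative_eq_intros)
      have "(P has_derivative (\<lambda>h. A h (G (x + \<epsilon> *\<^sub>R y)))) (at (x + \<epsilon> *\<^sub>R y))"
        using A_derivative_onD[OF P mem] False by auto
      from has_derivative_scaleR[OF \<kappa>(1) has_derivative_compose[OF 1 this]]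
      show ?thesis using False by (simp add: \<phi>'_def)
    qed
  next
    show "continuous_on UNIV (\<lambda>y. \<phi>' y h)"
      unfolding \<phi>'h by (intro continuous_intros c1 c2)
  qed (use \<kappa>(3) h in auto)
  moreover have "integral box2 (\<lambda>y. \<phi>' y h) = integral box2 (\<lambda>y. \<epsilon> *\<^sub>R A h (\<kappa> y *\<^sub>R G (x + \<epsilon> *\<^sub>R y)))
      + integral box2 (\<lambda>y. \<kappa>' y h *\<^sub>R P (x + \<epsilon> *\<^sub>R y))"
    unfolding \<phi>'h
    by (intro Henstock_Kurzweil_Integration.integral_add integrable_continuous continuous_intros c1 c2)
  moreover have "integral box2 (\<lambda>y. \<epsilon> *\<^sub>R A h (\<kappa> y *\<^sub>R G (x + \<epsilon> *\<^sub>R y)))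
      = \<epsilon> *\<^sub>R A h (integral box2 (\<lambda>y. \<kappa> y *\<^sub>R G (x + \<epsilon> *\<^sub>R y)))"
    using integral_blinfun_apply[OF integrable_continuous[OF c2], where h="A h"] by simp
  ultimately show ?thesis by (auto simp: eq_neg_iff_add_eq_0 add.commute)
qed

end

text \<open>Since \<open>bump 2 y * (y \<bullet> u)\<close> is -1/6 times the derivative of
  \<open>bump 3\<close> along \<open>u\<close>, the derivative found here is, up to this factor, a
  second derivative of \<open>bump 3\<close> and hence symmetric in \<open>u\<close> and
  \<open>h\<close>.\<close>

lemma has_derivative_bump_moment:
  fixes u :: "'e::euclidean_space"
  shows "((\<lambda>y. bump 2 y * (y \<bullet> u)) has_derivative
    (\<lambda>h. bump 2 y * (h \<bullet> u) - 4 * bump 1 y * (y \<bullet> h) * (y \<bullet> u))) (at y)"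
proof -
  have 1: "(bump 2 has_derivative (\<lambda>h. - 4 * bump 1 y * (y \<bullet> h))) (at y)"
    using has_derivative_bump[of 0 y] by (simp add: numeral_2_eq_2)
  have 2: "((\<lambda>y. y \<bullet> u) has_derivative (\<lambda>h. h \<bullet> u)) (at y)"
    by (auto intro!: derivative_eq_intros)
  show ?thesis
    by (rule has_derivative_eq_rhs[OF has_derivative_mult[OF 1 2]]) (simp add: fun_eq_iff)
qed

abbreviation bump_mass :: "'e::euclidean_space itself \<Rightarrow> real" where
  "bump_mass _ \<equiv> integral box2 (bump 2 :: 'e \<Rightarrow> real)"

lemma bump_mass_pos: "integral box2 (bump 2 :: 'e::euclidean_space \<Rightarrow> real) > 0"
proof -
  have c: "continuous_on box2 (bump 2 :: 'e \<Rightarrow> real)" by (intro continuous_intros)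
  have "integral box2 (bump 2 :: 'e \<Rightarrow> real) \<ge> 0"
    by (intro integral_nonneg integrable_continuous c) (simp add: bump_def)
  moreover have "integral box2 (bump 2 :: 'e \<Rightarrow> real) \<noteq> 0"
  proof
    assume "integral box2 (bump 2 :: 'e \<Rightarrow> real) = 0"
    then have "(bump 2 has_integral 0) (box2 :: 'e set)"
      using integrable_integral[OF integrable_continuous[OF c]] by simp
    moreover have "0 \<in> box (- (2 *\<^sub>R One)) (2 *\<^sub>R One :: 'e)" by (simp add: mem_box)
    ultimately have "bump 2 (0::'e) = 0"
      using has_integral_0_cbox_imp_0[OF c, of 0] box_subset_cbox by (fastforce simp: bump_def)
    then show False by (simp add: bump_def)
  qed
  ultimately show ?thesis by linarith
qed

context elliptic_symbol
begin

text \<open>Integration by parts along \<open>u0\<close> with the moment kernel of \<open>u\<close>,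
  and along \<open>u\<close> with that of \<open>u0\<close>, starts from the same integral, because
  the second derivatives of \<open>bump 3\<close> are symmetric. The first moments thus satisfy the
  first-order system in averaged form, up to a factor \<open>\<epsilon>\<close> that leaves no
  information at scale 0.\<close>

lemma bump_moment_integral:
  assumes P: "A_derivative_on (ball x R) P G" and G: "continuous_on (ball x R) G"
    and \<epsilon>: "0 \<le> \<epsilon>" "\<epsilon> < R" and u: "u \<in> Basis"
  defines "m \<equiv> \<lambda>u. integral box2 (\<lambda>y. (bump 2 y * (y \<bullet> u)) *\<^sub>R G (x + \<epsilon> *\<^sub>R y))"
  shows "\<epsilon> *\<^sub>R m u = \<epsilon> *\<^sub>R A u (m u0)"
proof -
  let ?k = "\<lambda>u y. bump 2 y * (y \<bullet> u)"
  let ?k' = "\<lambda>u y h. bump 2 y * (h \<bullet> u) - 4 * bump 1 y * (y \<bullet> h) * (y \<bullet> u)"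
  have ibp: "integral box2 (\<lambda>y. ?k' v y w *\<^sub>R P (x + \<epsilon> *\<^sub>R y)) = - (\<epsilon> *\<^sub>R A w (m v))"
    if "w \<in> Basis" for v w
    unfolding m_def
  proof (rule A_integration_by_parts[OF P G \<epsilon> has_derivative_bump_moment])
    show "continuous_on UNIV (\<lambda>y. ?k' v y w)" by (intro continuous_intros)
  qed (use that in \<open>simp_all add: bump_eq_0\<close>)
  have "?k' u y u0 = ?k' u0 y u" for y by (simp add: inner_commute)
  then have "- (\<epsilon> *\<^sub>R A u0 (m u)) = - (\<epsilon> *\<^sub>R A u (m u0))"
    using ibp[OF u0_Basis, of u] ibp[OF u, of u0] by presburger
  then show ?thesis by (simp add: A_u0')
qed

text \<open>For scale 0, where the preceding relation is empty: the integrand is a derivative of a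
  multiple of \<open>bump 3\<close>.\<close>

lemma bump_moment_const: "integral box2 (\<lambda>y::'e. (bump 2 y * (y \<bullet> u)) *\<^sub>R (v::'m)) = 0"
  if u: "u \<in> Basis"
proof -
  let ?k' = "\<lambda>y h. - 6 * bump 2 y * (y \<bullet> h)"
  have b: "(bump 3 has_derivative ?k' y) (at y)" for y :: 'e
    using has_derivative_bump[of 1 y] by (simp add: eval_nat_numeral)
  have "integral box2 (\<lambda>y. ?k' y u *\<^sub>R v) = 0"
  proof (rule integral_box2_derivative_eq_0)
    show "((\<lambda>y. bump 3 y *\<^sub>R v) has_derivative (\<lambda>h. ?k' y h *\<^sub>R v)) (at y)" for y :: 'e
      by (rule has_derivative_scaleR_left[OF b])
    show "continuous_on UNIV (\<lambda>y. ?k' y u *\<^sub>R v)" by (intro continuous_intros)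
  qed (use u in \<open>simp_all add: bump_eq_0\<close>)
  then have "(- 6) *\<^sub>R integral box2 (\<lambda>y::'e. (bump 2 y * (y \<bullet> u)) *\<^sub>R v) = 0"
    by (subst integral_cmul[symmetric]) (simp add: mult.assoc)
  then show ?thesis by simp
qed

text \<open>The derivative of the mean with respect to the radius is
  \<open>\<Sum>u. A u (m u)\<close> with the first moments \<open>m u\<close>. The relation
  \<open>m u = A u (m u0)\<close> turns it into the sum of the squares applied to
  \<open>m u0\<close>, which is 0, so the mean keeps its value at radius 0.\<close>

theorem A_mean_value:
  assumes P: "A_derivative_on (ball x R) P G" and G: "continuous_on (ball x R) G"
    and \<epsilon>: "0 \<le> \<epsilon>" "\<epsilon> < R"
  shows "integral box2 (\<lambda>y. bump 2 y *\<^sub>R P (x + \<epsilon> *\<^sub>R y)) = bump_mass TYPE('e) *\<^sub>R P x"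
proof -
  let ?T = "{-R<..<R}" and ?U = "{0..\<epsilon>}"
  have sub: "?U \<subseteq> ?T" using \<epsilon> by auto
  have mem: "x + t *\<^sub>R y \<in> ball x R" if "t \<in> ?T" "norm y \<le> 1" for t y
  proof -
    have "\<bar>t\<bar> * norm y \<le> \<bar>t\<bar>" using that(2) by (simp add: mult_left_le)
    then show ?thesis using that(1) by (auto simp: dist_norm)
  qed
  have b0: "bump 2 y = 0" if "norm y > 1" for y :: 'e using that by (simp add: bump_eq_0)
  have bc: "continuous_on UNIV (bump 2 :: 'e \<Rightarrow> real)" by (intro continuous_intros)
  have Pc: "continuous_on (ball x R) P" using A_derivative_on_continuous[OF P] .
  have cg: "continuous_on (?T \<times> UNIV) (\<lambda>(t, y). x + t *\<^sub>R y)"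
    unfolding split_beta by (intro continuous_intros)
  have cont: "continuous_on (?U \<times> box2) (\<lambda>(t, y). bump 2 y *\<^sub>R F (x + t *\<^sub>R y))"
    if F: "continuous_on (ball x R) F" for F :: "'e \<Rightarrow> 'm"
    by (rule continuous_on_subset[OF continuous_on_cutoff[OF bc b0 F open_ball _ cg mem]]) (use sub in auto)
  have slice: "continuous_on box2 (\<lambda>y. bump 2 y *\<^sub>R F (x + t *\<^sub>R y))"
    if F: "continuous_on (ball x R) F" and t: "t \<in> ?U" for F :: "'e \<Rightarrow> 'm" and t
    using continuous_on_compose2[OF cont[OF F] continuous_on_Pair[OF continuous_on_const continuous_on_id], of t box2] t
    by (simp add: image_subset_iff)
  let ?M = "\<lambda>t. integral box2 (\<lambda>y. bump 2 y *\<^sub>R P (x + t *\<^sub>R y))"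
  have der: "(?M has_vector_derivative integral box2 (\<lambda>y. A y (bump 2 y *\<^sub>R G (x + t *\<^sub>R y)))) (at t within ?U)"
    if t: "t \<in> ?U" for t
  proof (rule leibniz_rule_vector_derivative[OF _ _ _ t])
    fix t y assume t: "t \<in> ?U"
    show "((\<lambda>t. bump 2 y *\<^sub>R P (x + t *\<^sub>R y)) has_vector_derivative A y (bump 2 y *\<^sub>R G (x + t *\<^sub>R y))) (at t within ?U)"
    proof (cases "norm y \<le> 1")
      case True
      have 1: "((\<lambda>t. x + t *\<^sub>R y) has_derivative (\<lambda>h. h *\<^sub>R y)) (at t within ?U)"
        by (auto intro!: derivative_eq_intros)
      have "(P has_derivative (\<lambda>h. A h (G (x + t *\<^sub>R y)))) (at (x + t *\<^sub>R y))"
        using A_derivative_onD[OF P mem[OF _ True]] t sub by blast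
      from has_derivative_scaleR_right[OF has_derivative_compose[OF 1 this], of "bump 2 y"]
      show ?thesis
        unfolding has_vector_derivative_def
        by (rule has_derivative_eq_rhs)
          (simp add: fun_eq_iff linear_scale[OF linear_A] blinfun.scaleR_left blinfun.scaleR_right)
    next
      case False
      then show ?thesis using b0[of y] by simp
    qed
  next
    show "(\<lambda>y. bump 2 y *\<^sub>R P (x + t *\<^sub>R y)) integrable_on box2" if "t \<in> ?U" for t
      by (intro integrable_continuous slice Pc that)
    show "continuous_on (?U \<times> box2) (\<lambda>(t, y). A y (bump 2 y *\<^sub>R G (x + t *\<^sub>R y)))"
      using cont[OF G] unfolding split_beta
      by (intro blinfun.continuous_on continuous_on_A continuous_on_snd continuous_on_id) auto
  qed simp
  have zero: "integral box2 (\<lambda>y. A y (bump 2 y *\<^sub>R G (x + t *\<^sub>R y))) = 0" if t: "t \<in> ?U" for t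
  proof -
    define m where "m u = integral box2 (\<lambda>y. (bump 2 y * (y \<bullet> u)) *\<^sub>R G (x + t *\<^sub>R y))" for u
    have c: "continuous_on box2 (\<lambda>y. (bump 2 y * (y \<bullet> u)) *\<^sub>R G (x + t *\<^sub>R y))" for u
    proof -
      have "continuous_on box2 (\<lambda>y. (y \<bullet> u) *\<^sub>R (bump 2 y *\<^sub>R G (x + t *\<^sub>R y)))"
        by (intro continuous_on_scaleR slice[OF G t] continuous_intros)
      then show ?thesis by (simp add: mult.commute)
    qed
    have "A y (bump 2 y *\<^sub>R G (x + t *\<^sub>R y))
        = (\<Sum>u\<in>Basis. A u ((bump 2 y * (y \<bullet> u)) *\<^sub>R G (x + t *\<^sub>R y)))" for y
      unfolding A_expand[of y] by (intro sum.cong refl) (simp add: blinfun.scaleR_right mult.commute)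
    then have "integral box2 (\<lambda>y. A y (bump 2 y *\<^sub>R G (x + t *\<^sub>R y)))
        = integral box2 (\<lambda>y. \<Sum>u\<in>Basis. A u ((bump 2 y * (y \<bullet> u)) *\<^sub>R G (x + t *\<^sub>R y)))"
      by presburger
    also have "\<dots> = (\<Sum>u\<in>Basis. integral box2 (\<lambda>y. A u ((bump 2 y * (y \<bullet> u)) *\<^sub>R G (x + t *\<^sub>R y))))"
      by (intro Henstock_Kurzweil_Integration.integral_sum finite_Basis integrable_continuous blinfun.continuous_on continuous_on_const c)
    also have "\<dots> = (\<Sum>u\<in>Basis. A u (m u))"
      unfolding m_def by (intro sum.cong refl integral_blinfun_apply integrable_continuous c)
    also have "\<dots> = 0"
    proof (cases "t = 0")
      case True
      then show ?thesis by (simp add: m_def bump_moment_const)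
    next
      case False
      have "m u = A u (m u0)" if "u \<in> Basis" for u
        using bump_moment_integral[OF P G, of t u] False t \<epsilon> that by (simp add: m_def)
      then have "(\<Sum>u\<in>Basis. A u (m u)) = (\<Sum>u\<in>Basis. A u (A u (m u0)))" by simp
      then show ?thesis by (simp only: sum_A_squares)
    qed
    finally show ?thesis .
  qed
  have "(?M has_vector_derivative 0) (at t within ?U)" if "t \<in> ?U" for t
    using der[OF that] zero[OF that] by simp
  then have "\<exists>c. \<forall>t\<in>?U. ?M t = c"
    by (intro has_derivative_zero_constant[OF convex_real_interval(5)]) (simp add: has_vector_derivative_def)
  then obtain c where c: "\<forall>t\<in>?U. ?M t = c" by (elim exE)
  have "?M \<epsilon> = c" by (rule bspec[OF c]) (use \<epsilon> in auto)
  also have "c = ?M 0" by (rule bspec[OF c, symmetric]) (use \<epsilon> in auto)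
  also have "\<dots> = bump_mass TYPE('e) *\<^sub>R P x"
  proof -
    have "(bump 2 has_integral bump_mass TYPE('e)) (box2 :: 'e set)"
      by (intro integrable_integral integrable_continuous continuous_intros)
    from integral_unique[OF has_integral_scaleR_left[OF this, of "P x"]] show ?thesis by simp
  qed
  finally show ?thesis .
qed

text \<open>The derivative of an integral against the kernel can be moved onto the kernel, which yields
  both the regularity of the derivative and Cauchy's estimate.\<close>

theorem A_derivative_regular:
  assumes U: "open U" and G: "A_derivative_on U G G'"
  obtains G'' where "A_derivative_on U G' G''"
    and "\<And>x \<rho> R. 0 < \<rho> \<Longrightarrow> \<rho> < R \<Longrightarrow> ball x R \<subseteq> U \<Longrightarrow>
      G' x = (4 / (\<rho> * bump_mass TYPE('e))) *\<^sub>R integral box2 (\<lambda>y. (bump 1 y * (y \<bullet> u0)) *\<^sub>R G (x + \<rho> *\<^sub>R y))"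
proof -
  define \<kappa> where "\<kappa> y = bump 1 y * (y \<bullet> u0)" for y :: 'e
  have \<kappa>c: "continuous_on UNIV \<kappa>" unfolding \<kappa>_def by (intro continuous_intros)
  have \<kappa>0: "\<kappa> y = 0" if "norm y > 1" for y using that by (simp add: \<kappa>_def bump_eq_0)
  have bc: "continuous_on UNIV (bump 2 :: 'e \<Rightarrow> real)" by (intro continuous_intros)
  have b0: "bump 2 y = 0" if "norm y > 1" for y :: 'e using that by (simp add: bump_eq_0)
  have bm: "bump_mass TYPE('e) > 0" using bump_mass_pos .
  \<comment> \<open>The smoothed function has two \<open>A\<close>-derivatives: one from
    \<open>A_smoothing\<close>, the other from the mean value property, which identifies it with a
    multiple of \<open>F\<close>. Equating them extends the mean value property to
    \<open>F'\<close>, and integration by parts then expresses \<open>F'\<close> through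
    \<open>F\<close>.\<close>
  have rep: "F' x = (4 / (\<rho> * bump_mass TYPE('e))) *\<^sub>R integral box2 (\<lambda>y. \<kappa> y *\<^sub>R F (x + \<rho> *\<^sub>R y))"
    if F: "A_derivative_on (ball x R) F F'" "continuous_on (ball x R) F'" and \<rho>: "0 < \<rho>" "\<rho> < R" for F F' x \<rho> R
  proof -
    let ?\<delta> = "R - \<rho>"
    have "A_derivative_on (ball x ?\<delta>) (\<lambda>z. integral box2 (\<lambda>y. bump 2 y *\<^sub>R F (z + \<rho> *\<^sub>R y)))
       (\<lambda>z. integral box2 (\<lambda>y. bump 2 y *\<^sub>R F' (z + \<rho> *\<^sub>R y)))"
      using \<rho> by (intro A_smoothing[OF F _ _ bc b0]) auto
    moreover have "A_derivative_on (ball x ?\<delta>) (\<lambda>z. integral box2 (\<lambda>y. bump 2 y *\<^sub>R F (z + \<rho> *\<^sub>R y)))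
       (\<lambda>z. bump_mass TYPE('e) *\<^sub>R F' z)"
      unfolding A_derivative_on_def
    proof
      fix z assume z: "z \<in> ball x ?\<delta>"
      have eq: "integral box2 (\<lambda>y. bump 2 y *\<^sub>R F (w + \<rho> *\<^sub>R y)) = bump_mass TYPE('e) *\<^sub>R F w" if "w \<in> ball x ?\<delta>" for w
      proof -
        have "ball w (R - dist x w) \<subseteq> ball x R"
        proof
          fix y assume "y \<in> ball w (R - dist x w)"
          then show "y \<in> ball x R" using dist_triangle[of x y w] by simp
        qed
        then show ?thesis
          using that \<rho> by (intro A_mean_value[OF A_derivative_on_subset[OF F(1)]
              continuous_on_subset[OF F(2)], of w "R - dist x w"]) auto
      qed
      have der: "((\<lambda>w. bump_mass TYPE('e) *\<^sub>R F w) has_derivative (\<lambda>h. A h (bump_mass TYPE('e) *\<^sub>R F' z))) (at z)"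
        using A_derivative_on_scaleR[OF F(1), of "bump_mass TYPE('e)"] z \<rho> by (auto simp: A_derivative_on_def)
      show "((\<lambda>z. integral box2 (\<lambda>y. bump 2 y *\<^sub>R F (z + \<rho> *\<^sub>R y))) has_derivative
          (\<lambda>h. A h (bump_mass TYPE('e) *\<^sub>R F' z))) (at z)"
        by (rule has_derivative_transform_within_open[OF der open_ball z]) (rule eq[symmetric])
    qed
    ultimately have "integral box2 (\<lambda>y. bump 2 y *\<^sub>R F' (x + \<rho> *\<^sub>R y)) = bump_mass TYPE('e) *\<^sub>R F' x"
      by (rule A_derivative_on_unique) (use \<rho> in auto)
    moreover have "integral box2 (\<lambda>y. (- 4 * bump 1 y * (y \<bullet> u0)) *\<^sub>R F (x + \<rho> *\<^sub>R y))
      = - (\<rho> *\<^sub>R A u0 (integral box2 (\<lambda>y. bump 2 y *\<^sub>R F' (x + \<rho> *\<^sub>R y))))"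
    proof (rule A_integration_by_parts[OF F])
      show "(bump 2 has_derivative (\<lambda>h. - 4 * bump 1 y * (y \<bullet> h))) (at y)" for y :: 'e
        using has_derivative_bump[of 0 y] by (simp add: numeral_2_eq_2)
      show "continuous_on UNIV (\<lambda>y::'e. - 4 * bump 1 y * (y \<bullet> u0))" by (intro continuous_intros)
    qed (use \<rho> u0_Basis in \<open>simp_all add: bump_eq_0\<close>)
    moreover have "integral box2 (\<lambda>y. (- 4 * bump 1 y * (y \<bullet> u0)) *\<^sub>R F (x + \<rho> *\<^sub>R y))
        = (- 4) *\<^sub>R integral box2 (\<lambda>y. \<kappa> y *\<^sub>R F (x + \<rho> *\<^sub>R y))"
      by (subst integral_cmul[symmetric]) (simp add: \<kappa>_def mult.assoc)
    ultimately have "(\<rho> * bump_mass TYPE('e)) *\<^sub>R F' x = 4 *\<^sub>R integral box2 (\<lambda>y. \<kappa> y *\<^sub>R F (x + \<rho> *\<^sub>R y))"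
      by (simp add: A_u0')
    then have "(1 / (\<rho> * bump_mass TYPE('e))) *\<^sub>R ((\<rho> * bump_mass TYPE('e)) *\<^sub>R F' x)
        = (1 / (\<rho> * bump_mass TYPE('e))) *\<^sub>R (4 *\<^sub>R integral box2 (\<lambda>y. \<kappa> y *\<^sub>R F (x + \<rho> *\<^sub>R y)))" by simp
    then show ?thesis using \<rho> bm by simp
  qed
  \<comment> \<open>The formula for \<open>F'\<close> is itself a convolution of \<open>F\<close>,
    so it can be differentiated by smoothing: a continuous \<open>A\<close>-derivative again has a
    continuous \<open>A\<close>-derivative, on the ball of half the radius.\<close>
  have step: "\<exists>F''. A_derivative_on (ball x (R / 2)) F' F'' \<and> continuous_on (ball x (R / 2)) F''"
    if F: "A_derivative_on (ball x R) F F'" "continuous_on (ball x R) F'" and R: "R > 0" for F F' x R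
  proof -
    let ?\<rho> = "R / 4" and ?c = "4 / (R / 4 * bump_mass TYPE('e))"
    have c: "continuous_on (ball x (R / 2)) (\<lambda>z. integral box2 (\<lambda>y. \<kappa> y *\<^sub>R F' (z + ?\<rho> *\<^sub>R y)))"
    proof -
      obtain P where P: "A_derivative_on (ball x R) P F" using A_primitive_ball[OF F(1)] by blast
      have "continuous_on (ball x (R / 2) \<times> UNIV) (\<lambda>(z, y). z + ?\<rho> *\<^sub>R y)"
        unfolding split_beta by (intro continuous_intros)
      moreover have "z + ?\<rho> *\<^sub>R y \<in> ball x R" if "z \<in> ball x (R / 2)" "norm y \<le> 1" for z y
      proof -
        have "norm (?\<rho> *\<^sub>R y) \<le> ?\<rho>" using that(2) R by (simp add: mult_left_le)
        moreover have "dist x (z + ?\<rho> *\<^sub>R y) \<le> dist x z + norm (?\<rho> *\<^sub>R y)"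
          using dist_triangle[of x "z + ?\<rho> *\<^sub>R y" z] by (simp only: dist_norm) simp
        ultimately show ?thesis using that(1) R unfolding mem_ball by linarith
      qed
      ultimately have "continuous_on (ball x (R / 2) \<times> UNIV) (\<lambda>(z, y). \<kappa> y *\<^sub>R F' (z + ?\<rho> *\<^sub>R y))"
        by (intro continuous_on_cutoff[OF \<kappa>c \<kappa>0 F(2) open_ball open_ball]) auto
      then have "continuous_on (ball x (R / 2) \<times> box2) (\<lambda>(z, y). \<kappa> y *\<^sub>R F' (z + ?\<rho> *\<^sub>R y))"
        by (rule continuous_on_subset) auto
      then show ?thesis by (rule integral_continuous_on_param)
    qed
    have "A_derivative_on (ball x (R / 2)) (\<lambda>z. ?c *\<^sub>R integral box2 (\<lambda>y. \<kappa> y *\<^sub>R F (z + ?\<rho> *\<^sub>R y)))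
       (\<lambda>z. ?c *\<^sub>R integral box2 (\<lambda>y. \<kappa> y *\<^sub>R F' (z + ?\<rho> *\<^sub>R y)))"
      using R by (intro A_derivative_on_scaleR A_smoothing[OF F _ _ \<kappa>c \<kappa>0]) auto
    moreover have "?c *\<^sub>R integral box2 (\<lambda>y. \<kappa> y *\<^sub>R F (z + ?\<rho> *\<^sub>R y)) = F' z" if "z \<in> ball x (R / 2)" for z
    proof -
      have "ball z (R / 2) \<subseteq> ball x R"
      proof
        fix y assume "y \<in> ball z (R / 2)"
        then show "y \<in> ball x R" using that dist_triangle[of x y z] by simp
      qed
      then show ?thesis
        using R by (intro rep[of z "R / 2", symmetric] A_derivative_on_subset[OF F(1)] continuous_on_subset[OF F(2)]) auto
    qed
    ultimately have "A_derivative_on (ball x (R / 2)) F' (\<lambda>z. ?c *\<^sub>R integral box2 (\<lambda>y. \<kappa> y *\<^sub>R F' (z + ?\<rho> *\<^sub>R y)))"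
      unfolding A_derivative_on_def
    proof (intro ballI)
      fix z assume H: "\<forall>z\<in>ball x (R / 2). ((\<lambda>z. ?c *\<^sub>R integral box2 (\<lambda>y. \<kappa> y *\<^sub>R F (z + ?\<rho> *\<^sub>R y))) has_derivative
         (\<lambda>h. A h (?c *\<^sub>R integral box2 (\<lambda>y. \<kappa> y *\<^sub>R F' (z + ?\<rho> *\<^sub>R y))))) (at z)"
        and E: "\<And>z. z \<in> ball x (R / 2) \<Longrightarrow> ?c *\<^sub>R integral box2 (\<lambda>y. \<kappa> y *\<^sub>R F (z + ?\<rho> *\<^sub>R y)) = F' z"
        and z: "z \<in> ball x (R / 2)"
      show "(F' has_derivative (\<lambda>h. A h (?c *\<^sub>R integral box2 (\<lambda>y. \<kappa> y *\<^sub>R F' (z + ?\<rho> *\<^sub>R y))))) (at z)"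
        using bspec[OF H z] open_ball z E by (rule has_derivative_transform_within_open)
    qed
    then show ?thesis using c continuous_on_scaleR[OF continuous_on_const c] by blast
  qed
  \<comment> \<open>Continuity of \<open>G'\<close> is not given. Applying \<open>step\<close> to a
    primitive \<open>P\<close>, whose derivative \<open>G\<close> is continuous, yields it; applying
    \<open>step\<close> once more, to \<open>G\<close>, yields the derivative of
    \<open>G'\<close>.\<close>
  have loc: "\<exists>r>0. \<exists>F''. A_derivative_on (ball x r) G' F''" if x: "x \<in> U" for x
  proof -
    obtain R where R: "R > 0" "ball x R \<subseteq> U" using U x openE by blast
    note GR = A_derivative_on_subset[OF G R(2)]
    obtain P where P: "A_derivative_on (ball x R) P G" using A_primitive_ball[OF GR] by blast
    obtain G1 where G1: "A_derivative_on (ball x (R / 2)) G G1" "continuous_on (ball x (R / 2)) G1"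
      using step[OF P A_derivative_on_continuous[OF GR] R(1)] by blast
    have sub: "ball x (R / 2) \<subseteq> ball x R" using R(1) by (auto intro: subset_ball)
    have eq: "G1 z = G' z" if "z \<in> ball x (R / 2)" for z
      using A_derivative_on_unique[OF G1(1) A_derivative_on_subset[OF GR sub] that] .
    have c: "continuous_on (ball x (R / 2)) G'" by (rule continuous_on_eq[OF G1(2)]) (rule eq)
    obtain F'' where "A_derivative_on (ball x (R / 2 / 2)) G' F''"
      using step[OF A_derivative_on_subset[OF GR sub] c] R(1) by auto
    then show ?thesis using R(1) by (intro exI[of _ "R / 4"]) auto
  qed
  have "\<exists>v. (G' has_derivative (\<lambda>h. A h v)) (at x)" if x: "x \<in> U" for x
  proof -
    obtain r F'' where "r > 0" "A_derivative_on (ball x r) G' F''" using loc[OF x] by blast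
    then show ?thesis unfolding A_derivative_on_def by (intro exI[of _ "F'' x"]) simp
  qed
  then have "\<exists>G''. \<forall>x\<in>U. (G' has_derivative (\<lambda>h. A h (G'' x))) (at x)" by (intro bchoice) blast
  then obtain G'' where G'': "A_derivative_on U G' G''" unfolding A_derivative_on_def by (elim exE)
  have G'c: "continuous_on U G'" using A_derivative_on_continuous[OF G''] .
  note G''
  moreover have "G' x = (4 / (\<rho> * bump_mass TYPE('e))) *\<^sub>R integral box2 (\<lambda>y. (bump 1 y * (y \<bullet> u0)) *\<^sub>R G (x + \<rho> *\<^sub>R y))"
    if \<rho>: "0 < \<rho>" "\<rho> < R" "ball x R \<subseteq> U" for x \<rho> R
  proof -
    show ?thesis
      using rep[OF A_derivative_on_subset[OF G \<rho>(3)] continuous_on_subset[OF G'c \<rho>(3)] \<rho>(1,2)] by (simp add: \<kappa>_def)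
  qed
  ultimately show thesis using that by blast
qed

end

text \<open>A single term of the series of \<open>exp n\<close> is at most \<open>exp 1 ^ n\<close>.
  This converts the powers \<open>n ^ n\<close> that arise from \<open>n\<close> Cauchy estimates on
  shrinking balls into factorials.\<close>

lemma power_self_le_fact: "real n ^ n \<le> 3 ^ n * fact n"
proof -
  have "real n ^ n / fact n \<le> (\<Sum>k. real n ^ k / fact k)"
    using sum_le_suminf[OF summable_exp_generic[of "real n"], of "{n}"] by (simp add: divide_inverse mult.commute)
  also have "\<dots> = exp (real n)" by (simp add: exp_def divide_inverse mult.commute)
  also have "\<dots> = exp 1 ^ n" by (simp add: exp_of_nat_mult[symmetric])
  also have "\<dots> \<le> 3 ^ n" using exp_le by (intro power_mono) auto
  finally show ?thesis by (simp add: divide_le_eq)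
qed

section \<open>Cauchy estimates and Taylor expansion within one block\<close>

context elliptic_symbol
begin

theorem A_Cauchy_estimate:
  obtains C where "C \<ge> 1" and "\<And>x R G G' M. R > 0 \<Longrightarrow> A_derivative_on (ball x R) G G' \<Longrightarrow>
    (\<And>y. y \<in> ball x R \<Longrightarrow> norm (G y) \<le> M) \<Longrightarrow> norm (G' x) \<le> C * M / R"
proof -
  \<comment> \<open>The factor 8 is the 4 of the kernel representation divided by the 1/2 of the
    scale \<open>R / 2\<close>.\<close>
  define c where "c = 8 * Henstock_Kurzweil_Integration.content (box2 :: 'e set) / bump_mass TYPE('e)"
  have bm: "bump_mass TYPE('e) > 0" using bump_mass_pos .
  have "norm (G' x) \<le> max 1 c * M / R"
    if R: "R > 0" and G: "A_derivative_on (ball x R) G G'" and M: "\<And>y. y \<in> ball x R \<Longrightarrow> norm (G y) \<le> M"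
    for x R G G' M
  proof -
    let ?f = "\<lambda>y. (bump 1 y * (y \<bullet> u0)) *\<^sub>R G (x + (R / 2) *\<^sub>R y)"
    have H: "\<And>z \<rho> S. 0 < \<rho> \<Longrightarrow> \<rho> < S \<Longrightarrow> ball z S \<subseteq> ball x R \<Longrightarrow> G' z = (4 / (\<rho> * bump_mass TYPE('e))) *\<^sub>R
        integral box2 (\<lambda>y. (bump 1 y * (y \<bullet> u0)) *\<^sub>R G (z + \<rho> *\<^sub>R y))"
      by (rule A_derivative_regular[OF open_ball G]) blast
    have rep: "G' x = (4 / (R / 2 * bump_mass TYPE('e))) *\<^sub>R integral box2 ?f"
      by (rule H[of _ R]) (use R in auto)
    have M0: "M \<ge> 0" using M[of x] R by (simp add: order_trans[OF norm_ge_zero])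
    have mem: "x + (R / 2) *\<^sub>R y \<in> ball x R" if "norm y \<le> 1" for y
    proof -
      have "R * norm y \<le> R" using that R by (simp add: mult_left_le)
      then show ?thesis using R by (simp add: dist_norm)
    qed
    have "norm (?f y) \<le> M" for y
    proof (cases "norm y \<le> 1")
      case True
      have "\<bar>bump 1 y\<bar> \<le> 1" by (simp add: bump_def)
      moreover have "\<bar>y \<bullet> u0\<bar> \<le> 1" using Basis_le_norm[OF u0_Basis, of y] True by linarith
      ultimately have "\<bar>bump 1 y * (y \<bullet> u0)\<bar> \<le> 1" unfolding abs_mult by (intro mult_le_one) auto
      then have "norm (?f y) \<le> 1 * norm (G (x + (R / 2) *\<^sub>R y))"
        unfolding norm_scaleR by (intro mult_right_mono) auto
      then show ?thesis using M[OF mem[OF True]] by simp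
    next
      case False
      then show ?thesis using M0 by (simp add: bump_eq_0)
    qed
    moreover have "?f integrable_on box2"
    proof (intro integrable_continuous continuous_on_cutoff1[OF _ _ A_derivative_on_continuous[OF G]])
      show "continuous_on UNIV (\<lambda>y::'e. bump 1 y * (y \<bullet> u0))" by (intro continuous_intros)
      show "continuous_on UNIV (\<lambda>y. x + (R / 2) *\<^sub>R y)" by (intro continuous_intros)
    qed (use mem in \<open>simp_all add: bump_eq_0\<close>)
    ultimately have "norm (integral box2 ?f) \<le> M * Henstock_Kurzweil_Integration.content (box2 :: 'e set)"
      using has_integral_bound[OF M0 integrable_integral] by blast
    then have "norm (G' x) \<le> (4 / (R / 2 * bump_mass TYPE('e))) * (M * Henstock_Kurzweil_Integration.content (box2 :: 'e set))"
      unfolding rep norm_scaleR using R bm by (intro mult_mono) auto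
    also have "\<dots> = c * M / R" by (simp add: c_def mult_ac)
    also have "\<dots> \<le> max 1 c * M / R"
      using M0 R by (intro divide_right_mono mult_right_mono) auto
    finally show ?thesis .
  qed
  then show thesis using that[of "max 1 c"] by simp
qed

text \<open>Each function is chosen as a pair with its derivative, so that the next choice continues
  from the derivative already fixed.\<close>

lemma A_derivative_sequence:
  assumes "open U" "A_derivative_on U G G'"
  obtains Gs where "Gs 0 = G" "\<And>j. A_derivative_on U (Gs j) (Gs (Suc j))"
proof -
  have "\<exists>Gs. \<forall>j. (A_derivative_on U (fst (Gs j)) (snd (Gs j)) \<and> (j = 0 \<longrightarrow> fst (Gs j) = G)) \<and> fst (Gs (Suc j)) = snd (Gs j)"
  proof (rule dependent_nat_choice)
    show "\<exists>p. A_derivative_on U (fst p) (snd p) \<and> ((0::nat) = 0 \<longrightarrow> fst p = G)"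
      using assms by (intro exI[of _ "(G, G')"]) auto
  next
    fix p and j :: nat assume "A_derivative_on U (fst p) (snd p) \<and> (j = 0 \<longrightarrow> fst p = G)"
    then obtain G'' where "A_derivative_on U (snd p) G''"
      using A_derivative_regular[OF assms(1)] by metis
    then show "\<exists>p'. (A_derivative_on U (fst p') (snd p') \<and> (Suc j = 0 \<longrightarrow> fst p' = G)) \<and> fst p' = snd p"
      by (intro exI[of _ "(snd p, G'')"]) auto
  qed
  then obtain Gs where Gs: "\<And>j. A_derivative_on U (fst (Gs j)) (snd (Gs j))" "fst (Gs 0) = G"
     "\<And>j. fst (Gs (Suc j)) = snd (Gs j)" by blast
  show thesis by (rule that[of "\<lambda>j. fst (Gs j)"]) (use Gs in auto)
qed

lemma norm_A_power: "norm (((blinfun_apply (A h)) ^^ j) v) \<le> norm (A h) ^ j * norm v"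
proof (induction j)
  case (Suc j)
  have "norm (((blinfun_apply (A h)) ^^ Suc j) v) \<le> norm (A h) * norm (((blinfun_apply (A h)) ^^ j) v)"
    by (simp add: norm_blinfun)
  also have "\<dots> \<le> norm (A h) * (norm (A h) ^ j * norm v)" by (intro mult_left_mono Suc) auto
  finally show ?case by (simp add: mult_ac)
qed simp

lemma A_power_scaleR: "((blinfun_apply (A (t *\<^sub>R h))) ^^ j) v = t ^ j *\<^sub>R ((blinfun_apply (A h)) ^^ j) v"
  by (induction j) (simp_all add: linear_scale[OF linear_A] blinfun.scaleR_left blinfun.scaleR_right)

text \<open>The Maclaurin formula is scalar, so the function along the segment is paired with its
  own remainder vector \<open>rem\<close>. This bounds the square of \<open>norm rem\<close> by the
  desired bound times \<open>norm rem\<close>.\<close>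

lemma A_Taylor_remainder:
  assumes Gs: "\<And>j. A_derivative_on U (Gs j) (Gs (Suc j))"
    and seg: "\<And>t. t \<in> {0..1} \<Longrightarrow> x + t *\<^sub>R h \<in> U"
    and B: "\<And>t. t \<in> {0..1} \<Longrightarrow> norm (Gs (Suc n) (x + t *\<^sub>R h)) \<le> B"
  shows "norm (Gs 0 (x + h) - (\<Sum>j\<le>n. (1 / fact j) *\<^sub>R ((blinfun_apply (A h)) ^^ j) (Gs j x)))
    \<le> norm (A h) ^ Suc n * B / fact (Suc n)"
proof -
  define rem where "rem = Gs 0 (x + h) - (\<Sum>j\<le>n. (1 / fact j) *\<^sub>R ((blinfun_apply (A h)) ^^ j) (Gs j x))"
  define diff where "diff j t = ((blinfun_apply (A h)) ^^ j) (Gs j (x + t *\<^sub>R h)) \<bullet> rem" for j t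
  have blin: "bounded_linear ((blinfun_apply (A h)) ^^ j)" for j
    by (induction j) (auto intro: bounded_linear_compose[OF blinfun.bounded_linear_right] bounded_linear_ident simp: id_def o_def)
  have comm: "((blinfun_apply (A h)) ^^ j) (A h v) = A h (((blinfun_apply (A h)) ^^ j) v)" for j v
    by (simp add: funpow_swap1)
  have der: "DERIV (diff j) t :> diff (Suc j) t" if t: "0 \<le> t" "t \<le> 1" for j t
  proof -
    have 1: "((\<lambda>t. x + t *\<^sub>R h) has_derivative (\<lambda>s. s *\<^sub>R h)) (at t)"
      by (auto intro!: derivative_eq_intros)
    have "(Gs j has_derivative (\<lambda>k. A k (Gs (Suc j) (x + t *\<^sub>R h)))) (at (x + t *\<^sub>R h))"
      using A_derivative_onD[OF Gs seg] t by auto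
    note has_derivative_compose[OF 1 this]
    from has_derivative_inner_left[OF bounded_linear.has_derivative[OF blin[of j] this], of rem]
    show ?thesis
      unfolding has_field_derivative_def diff_def
      by (rule has_derivative_eq_rhs)
        (simp add: fun_eq_iff linear_scale[OF linear_A] blinfun.scaleR_left comm
          linear_scale[OF bounded_linear.linear[OF blin]])
  qed
  obtain t where t: "0 < t" "t < 1"
     "diff 0 1 = (\<Sum>m<Suc n. diff m 0 / fact m * 1 ^ m) + diff (Suc n) t / fact (Suc n) * 1 ^ Suc n"
    using Maclaurin[of 1 "Suc n" diff "diff 0"] der by auto
  have "(\<Sum>m<Suc n. diff m 0 / fact m * 1 ^ m)
      = (\<Sum>j\<le>n. (1 / fact j) *\<^sub>R ((blinfun_apply (A h)) ^^ j) (Gs j x)) \<bullet> rem"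
    unfolding inner_sum_left lessThan_Suc_atMost by (simp add: diff_def)
  then have "rem \<bullet> rem = diff (Suc n) t / fact (Suc n)"
    using t(3) by (simp add: rem_def inner_diff_left diff_def)
  then have "(norm rem)\<^sup>2 = diff (Suc n) t / fact (Suc n)"
    by (simp add: power2_norm_eq_inner)
  also have "diff (Suc n) t \<le> norm (((blinfun_apply (A h)) ^^ Suc n) (Gs (Suc n) (x + t *\<^sub>R h))) * norm rem"
    unfolding diff_def by (rule norm_cauchy_schwarz)
  also have "\<dots> \<le> (norm (A h) ^ Suc n * norm (Gs (Suc n) (x + t *\<^sub>R h))) * norm rem"
    by (intro mult_right_mono norm_A_power) auto
  also have "\<dots> \<le> (norm (A h) ^ Suc n * B) * norm rem"
    using t by (intro mult_right_mono mult_left_mono B) auto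
  finally have *: "(norm rem)\<^sup>2 \<le> (norm (A h) ^ Suc n * B / fact (Suc n)) * norm rem"
    by (simp add: divide_right_mono)
  have "norm rem \<le> norm (A h) ^ Suc n * B / fact (Suc n)"
  proof (cases "rem = 0")
    case True
    have "B \<ge> 0" using B[of 0] by (simp add: order_trans[OF norm_ge_zero])
    then show ?thesis using True by simp
  next
    case False
    then show ?thesis using mult_right_le_imp_le[OF *[unfolded power2_eq_square]] by simp
  qed
  then show ?thesis unfolding rem_def .
qed

text \<open>For the derivative of order \<open>n\<close>, each of \<open>n\<close> Cauchy estimates
  uses up radius \<open>R / (2 n)\<close>. The product \<open>(2 C n / R) ^ n\<close> is at most
  \<open>n!\<close> times a geometric factor, so the Taylor remainder decays geometrically close to
  \<open>x\<close>, with a \<open>K\<close> that depends neither on the function nor on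
  \<open>R\<close>.\<close>

theorem A_Taylor:
  obtains K where "K \<ge> 1" and "\<And>x R Gs M. R > 0 \<Longrightarrow> (\<And>j. A_derivative_on (ball x R) (Gs j) (Gs (Suc j))) \<Longrightarrow>
      (\<And>y. y \<in> ball x R \<Longrightarrow> norm (Gs 0 y) \<le> M) \<Longrightarrow>
      (\<forall>j. norm (Gs j x) \<le> M * fact j * (K / R) ^ j) \<and>
      (\<forall>j. \<forall>y \<in> ball x (R/2). norm (Gs j y) \<le> M * fact j * (K / R) ^ j) \<and>
      (\<forall>n h. norm h < R / 2 \<longrightarrow> norm (Gs 0 (x + h) - (\<Sum>j\<le>n. (1 / fact j) *\<^sub>R ((blinfun_apply (A h)) ^^ j) (Gs j x)))
         \<le> M * (K * norm h / R) ^ Suc n)"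
proof -
  obtain C where C: "C \<ge> 1" "\<And>x R G G' M. R > 0 \<Longrightarrow> A_derivative_on (ball x R) G G' \<Longrightarrow>
    (\<And>y. y \<in> ball x R \<Longrightarrow> norm (G y) \<le> M) \<Longrightarrow> norm (G' x) \<le> C * M / R"
    by (rule A_Cauchy_estimate) blast
  obtain a where a: "a \<ge> 1" "\<And>h. norm (A h) \<le> a * norm h" using norm_A_bound by blast
  \<comment> \<open>In \<open>6 * C\<close> the 2 comes from the steps of length
    \<open>R / (2 n)\<close> and the 3 from \<open>n ^ n \<le> 3 ^ n n!\<close>. The further factor
    \<open>a\<close> in \<open>K\<close> bounds the powers of \<open>A h\<close> in the
    remainder.\<close>
  define K0 where "K0 = 6 * C"
  define K where "K = K0 * a"
  have K0: "K0 \<ge> 1" using C(1) by (simp add: K0_def)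
  have KK: "K0 \<le> K" using K0 a(1) mult_left_mono[of 1 a K0] by (simp add: K_def)
  have bound0: "\<forall>j. \<forall>y \<in> ball x (R/2). norm (Gs j y) \<le> M * fact j * (K0 / R) ^ j"
    if R: "R > 0" and Gs: "\<And>j. A_derivative_on (ball x R) (Gs j) (Gs (Suc j))"
      and M: "\<And>y. y \<in> ball x R \<Longrightarrow> norm (Gs 0 y) \<le> M" for x R Gs M
  proof (intro allI ballI)
    fix n y assume y: "y \<in> ball x (R / 2)"
    have M0: "M \<ge> 0" using M[of x] R by (simp add: order_trans[OF norm_ge_zero])
    show "norm (Gs n y) \<le> M * fact n * (K0 / R) ^ n"
    proof (cases "n = 0")
      case True then show ?thesis using M[of y] y R by simp
    next
      case False
      define \<delta> where "\<delta> = R / (2 * n)"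
      have \<delta>: "\<delta> > 0" "n * \<delta> = R / 2" using R False by (simp_all add: \<delta>_def)
      have "\<forall>z \<in> ball x (R - i * \<delta>). norm (Gs i z) \<le> (C / \<delta>) ^ i * M" if "i \<le> n" for i
        using that
      proof (induction i)
        case 0 then show ?case using M by simp
      next
        case (Suc i)
        show ?case
        proof
          fix z assume z: "z \<in> ball x (R - Suc i * \<delta>)"
          have sub: "ball z \<delta> \<subseteq> ball x (R - i * \<delta>)"
          proof
            fix w assume "w \<in> ball z \<delta>"
            then show "w \<in> ball x (R - i * \<delta>)" using z dist_triangle[of x w z] by (simp add: algebra_simps)
          qed
          have "ball x (R - i * \<delta>) \<subseteq> ball x R" using \<delta>(1) by (intro subset_ball) simp
          then have "norm (Gs (Suc i) z) \<le> C * ((C / \<delta>) ^ i * M) / \<delta>"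
            using sub Suc by (intro C(2)[OF \<delta>(1) A_derivative_on_subset[OF Gs]]) auto
          then show "norm (Gs (Suc i) z) \<le> (C / \<delta>) ^ Suc i * M" by (simp add: mult_ac)
        qed
      qed
      from this[of n] have "norm (Gs n y) \<le> (C / \<delta>) ^ n * M" using y \<delta> by auto
      also have "(C / \<delta>) ^ n = (2 * C / R) ^ n * real n ^ n"
        using R by (simp add: \<delta>_def power_mult_distrib[symmetric] mult_ac)
      also have "\<dots> * M \<le> (2 * C / R) ^ n * (3 ^ n * fact n) * M"
        using C(1) R M0 by (intro mult_right_mono mult_left_mono power_self_le_fact) auto
      also have "\<dots> = M * fact n * (K0 / R) ^ n"
        by (simp add: K0_def power_mult_distrib power_divide mult_ac) (simp add: power_mult_distrib[symmetric])
      finally show ?thesis .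
    qed
  qed
  show thesis
  proof (rule that[of K])
    show "K \<ge> 1" using K0 KK by linarith
    fix x R Gs M assume R: "R > 0" and Gs: "\<And>j. A_derivative_on (ball x R) (Gs j) (Gs (Suc j))"
      and M: "\<And>y. y \<in> ball x R \<Longrightarrow> norm (Gs 0 y) \<le> M"
    have M0: "M \<ge> 0" using M[of x] R by (simp add: order_trans[OF norm_ge_zero])
    note b0 = bound0[OF R Gs M]
    have b: "\<forall>j. \<forall>y \<in> ball x (R/2). norm (Gs j y) \<le> M * fact j * (K / R) ^ j"
    proof (intro allI ballI)
      fix j y assume "y \<in> ball x (R / 2)"
      then have "norm (Gs j y) \<le> M * fact j * (K0 / R) ^ j" using b0 by blast
      also have "\<dots> \<le> M * fact j * (K / R) ^ j"
        using M0 K0 KK R by (intro mult_left_mono power_mono divide_right_mono) auto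
      finally show "norm (Gs j y) \<le> M * fact j * (K / R) ^ j" .
    qed
    moreover have "norm (Gs 0 (x + h) - (\<Sum>j\<le>n. (1 / fact j) *\<^sub>R ((blinfun_apply (A h)) ^^ j) (Gs j x)))
         \<le> M * (K * norm h / R) ^ Suc n" if h: "norm h < R / 2" for n h
    proof -
      have mem: "x + t *\<^sub>R h \<in> ball x (R / 2)" if "t \<in> {0..1}" for t
      proof -
        have "\<bar>t\<bar> * norm h \<le> norm h" using that by (simp add: mult_left_le_one_le)
        then show ?thesis using h by (simp add: dist_norm)
      qed
      have sub: "ball x (R / 2) \<subseteq> ball x R" using R by (intro subset_ball) simp
      have "norm (Gs 0 (x + h) - (\<Sum>j\<le>n. (1 / fact j) *\<^sub>R ((blinfun_apply (A h)) ^^ j) (Gs j x)))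
         \<le> norm (A h) ^ Suc n * (M * fact (Suc n) * (K0 / R) ^ Suc n) / fact (Suc n)"
      proof (rule A_Taylor_remainder[where U = "ball x R" and Gs = Gs, OF Gs])
        show "x + t *\<^sub>R h \<in> ball x R" if "t \<in> {0..1}" for t using mem[OF that] sub by blast
        show "norm (Gs (Suc n) (x + t *\<^sub>R h)) \<le> M * fact (Suc n) * (K0 / R) ^ Suc n" if "t \<in> {0..1}" for t
          using b0 mem[OF that] by blast
      qed
      also have "\<dots> = M * (norm (A h) * K0 / R) ^ Suc n"
        by (simp only: power_mult_distrib power_divide) (simp add: fact_nonzero)
      also have "\<dots> \<le> M * (K * norm h / R) ^ Suc n"
        using M0 R K0 a(2)[of h]
        by (intro mult_left_mono power_mono divide_right_mono) (auto simp: K_def mult.commute mult.left_commute intro: mult_left_mono)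
      finally show ?thesis .
    qed
    moreover have "x \<in> ball x (R / 2)" using R by simp
    ultimately show "(\<forall>j. norm (Gs j x) \<le> M * fact j * (K / R) ^ j) \<and>
      (\<forall>j. \<forall>y \<in> ball x (R/2). norm (Gs j y) \<le> M * fact j * (K / R) ^ j) \<and>
      (\<forall>n h. norm h < R / 2 \<longrightarrow> norm (Gs 0 (x + h) - (\<Sum>j\<le>n. (1 / fact j) *\<^sub>R ((blinfun_apply (A h)) ^^ j) (Gs j x)))
         \<le> M * (K * norm h / R) ^ Suc n)"
      by blast
  qed
qed

end

section \<open>From pointwise to locally uniform geometric bounds\<close>

text \<open>Greedy choice: the next point is the least element of \<open>E\<close> at least
  \<open>d = r / (n + 1)\<close> further right. One step discards measure at most \<open>d\<close>,
  so positive measure remains until \<open>n + 1\<close> points have been found.\<close>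

lemma spaced_points_exist:
  fixes E :: "real set"
  assumes E: "compact E" and r: "r > 0" "measure lborel E \<ge> r"
  obtains x :: "nat \<Rightarrow> real" where "\<And>i. i \<le> n \<Longrightarrow> x i \<in> E"
    "\<And>i j. i < j \<Longrightarrow> j \<le> n \<Longrightarrow> x j - x i \<ge> real (j - i) * (r / (n + 1))"
proof -
  define d where "d = r / (n + 1)"
  have d: "d > 0" "d * (n + 1) = r" using r by (simp_all add: d_def)
  have cpt: "compact (E \<inter> {y..})" for y using E by (intro compact_Int_closed) auto
  have Inf_mem: "Inf F \<in> F \<and> (\<forall>z\<in>F. Inf F \<le> z)" if "compact F" "F \<noteq> {}" for F :: "real set"
    using that by (meson bounded_imp_bdd_below cInf_lower closed_contains_Inf compact_imp_bounded compact_imp_closed)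
  have E0: "E \<noteq> {}" using r by auto
  \<comment> \<open>The induction carries along the measure of the part of \<open>E\<close> to the
    right of the latest point, which guarantees that a next point exists.\<close>
  have ex: "\<exists>x. (\<forall>i\<le>k. x i \<in> E) \<and> (\<forall>i j. i < j \<and> j \<le> k \<longrightarrow> x j - x i \<ge> real (j - i) * d)
      \<and> measure lborel (E \<inter> {x k..}) \<ge> r - k * d" if "k \<le> n" for k
    using that
  proof (induction k)
    case 0
    have "E \<inter> {Inf E..} = E" using Inf_mem[OF E E0] by auto
    then show ?case using Inf_mem[OF E E0] r by (intro exI[of _ "\<lambda>_. Inf E"]) auto
  next
    case (Suc k)
    then obtain x where x: "\<And>i. i \<le> k \<Longrightarrow> x i \<in> E" "\<And>i j. i < j \<Longrightarrow> j \<le> k \<Longrightarrow> x j - x i \<ge> real (j - i) * d"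
      "measure lborel (E \<inter> {x k..}) \<ge> r - k * d" by auto
    define F where "F = E \<inter> {x k + d..}"
    have F: "compact F" unfolding F_def by (rule cpt)
    have sets: "F \<in> sets lborel" "E \<inter> {x k..} \<in> sets lborel"
      using F cpt by (auto intro: borel_compact)
    have "measure lborel (E \<inter> {x k..}) \<le> measure lborel (F \<union> {x k..x k + d})"
      using sets F by (intro measure_mono_fmeasurable) (auto simp: F_def fmeasurable_compact)
    also have "\<dots> \<le> measure lborel F + measure lborel {x k..x k + d}"
      using sets by (intro measure_Un_le) auto
    finally have mF: "measure lborel F \<ge> r - Suc k * d" using x(3) d(1) by (simp add: algebra_simps)
    have "Suc k * d < (n + 1) * d" using Suc.prems d(1) by (intro mult_strict_right_mono) auto
    then have "measure lborel F > 0" using mF d(2) by (simp add: mult.commute)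
    then have F0: "F \<noteq> {}" by auto
    define y where "y = Inf F"
    have y: "y \<in> F" "\<And>z. z \<in> F \<Longrightarrow> y \<le> z" using Inf_mem[OF F F0] by (auto simp: y_def)
    have Fy: "E \<inter> {y..} = F" using y by (auto simp: F_def)
    have "x' j - x' i \<ge> real (j - i) * d" if "i < j" "j \<le> Suc k" "x' = x(Suc k := y)" for i j x'
    proof (cases "j = Suc k")
      case True
      have "real (k - i) * d \<le> x k - x i" using x(2)[of i k] that True by (cases "i = k") auto
      moreover have "real (j - i) * d = real (k - i) * d + d"
        using that True by (simp add: Suc_diff_le algebra_simps)
      ultimately show ?thesis using that True y(1) by (simp add: F_def)
    next
      case False
      then show ?thesis using that x(2)[of i j] by simp
    qed
    then show ?case using x(1) y(1) mF Fy
      by (intro exI[of _ "x(Suc k := y)"]) (auto simp: F_def le_Suc_eq)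
  qed
  obtain x where x: "\<forall>i\<le>n. x i \<in> E" "\<forall>i j. i < j \<and> j \<le> n \<longrightarrow> x j - x i \<ge> real (j - i) * d"
    using ex[OF order_refl] by (elim exE conjE)
  show thesis by (rule that[of x]) (use x in \<open>simp_all add: d_def\<close>)
qed

lemma Lagrange_interpolation:
  fixes p :: "'a::field poly"
  assumes inj: "inj_on x {..n}" and deg: "degree p \<le> n"
  shows "poly p t = (\<Sum>i\<le>n. poly p (x i) * (\<Prod>j\<in>{..n} - {i}. (t - x j) / (x i - x j)))"
proof -
  define c where "c i = poly p (x i) / (\<Prod>j\<in>{..n} - {i}. x i - x j)" for i
  define L where "L = (\<Sum>i\<le>n. smult (c i) (\<Prod>j\<in>{..n} - {i}. [:- x j, 1:]))"
  have "degree L \<le> n"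
    unfolding L_def
  proof (rule degree_sum_le)
    fix i assume "i \<in> {..n}"
    have "degree (\<Prod>j\<in>{..n} - {i}. [:- x j, 1:]) \<le> sum (degree \<circ> (\<lambda>j. [:- x j, 1:])) ({..n} - {i})"
      by (rule degree_prod_sum_le) simp
    also have "\<dots> = n" using \<open>i \<in> {..n}\<close> by simp
    finally show "degree (smult (c i) (\<Prod>j\<in>{..n} - {i}. [:- x j, 1:])) \<le> n"
      using degree_smult_le order_trans by blast
  qed simp
  have polyL: "poly L s = (\<Sum>i\<le>n. c i * (\<Prod>j\<in>{..n} - {i}. s - x j))" for s
    by (simp add: L_def poly_sum poly_prod)
  have "poly L (x k) = poly p (x k)" if k: "k \<le> n" for k
  proof -
    have "c i * (\<Prod>j\<in>{..n} - {i}. x k - x j) = (if i = k then poly p (x k) else 0)" if "i \<le> n" for i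
    proof (cases "i = k")
      case True
      have "(\<Prod>j\<in>{..n} - {k}. x k - x j) \<noteq> 0" using inj k by (auto simp: inj_on_def)
      then show ?thesis using True by (simp add: c_def)
    next
      case False
      have "(\<Prod>j\<in>{..n} - {i}. x k - x j) = 0" using False k by (intro prod_zero) auto
      then show ?thesis using False by simp
    qed
    then have "poly L (x k) = (\<Sum>i\<le>n. if i = k then poly p (x k) else 0)"
      unfolding polyL by (intro sum.cong) auto
    then show ?thesis using k by simp
  qed
  then have "p = L"
    using \<open>degree L \<le> n\<close> deg inj by (intro poly_eqI_degree[of "x ` {..n}"]) (auto simp: card_image)
  then have "poly p t = (\<Sum>i\<le>n. c i * (\<Prod>j\<in>{..n} - {i}. t - x j))" using polyL by metis
  also have "\<dots> = (\<Sum>i\<le>n. poly p (x i) * (\<Prod>j\<in>{..n} - {i}. (t - x j) / (x i - x j)))"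
    by (simp add: c_def prod_dividef)
  finally show ?thesis .
qed

lemma prod_abs_diff_nat:
  assumes "i \<le> n"
  shows "(\<Prod>j\<in>{..n} - {i}. \<bar>real i - real j\<bar>) = fact i * fact (n - i)"
proof -
  have split: "{..n} - {i} = {0..<i} \<union> {i<..n}" using assms by auto
  have "(\<Prod>j\<in>{..n} - {i}. \<bar>real i - real j\<bar>)
      = (\<Prod>j\<in>{0..<i}. \<bar>real i - real j\<bar>) * (\<Prod>j\<in>{i<..n}. \<bar>real i - real j\<bar>)"
    unfolding split by (rule prod.union_disjoint) auto
  also have "(\<Prod>j\<in>{0..<i}. \<bar>real i - real j\<bar>) = (\<Prod>j\<in>{0..<i}. real (i - j))"
    by (intro prod.cong) auto
  also have "\<dots> = fact i" using fact_prod_rev[of i, where 'a=real] by simp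
  also have "(\<Prod>j\<in>{i<..n}. \<bar>real i - real j\<bar>) = (\<Prod>k\<in>{1..n - i}. real k)"
    by (rule prod.reindex_bij_witness[of _ "\<lambda>k. k + i" "\<lambda>j. j - i"]) (use assms in auto)
  also have "\<dots> = fact (n - i)" by (simp add: fact_prod)
  finally show ?thesis .
qed

text \<open>Only the geometric growth in the degree matters later.\<close>

lemma Remez_crude:
  fixes p :: "real poly"
  assumes E: "compact E" "E \<subseteq> {-r..r}" and r: "r > 0" "measure lborel E \<ge> r"
    and deg: "degree p \<le> n" and S: "\<And>s. s \<in> E \<Longrightarrow> \<bar>poly p s\<bar> \<le> S" and t: "t \<in> {-r..r}"
  shows "\<bar>poly p t\<bar> \<le> 3 * 12 ^ n * S"
proof -
  define d where "d = r / (n + 1)"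
  have d: "d > 0" using r by (simp add: d_def)
  obtain x :: "nat \<Rightarrow> real" where x: "\<And>i. i \<le> n \<Longrightarrow> x i \<in> E"
    "\<And>i j. i < j \<Longrightarrow> j \<le> n \<Longrightarrow> x j - x i \<ge> real (j - i) * d"
    using spaced_points_exist[OF E(1) r, of n] unfolding d_def by metis
  have S0: "S \<ge> 0" using S[OF x(1)[of 0]] by linarith
  have sep: "\<bar>x i - x j\<bar> \<ge> \<bar>real i - real j\<bar> * d" if "i \<le> n" "j \<le> n" for i j
  proof (cases i j rule: linorder_cases)
    case less
    then have eq: "real (j - i) = \<bar>real i - real j\<bar>" by simp
    show ?thesis using x(2)[OF less that(2)] unfolding eq by linarith
  next
    case greater
    then have eq: "real (i - j) = \<bar>real i - real j\<bar>" by simp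
    show ?thesis using x(2)[OF greater that(1)] unfolding eq by linarith
  qed simp
  have inj: "inj_on x {..n}"
  proof (rule inj_onI)
    fix i j assume ij: "i \<in> {..n}" "j \<in> {..n}" "x i = x j"
    then have "\<bar>real i - real j\<bar> * d \<le> 0" using sep[of i j] by simp
    then show "i = j" using d by (simp add: mult_le_0_iff)
  qed
  \<comment> \<open>The spacing lets equally spaced nodes dominate the denominators, and
    \<open>2 r\<close> bounds the numerators; since \<open>d\<close> is proportional to
    \<open>r\<close>, the radius cancels.\<close>
  have bnd: "\<bar>\<Prod>j\<in>{..n} - {i}. (t - x j) / (x i - x j)\<bar> \<le> (2 * real (n + 1)) ^ n / (fact i * fact (n - i))"
    if i: "i \<le> n" for i
  proof -
    have "\<bar>\<Prod>j\<in>{..n} - {i}. (t - x j) / (x i - x j)\<bar> = (\<Prod>j\<in>{..n} - {i}. \<bar>t - x j\<bar> / \<bar>x i - x j\<bar>)"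
      by (simp add: abs_prod)
    also have "\<dots> \<le> (\<Prod>j\<in>{..n} - {i}. (2 * r) / (\<bar>real i - real j\<bar> * d))"
    proof (intro prod_mono conjI frac_le)
      fix j assume j: "j \<in> {..n} - {i}"
      show "\<bar>t - x j\<bar> \<le> 2 * r" using x(1)[of j] j E(2) t by force
      show "\<bar>real i - real j\<bar> * d \<le> \<bar>x i - x j\<bar>" using sep i j by auto
      show "0 < \<bar>real i - real j\<bar> * d" using j d by auto
    qed (use r in auto)
    also have "\<dots> = (\<Prod>j\<in>{..n} - {i}. 2 * real (n + 1)) / (\<Prod>j\<in>{..n} - {i}. \<bar>real i - real j\<bar>)"
      unfolding prod_dividef[symmetric] using r by (intro prod.cong) (auto simp: d_def)
    also have "\<dots> = (2 * real (n + 1)) ^ n / (fact i * fact (n - i))"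
      unfolding prod_abs_diff_nat[OF i] using i by simp
    finally show ?thesis .
  qed
  have "\<bar>poly p t\<bar> \<le> (\<Sum>i\<le>n. \<bar>poly p (x i) * (\<Prod>j\<in>{..n} - {i}. (t - x j) / (x i - x j))\<bar>)"
    unfolding Lagrange_interpolation[OF inj deg, of t] by (rule sum_abs)
  also have "\<dots> \<le> (\<Sum>i\<le>n. S * ((2 * real (n + 1)) ^ n / (fact i * fact (n - i))))"
    unfolding abs_mult using S x(1) bnd S0 by (intro sum_mono mult_mono) auto
  also have "\<dots> = S * (2 * real (n + 1)) ^ n / fact n * (\<Sum>i\<le>n. real (n choose i))"
    unfolding sum_distrib_left by (intro sum.cong) (auto simp: binomial_fact)
  also have "(\<Sum>i\<le>n. real (n choose i)) = 2 ^ n"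
    using choose_row_sum[of n] by (simp flip: of_nat_sum)
  \<comment> \<open>The constant 12 is \<open>4 * 3\<close>: a factor 2 from the length of the
    interval, a factor 2 from the sum of the binomial coefficients, and 3 from the comparison of
    powers with factorials.\<close>
  also have "S * (2 * real (n + 1)) ^ n / fact n * 2 ^ n = S * 4 ^ n * (real (n + 1) ^ n / fact n)"
  proof -
    have "(2 * real (n + 1)) ^ n * 2 ^ n = (2 * real (n + 1) * 2) ^ n" by (rule power_mult_distrib[symmetric])
    also have "\<dots> = (4 * real (n + 1)) ^ n" by (simp add: algebra_simps)
    also have "\<dots> = 4 ^ n * real (n + 1) ^ n" by (rule power_mult_distrib)
    finally show ?thesis by (metis (no_types, opaque_lifting) mult.assoc times_divide_eq_left times_divide_eq_right)
  qed
  also have "\<dots> \<le> S * 4 ^ n * (3 * 3 ^ n)"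
  proof (intro mult_left_mono)
    have "real (n + 1) ^ (n + 1) \<le> 3 ^ (n + 1) * fact (n + 1)" by (rule power_self_le_fact)
    then have "real (n + 1) * real (n + 1) ^ n \<le> real (n + 1) * (3 ^ (n + 1) * fact n)"
      by (simp add: mult_ac)
    then have "real (n + 1) ^ n \<le> 3 ^ (n + 1) * fact n"
      by (rule mult_left_le_imp_le) simp
    then show "real (n + 1) ^ n / fact n \<le> 3 * 3 ^ n" by (simp add: divide_le_eq)
  qed (use S0 in auto)
  also have "\<dots> = 3 * (4 * 3) ^ n * S" unfolding power_mult_distrib by (simp only: mult_ac)
  also have "\<dots> = 3 * 12 ^ n * S" by simp
  finally show ?thesis .
qed

text \<open>Pairing the vector polynomial with its value at \<open>t\<close> reduces to the scalar
  inequality and reproduces the squared norm at \<open>t\<close>.\<close>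

lemma Remez_crude_vector:
  fixes a :: "nat \<Rightarrow> 'm::real_inner"
  assumes E: "compact E" "E \<subseteq> {-r..r}" and r: "r > 0" "measure lborel E \<ge> r"
    and S: "\<And>s. s \<in> E \<Longrightarrow> norm (\<Sum>j\<le>n. s ^ j *\<^sub>R a j) \<le> S" and t: "t \<in> {-r..r}"
  shows "norm (\<Sum>j\<le>n. t ^ j *\<^sub>R a j) \<le> 3 * 12 ^ n * S"
proof -
  define w where "w = (\<Sum>j\<le>n. t ^ j *\<^sub>R a j)"
  define p where "p = (\<Sum>j\<le>n. monom (a j \<bullet> w) j)"
  have p: "poly p s = (\<Sum>j\<le>n. s ^ j *\<^sub>R a j) \<bullet> w" for s
    by (simp add: p_def poly_sum poly_monom inner_sum_left mult.commute)
  have "degree p \<le> n" unfolding p_def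
    by (intro degree_sum_le) (auto intro: order_trans[OF degree_monom_le])
  moreover have "\<bar>poly p s\<bar> \<le> S * norm w" if "s \<in> E" for s
    unfolding p using S[OF that] Cauchy_Schwarz_ineq2 mult_right_mono norm_ge_zero order_trans by blast
  ultimately have "\<bar>poly p t\<bar> \<le> 3 * 12 ^ n * (S * norm w)"
    using Remez_crude[OF E r] t by blast
  moreover have "poly p t = norm w * norm w" unfolding p w_def[symmetric] by (simp add: dot_square_norm power2_eq_square)
  ultimately have *: "norm w * norm w \<le> (3 * 12 ^ n * S) * norm w" by simp
  have "E \<noteq> {}" using r by auto
  then have "S \<ge> 0" using S norm_ge_zero order_trans by blast
  then show ?thesis using mult_right_le_imp_le[OF *] unfolding w_def[symmetric] by (cases "w = 0") auto
qed

text \<open>The coefficients may change with \<open>n\<close>: what is recorded is the rate at which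
  polynomials of each degree approximate \<open>f\<close> near 0 on a real segment.\<close>

definition Taylor_bounded :: "real \<Rightarrow> real \<Rightarrow> real \<Rightarrow> (real \<Rightarrow> 'm::real_normed_vector) \<Rightarrow> bool" where
  "Taylor_bounded C M r f \<longleftrightarrow>
    (\<forall>n. \<exists>a. \<forall>t. \<bar>t\<bar> \<le> r \<longrightarrow> norm (f t - (\<Sum>j\<le>n. t ^ j *\<^sub>R a j)) \<le> M * (C * \<bar>t\<bar>) ^ Suc n)"

text \<open>A replacement for Hartogs' lemma on sequences of subharmonic functions: pointwise geometric
  bounds become locally uniform, at the price of a factor 2 in the rate. On a set of positive
  measure the pointwise bound is uniform, and Remez' inequality is applied to Taylor polynomials
  of a degree proportional to k.\<close>

lemma pointwise_rate_uniform_1: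
  fixes f :: "'z \<Rightarrow> nat \<Rightarrow> real \<Rightarrow> 'm::real_inner" and Z :: "nat \<Rightarrow> 'z set"
  assumes pos: "r > 0" "b > 0" "C > 0" "M > 0" "M0 \<ge> 0"
    and cont: "\<And>z k. z \<in> Z 0 \<Longrightarrow> continuous_on {-r..r} (f z k)"
    and tay: "\<And>z k. z \<in> Z 0 \<Longrightarrow> Taylor_bounded C (M0 * M ^ k) r (f z k)"
    and Z: "\<And>m m'. m \<le> m' \<Longrightarrow> Z m' \<subseteq> Z m"
    and pw: "\<And>t. t \<in> {-r..r} \<Longrightarrow> \<exists>m. \<forall>z\<in>Z m. \<forall>k. norm (f z k t) \<le> real m * b ^ k"
  obtains r' m N where "r' > 0" "r' \<le> r" "\<And>z k t. z \<in> Z m \<Longrightarrow> \<bar>t\<bar> \<le> r' \<Longrightarrow> norm (f z k t) \<le> N * (2 * b) ^ k"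
proof -
  \<comment> \<open>The exchange rate between the two geometric rates:
    \<open>x ^ k \<le> (b / M) ^ k\<close> turns the a priori rate \<open>M\<close> into the
    pointwise rate \<open>b\<close>.\<close>
  define x where "x = min 1 (b / M)"
  have x: "0 < x" "x \<le> 1" "x \<le> b / M" using pos by (auto simp: x_def)
  \<comment> \<open>With degree \<open>n = k div 4\<close> the Taylor error contains
    \<open>(C r') ^ (n + 1)\<close>, and \<open>4 (n + 1) > k\<close>; the fourth power of
    \<open>x\<close> makes this at most \<open>x ^ k\<close>.\<close>
  define r' where "r' = min r (x ^ 4 / C)"
  have r': "r' > 0" "r' \<le> r" "C * r' \<le> x ^ 4"
  proof -
    show "r' > 0" "r' \<le> r" using pos x by (auto simp: r'_def)
    have "C * r' \<le> C * (x ^ 4 / C)" using pos by (intro mult_left_mono) (auto simp: r'_def)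
    then show "C * r' \<le> x ^ 4" using pos by simp
  qed
  \<comment> \<open>These closed sets increase to the whole interval of length \<open>2 r'\<close>,
    so some \<open>E m\<close> has measure above \<open>r'\<close>, as Remez' inequality
    requires.\<close>
  define E where "E m = {t \<in> {-r'..r'}. \<forall>z\<in>Z m. \<forall>k. norm (f z k t) \<le> real m * b ^ k}" for m
  have Ecl: "closed (E m)" for m
  proof -
    have "E m = {-r'..r'} \<inter> (\<Inter>z\<in>Z m. \<Inter>k. {t \<in> {-r'..r'}. norm (f z k t) \<le> real m * b ^ k})"
      by (auto simp: E_def)
    moreover have "closed {t \<in> {-r'..r'}. norm (f z k t) \<le> real m * b ^ k}" if "z \<in> Z m" for z k
    proof -
      have "continuous_on {-r'..r'} (f z k)"
        by (rule continuous_on_subset[OF cont]) (use that Z[of 0 m] r' in auto)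
      then have "closed ({-r'..r'} \<inter> (\<lambda>t. norm (f z k t)) -` {..real m * b ^ k})"
        by (intro continuous_closed_preimage continuous_intros) auto
      then show ?thesis by (simp only: vimage_def Int_def mem_Collect_eq atMost_iff)
    qed
    ultimately show ?thesis by (auto intro!: closed_Int closed_INT)
  qed
  have inc: "incseq E"
  proof (rule monoI)
    fix m m' :: nat assume mm: "m \<le> m'"
    have "real m * b ^ k \<le> real m' * b ^ k" for k using mm pos by (intro mult_right_mono) auto
    show "E m \<subseteq> E m'"
    proof
      fix t assume t: "t \<in> E m"
      have "norm (f z k t) \<le> real m' * b ^ k" if "z \<in> Z m'" for z k
      proof -
        have "norm (f z k t) \<le> real m * b ^ k" using t that Z[OF mm] unfolding E_def by blast
        also have "\<dots> \<le> real m' * b ^ k" using mm pos by (intro mult_right_mono) auto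
        finally show ?thesis .
      qed
      then show "t \<in> E m'" using t unfolding E_def by blast
    qed
  qed
  have "(\<Union>m. E m) = {-r'..r'}"
  proof
    show "(\<Union>m. E m) \<subseteq> {-r'..r'}" unfolding E_def by blast
    show "{-r'..r'} \<subseteq> (\<Union>m. E m)"
    proof
      fix t assume t: "t \<in> {-r'..r'}"
      then have "t \<in> {-r..r}" using r'(2) by auto
      from pw[OF this] obtain m :: nat where "\<forall>z\<in>Z m. \<forall>k. norm (f z k t) \<le> real m * b ^ k" by (elim exE)
      then have "t \<in> E m" using t unfolding E_def by blast
      then show "t \<in> (\<Union>m. E m)" by (rule UN_I[OF UNIV_I])
    qed
  qed
  then have "(\<lambda>m. measure lborel (E m)) \<longlonglongrightarrow> 2 * r'"
    using Lim_measure_incseq[of E lborel] inc r' borel_closed[OF Ecl] by (simp add: image_subset_iff)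
  moreover have "r' < 2 * r'" using r' by simp
  ultimately have "\<forall>\<^sub>F m in sequentially. measure lborel (E m) > r'" by (rule order_tendstoD)
  then obtain m where m: "measure lborel (E m) > r'"
    using eventually_happens'[OF sequentially_bot] by blast
  have Ec: "compact (E m)" "E m \<subseteq> {-r'..r'}"
    using Ecl by (auto simp: compact_eq_bounded_closed E_def intro: bounded_subset[OF bounded_closed_interval])
  define N where "N = 3 * (m + M0) + M0"
  have "norm (f z k t) \<le> N * (2 * b) ^ k" if z: "z \<in> Z m" and t: "\<bar>t\<bar> \<le> r'" for z k t
  proof -
    \<comment> \<open>A quarter of \<open>k\<close> is low enough for
      \<open>12 ^ n \<le> 16 ^ n \<le> 2 ^ k\<close>, the loss of a factor 2, and high enough for
      the Taylor error to reach the rate \<open>b\<close>.\<close>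
    define n where "n = k div 4"
    have z0: "z \<in> Z 0" using z Z[of 0 m] by auto
    obtain a where a: "\<And>s. \<bar>s\<bar> \<le> r \<Longrightarrow> norm (f z k s - (\<Sum>j\<le>n. s ^ j *\<^sub>R a j)) \<le> M0 * M ^ k * (C * \<bar>s\<bar>) ^ Suc n"
      using tay[OF z0, of k] unfolding Taylor_bounded_def by blast
    have err: "norm (f z k s - (\<Sum>j\<le>n. s ^ j *\<^sub>R a j)) \<le> M0 * b ^ k" if s: "\<bar>s\<bar> \<le> r'" for s
    proof -
      have "C * \<bar>s\<bar> \<le> C * r'" using s pos by simp
      then have "C * \<bar>s\<bar> \<le> x ^ 4" using r'(3) by linarith
      then have "(C * \<bar>s\<bar>) ^ Suc n \<le> (x ^ 4) ^ Suc n" using pos by (intro power_mono) auto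
      also have "\<dots> = x ^ (4 * Suc n)" by (simp only: power_mult)
      also have "\<dots> \<le> x ^ k" using x by (intro power_decreasing) (auto simp: n_def)
      also have "\<dots> \<le> (b / M) ^ k" using x by (intro power_mono) auto
      finally have "M0 * M ^ k * (C * \<bar>s\<bar>) ^ Suc n \<le> M0 * M ^ k * (b / M) ^ k"
        using pos by (intro mult_left_mono) auto
      also have "\<dots> = M0 * b ^ k" using pos by (simp add: power_divide)
      finally show ?thesis using a[of s] s r'(2) by linarith
    qed
    have S: "norm (\<Sum>j\<le>n. s ^ j *\<^sub>R a j) \<le> (m + M0) * b ^ k" if s: "s \<in> E m" for s
    proof -
      have "norm (f z k s) \<le> m * b ^ k" "\<bar>s\<bar> \<le> r'" using s z by (auto simp: E_def)
      then show ?thesis using err[of s] norm_triangle_ineq2[of "\<Sum>j\<le>n. s ^ j *\<^sub>R a j" "f z k s"]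
        by (simp add: norm_minus_commute algebra_simps)
    qed
    have "norm (\<Sum>j\<le>n. t ^ j *\<^sub>R a j) \<le> 3 * 12 ^ n * ((m + M0) * b ^ k)"
      using Remez_crude_vector[OF Ec r'(1) less_imp_le[OF m] S] t by (simp add: abs_le_iff)
    also have "\<dots> \<le> 3 * 2 ^ k * ((m + M0) * b ^ k)"
    proof -
      have "(12::real) ^ n \<le> 16 ^ n" by (intro power_mono) auto
      also have "\<dots> = 2 ^ (4 * n)" by (simp add: power_mult)
      also have "\<dots> \<le> 2 ^ k" by (intro power_increasing) (auto simp: n_def)
      finally show ?thesis using pos by (intro mult_right_mono) auto
    qed
    finally have "norm (f z k t) \<le> 3 * 2 ^ k * ((m + M0) * b ^ k) + M0 * b ^ k"
      using err[OF t] norm_triangle_sub[of "f z k t" "\<Sum>j\<le>n. t ^ j *\<^sub>R a j"] by linarith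
    also have "\<dots> \<le> 3 * 2 ^ k * ((m + M0) * b ^ k) + M0 * (2 ^ k * b ^ k)"
      using pos mult_right_mono[of 1 "2 ^ k" "b ^ k"] by (intro add_mono mult_left_mono) auto
    also have "\<dots> = N * (2 * b) ^ k" by (simp add: N_def power_mult_distrib algebra_simps)
    finally show ?thesis .
  qed
  then show thesis using that r'(1,2) by blast
qed

text \<open>Coordinates are functions that vanish off \<open>I\<close>; boxes for different index
  sets thus belong to one type, and changing a coordinate is a function update.\<close>

definition coord_box :: "'i set \<Rightarrow> real \<Rightarrow> ('i \<Rightarrow> real) set" where
  "coord_box I r = {\<xi>. (\<forall>i\<in>I. \<bar>\<xi> i\<bar> \<le> r) \<and> (\<forall>i. i \<notin> I \<longrightarrow> \<xi> i = 0)}"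

text \<open>One coordinate is added at a time. For a fixed value \<open>t\<close> of it the
  induction hypothesis yields uniformity in the others, on a box and with a constant that depend on
  \<open>t\<close>; \<open>pointwise_rate_uniform_1\<close> removes this dependence at the price of
  a factor 2 in the rate.\<close>

theorem pointwise_rate_uniform:
  fixes F :: "nat \<Rightarrow> ('i \<Rightarrow> real) \<Rightarrow> 'm::real_inner"
  assumes "finite I" and "r > 0" "b > 0" "C > 0" "M > 0" "M0 \<ge> 0"
    and "\<And>\<xi> i k. \<xi> \<in> coord_box I r \<Longrightarrow> i \<in> I \<Longrightarrow> continuous_on {-r..r} (\<lambda>t. F k (\<xi>(i := t)))"
    and "\<And>\<xi> i k. \<xi> \<in> coord_box I r \<Longrightarrow> i \<in> I \<Longrightarrow> Taylor_bounded C (M0 * M ^ k) r (\<lambda>t. F k (\<xi>(i := t)))"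
    and "\<And>\<xi>. \<xi> \<in> coord_box I r \<Longrightarrow> \<exists>N. \<forall>k. norm (F k \<xi>) \<le> N * b ^ k"
  shows "\<exists>r'>0. \<exists>N. \<forall>\<xi>\<in>coord_box I r'. \<forall>k. norm (F k \<xi>) \<le> N * (2 ^ card I * b) ^ k"
  using assms
proof (induction I arbitrary: F r rule: finite_induct)
  case empty
  have "coord_box {} r = coord_box {} (1::real)" by (auto simp: coord_box_def)
  moreover have "(\<lambda>_. 0) \<in> coord_box {} r" by (simp add: coord_box_def)
  ultimately show ?case using empty(8)[of "\<lambda>_. 0"]
    by (intro exI[of _ 1]) (auto simp: coord_box_def fun_eq_iff[symmetric])
next
  case (insert i I)
  note cont = insert.prems(6) and tay = insert.prems(7) and pw = insert.prems(8)
  let ?b = "2 ^ card I * b"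
  \<comment> \<open>Boxes shrinking to 0 let a single integer \<open>m\<close> take care of both the
    unknown radius and the unknown constant obtained for each \<open>t\<close>.\<close>
  define Z where "Z m = coord_box I (min r (1 / Suc m))" for m :: nat
  have upd: "\<xi>(i := t) \<in> coord_box (insert i I) r" if "\<xi> \<in> coord_box I r" "\<bar>t\<bar> \<le> r" for \<xi> t
    using that insert.hyps(2) by (auto simp: coord_box_def)
  have mono: "coord_box I s \<subseteq> coord_box I s'" if "s \<le> s'" for s s'
    using that by (force simp: coord_box_def)
  have Z0: "Z m \<subseteq> coord_box I r" for m unfolding Z_def by (rule mono) simp
  have up0: "\<xi> \<in> coord_box (insert i I) r" if "\<xi> \<in> coord_box I r" for \<xi>
    using that insert.prems(1) insert.hyps(2) by (auto simp: coord_box_def)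
  obtain r' m N where *: "r' > 0" "r' \<le> r"
    "\<And>z k t. z \<in> Z m \<Longrightarrow> \<bar>t\<bar> \<le> r' \<Longrightarrow> norm (F k (z(i := t))) \<le> N * (2 * ?b) ^ k"
  proof (rule pointwise_rate_uniform_1[where r = r and b = ?b and C = C and M = M and ?M0.0 = M0 and Z = Z
      and f = "\<lambda>z k t. F k (z(i := t))"])
    show "0 < ?b" using insert.prems(2) by simp
    show "continuous_on {-r..r} (\<lambda>t. F k (z(i := t)))" if "z \<in> Z 0" for z k
      using cont[OF up0] that Z0 by blast
    show "Taylor_bounded C (M0 * M ^ k) r (\<lambda>t. F k (z(i := t)))" if "z \<in> Z 0" for z k
      using tay[OF up0] that Z0 by blast
    show "Z m' \<subseteq> Z m" if "m \<le> m'" for m m'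
      unfolding Z_def using that by (intro mono min.mono) (simp_all add: frac_le)
    fix t assume t: "t \<in> {-r..r}"
    then have t': "\<bar>t\<bar> \<le> r" by auto
    have "\<exists>r'>0. \<exists>N. \<forall>\<xi>\<in>coord_box I r'. \<forall>k. norm (F k (\<xi>(i := t))) \<le> N * ?b ^ k"
    proof (rule insert.IH[OF insert.prems(1-5)])
      fix \<xi> j k assume \<xi>: "\<xi> \<in> coord_box I r" "j \<in> I"
      have com: "\<xi>(j := s, i := t) = \<xi>(i := t, j := s)" for s
        using \<xi>(2) insert.hyps(2) by (intro fun_upd_twist) auto
      show "continuous_on {-r..r} (\<lambda>s. F k (\<xi>(j := s, i := t)))"
          "Taylor_bounded C (M0 * M ^ k) r (\<lambda>s. F k (\<xi>(j := s, i := t)))"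
        unfolding com by (rule cont[OF upd[OF \<xi>(1) t'] insertI2[OF \<xi>(2)]], rule tay[OF upd[OF \<xi>(1) t'] insertI2[OF \<xi>(2)]])
    next
      fix \<xi> assume "\<xi> \<in> coord_box I r"
      then show "\<exists>N. \<forall>k. norm (F k (\<xi>(i := t))) \<le> N * b ^ k" using pw upd t' by blast
    qed
    then obtain r' N where r': "r' > 0" "\<And>\<xi> k. \<xi> \<in> coord_box I r' \<Longrightarrow> norm (F k (\<xi>(i := t))) \<le> N * ?b ^ k" by blast
    obtain m1 :: nat where m1: "1 / Suc m1 < r'" using r'(1) nat_approx_posE by blast
    obtain m2 :: nat where m2: "N \<le> m2" using real_arch_simple by blast
    define m where "m = max m1 m2"
    have "1 / Suc m \<le> 1 / Suc m1" by (simp add: m_def frac_le)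
    then have Zm: "Z m \<subseteq> coord_box I r'" unfolding Z_def using m1 by (intro mono) auto
    have "norm (F k (z(i := t))) \<le> real m * ?b ^ k" if "z \<in> Z m" for z k
    proof -
      have "norm (F k (z(i := t))) \<le> N * ?b ^ k" using r'(2) Zm that by blast
      also have "\<dots> \<le> real m * ?b ^ k" using m2 insert.prems(2) by (intro mult_right_mono) (auto simp: m_def)
      finally show ?thesis .
    qed
    then show "\<exists>m. \<forall>z\<in>Z m. \<forall>k. norm (F k (z(i := t))) \<le> real m * ?b ^ k" by blast
  qed (use insert.prems in auto)
  define r'' where "r'' = min r' (min r (1 / Suc m))"
  have "r'' > 0" using * insert.prems(1) by (simp add: r''_def)
  moreover have "norm (F k \<xi>) \<le> N * (2 ^ card (insert i I) * b) ^ k" if "\<xi> \<in> coord_box (insert i I) r''" for \<xi> k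
  proof -
    have "\<xi>(i := 0) \<in> Z m" "\<bar>\<xi> i\<bar> \<le> r'" using that insert.hyps(2) by (auto simp: Z_def coord_box_def r''_def)
    from *(3)[OF this, of k] show ?thesis using insert.hyps by (simp add: mult.assoc)
  qed
  ultimately show ?case by blast
qed

section \<open>Low-order Taylor estimates and uniform limits within one block\<close>

context elliptic_symbol
begin

text \<open>The orders 0 and 1 of \<open>A_Taylor\<close>, for use when only a function and its
  first derivative are at hand; the sequence of higher derivatives is constructed inside.\<close>

lemma A_Taylor_low:
  obtains K where "K \<ge> 1" and "\<And>x R G G' M. R > 0 \<Longrightarrow> A_derivative_on (ball x R) G G' \<Longrightarrow>
      (\<And>y. y \<in> ball x R \<Longrightarrow> norm (G y) \<le> M) \<Longrightarrow>
      (\<forall>y\<in>ball x (R/2). norm (G' y) \<le> M * (K / R)) \<and>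
      (\<forall>h. norm h < R / 2 \<longrightarrow> norm (G (x + h) - G x) \<le> M * (K * norm h / R)) \<and>
      (\<forall>h. norm h < R / 2 \<longrightarrow> norm (G (x + h) - G x - A h (G' x)) \<le> M * (K * norm h / R)\<^sup>2)"
proof -
  obtain K where K: "K \<ge> 1" and T: "\<And>x R Gs M. R > 0 \<Longrightarrow> (\<And>j. A_derivative_on (ball x R) (Gs j) (Gs (Suc j))) \<Longrightarrow>
      (\<And>y. y \<in> ball x R \<Longrightarrow> norm (Gs 0 y) \<le> M) \<Longrightarrow>
      (\<forall>j. norm (Gs j x) \<le> M * fact j * (K / R) ^ j) \<and>
      (\<forall>j. \<forall>y \<in> ball x (R/2). norm (Gs j y) \<le> M * fact j * (K / R) ^ j) \<and>
      (\<forall>n h. norm h < R / 2 \<longrightarrow> norm (Gs 0 (x + h) - (\<Sum>j\<le>n. (1 / fact j) *\<^sub>R ((blinfun_apply (A h)) ^^ j) (Gs j x)))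
         \<le> M * (K * norm h / R) ^ Suc n)"
    by (rule A_Taylor) blast
  show thesis
  proof (rule that[OF K])
    fix x R G G' M assume R: "R > 0" and G: "A_derivative_on (ball x R) G G'"
      and M: "\<And>y. y \<in> ball x R \<Longrightarrow> norm (G y) \<le> M"
    obtain Gs where Gs: "Gs 0 = G" "\<And>j. A_derivative_on (ball x R) (Gs j) (Gs (Suc j))"
      by (rule A_derivative_sequence[OF open_ball G]) blast
    have G1: "Gs 1 y = G' y" if "y \<in> ball x R" for y
      using A_derivative_on_unique[OF _ G that, of "Gs 1"] Gs(2)[of 0] Gs(1) by simp
    have t: "(\<forall>j. \<forall>y \<in> ball x (R/2). norm (Gs j y) \<le> M * fact j * (K / R) ^ j) \<and>
      (\<forall>n h. norm h < R / 2 \<longrightarrow> norm (Gs 0 (x + h) - (\<Sum>j\<le>n. (1 / fact j) *\<^sub>R ((blinfun_apply (A h)) ^^ j) (Gs j x)))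
         \<le> M * (K * norm h / R) ^ Suc n)"
      using T[where Gs = Gs and M = M, OF R Gs(2)] M Gs(1) by simp
    have a: "norm (G' y) \<le> M * (K / R)" if y: "y \<in> ball x (R / 2)" for y
    proof -
      have "y \<in> ball x R" using y R by simp
      then have "norm (G' y) = norm (Gs 1 y)" using G1 by simp
      also have "\<dots> \<le> M * fact 1 * (K / R) ^ 1" using t y by blast
      finally show ?thesis by simp
    qed
    have x: "x \<in> ball x R" using R by simp
    have b: "norm (G (x + h) - G x) \<le> M * (K * norm h / R)" if "norm h < R / 2" for h
      using conjunct2[OF t, rule_format, OF that, of 0] by (simp add: Gs(1))
    have c: "norm (G (x + h) - G x - A h (G' x)) \<le> M * (K * norm h / R)\<^sup>2" if "norm h < R / 2" for h
      using conjunct2[OF t, rule_format, OF that, of 1] G1[OF x]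
      by (simp add: Gs(1) power2_eq_square diff_diff_eq)
    show "(\<forall>y\<in>ball x (R/2). norm (G' y) \<le> M * (K / R)) \<and>
      (\<forall>h. norm h < R / 2 \<longrightarrow> norm (G (x + h) - G x) \<le> M * (K * norm h / R)) \<and>
      (\<forall>h. norm h < R / 2 \<longrightarrow> norm (G (x + h) - G x - A h (G' x)) \<le> M * (K * norm h / R)\<^sup>2)"
      using a b c by blast
  qed
qed

text \<open>Weierstrass' theorem: Cauchy's estimate applied to differences makes the derivatives
  converge uniformly on the ball of half the radius, and then the limit may be
  differentiated.\<close>

lemma A_uniform_limit:
  fixes G G' :: "nat \<Rightarrow> 'e \<Rightarrow> 'm"
  assumes R: "R > 0" and G: "\<And>n. A_derivative_on (ball x R) (G n) (G' n)"
    and lim: "\<And>e. e > 0 \<Longrightarrow> \<exists>N. \<forall>n\<ge>N. \<forall>y\<in>ball x R. norm (G n y - L y) \<le> e"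
  shows "\<exists>v. (L has_derivative (\<lambda>h. A h v)) (at x)"
proof -
  let ?S = "ball x (R / 2)"
  obtain C where C: "C \<ge> 1" "\<And>x R G G' M. R > 0 \<Longrightarrow> A_derivative_on (ball x R) G G' \<Longrightarrow>
    (\<And>y. y \<in> ball x R \<Longrightarrow> norm (G y) \<le> M) \<Longrightarrow> norm (G' x) \<le> C * M / R"
    by (rule A_Cauchy_estimate) blast
  obtain a where a: "a \<ge> 1" "\<And>h. norm (A h) \<le> a * norm h" using norm_A_bound by blast
  have cauchy: "\<exists>N. \<forall>m\<ge>N. \<forall>n\<ge>N. \<forall>y\<in>?S. norm (G' m y - G' n y) \<le> e" if e: "e > 0" for e
  proof -
    define e' where "e' = e * R / (4 * C)"
    have e': "e' > 0" "C * (2 * e') / (R / 2) = e" using e R C(1) by (simp_all add: e'_def)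
    obtain N where N: "\<And>n y. n \<ge> N \<Longrightarrow> y \<in> ball x R \<Longrightarrow> norm (G n y - L y) \<le> e'"
      using lim[OF e'(1)] by blast
    have "norm (G' m y - G' n y) \<le> e" if mn: "m \<ge> N" "n \<ge> N" and y: "y \<in> ?S" for m n y
    proof -
      have sub: "ball y (R / 2) \<subseteq> ball x R"
      proof
        fix z assume "z \<in> ball y (R / 2)"
        then show "z \<in> ball x R" using y dist_triangle[of x z y] by simp
      qed
      have "norm (G m z - G n z) \<le> 2 * e'" if "z \<in> ball y (R / 2)" for z
      proof -
        have "norm (G m z - G n z) \<le> norm (G m z - L z) + norm (G n z - L z)"
          using norm_triangle_ineq4[of "G m z - L z" "G n z - L z"] by simp
        then show ?thesis using N[OF mn(1)] N[OF mn(2)] that sub by (smt (verit) subsetD)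
      qed
      then have "norm (G' m y - G' n y) \<le> C * (2 * e') / (R / 2)"
        using R by (intro C(2)[OF _ A_derivative_on_subset[OF A_derivative_on_minus[OF G G] sub]]) auto
      then show ?thesis using e'(2) by simp
    qed
    then show ?thesis by blast
  qed
  have "uniformly_convergent_on ?S G'"
    unfolding uniformly_convergent_eq_Cauchy uniformly_Cauchy_on_def
  proof (intro allI impI)
    fix e :: real assume "e > 0"
    then obtain N where "\<forall>m\<ge>N. \<forall>n\<ge>N. \<forall>y\<in>?S. norm (G' m y - G' n y) \<le> e / 2"
      using cauchy[of "e / 2"] by auto
    then show "\<exists>M. \<forall>y\<in>?S. \<forall>m\<ge>M. \<forall>n\<ge>M. dist (G' m y) (G' n y) < e"
      using \<open>e > 0\<close> by (intro exI[of _ N]) (force simp: dist_norm)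
  qed
  then obtain g where g: "uniform_limit ?S G' g sequentially"
    by (auto simp: uniformly_convergent_on_def)
  have xS: "x \<in> ?S" using R by simp
  have ptw: "(\<lambda>n. G n y) \<longlonglongrightarrow> L y" if y: "y \<in> ?S" for y
  proof (rule LIMSEQ_I)
    fix e :: real assume "e > 0"
    then obtain N where "\<forall>n\<ge>N. \<forall>y\<in>ball x R. norm (G n y - L y) \<le> e / 2" using lim[of "e / 2"] by auto
    moreover have "y \<in> ball x R" using y R by simp
    ultimately show "\<exists>N. \<forall>n\<ge>N. norm (G n y - L y) < e"
      using \<open>e > 0\<close> by (intro exI[of _ N]) force
  qed
  have "\<exists>g'. \<forall>y\<in>?S. (\<lambda>n. G n y) \<longlonglongrightarrow> g' y \<and> (g' has_derivative (\<lambda>h. A h (g y))) (at y within ?S)"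
  proof (rule has_derivative_sequence[where f = G, OF convex_ball _ _ xS ptw[OF xS]])
    show "(G n has_derivative (\<lambda>h. A h (G' n y))) (at y within ?S)" if "y \<in> ?S" for n y
      using that R by (intro A_derivative_onD[OF G]) auto
    fix e :: real assume e: "e > 0"
    have "\<forall>\<^sub>F n in sequentially. \<forall>y\<in>?S. dist (G' n y) (g y) < e / a"
      using g e a(1) unfolding uniform_limit_iff by simp
    then show "\<forall>\<^sub>F n in sequentially. \<forall>y\<in>?S. \<forall>h. norm (A h (G' n y) - A h (g y)) \<le> e * norm h"
    proof (rule eventually_mono, intro ballI allI)
      fix n y h assume *: "\<forall>y\<in>?S. dist (G' n y) (g y) < e / a" and y: "y \<in> ?S"
      have "norm (A h (G' n y) - A h (g y)) \<le> norm (A h) * norm (G' n y - g y)"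
        unfolding blinfun.diff_right[symmetric] by (rule norm_blinfun)
      also have "\<dots> \<le> (a * norm h) * (e / a)"
        using * y a by (intro mult_mono) (auto simp: dist_norm less_imp_le)
      finally show "norm (A h (G' n y) - A h (g y)) \<le> e * norm h" using a(1) by (simp add: mult.commute)
    qed
  qed
  then obtain g' where g': "\<And>y. y \<in> ?S \<Longrightarrow> (\<lambda>n. G n y) \<longlonglongrightarrow> g' y"
     "\<And>y. y \<in> ?S \<Longrightarrow> (g' has_derivative (\<lambda>h. A h (g y))) (at y within ?S)" by blast
  have "g' y = L y" if "y \<in> ?S" for y using LIMSEQ_unique[OF g'(1) ptw] that by blast
  moreover have "(g' has_derivative (\<lambda>h. A h (g x))) (at x)"
    using g'(2)[OF xS] at_within_open[OF xS open_ball] by simp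
  ultimately have "(L has_derivative (\<lambda>h. A h (g x))) (at x)"
    by (rule_tac has_derivative_transform_within_open[OF _ open_ball xS])
  then show ?thesis by blast
qed

end

section \<open>Hartogs' theorem for several blocks\<close>

text \<open>Blocks outside \<open>B\<close> are frozen at the centre. Polydiscs in fewer blocks, and
  slices with centre \<open>c(b := w)\<close>, are therefore sets of the same type, which suits
  induction on the blocks.\<close>

definition polydisc :: "'b set \<Rightarrow> ('b \<Rightarrow> 'e::metric_space) \<Rightarrow> real \<Rightarrow> ('b \<Rightarrow> 'e) set" where
  "polydisc B c R = {y. (\<forall>b\<in>B. dist (c b) (y b) < R) \<and> (\<forall>b. b \<notin> B \<longrightarrow> y b = c b)}"

lemma polydisc_upd: "y \<in> polydisc B c R \<Longrightarrow> b \<in> B \<Longrightarrow> dist (c b) h < R \<Longrightarrow> y(b := h) \<in> polydisc B c R"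
  by (auto simp: polydisc_def)

lemma polydisc_mono: "R \<le> R' \<Longrightarrow> polydisc B c R \<subseteq> polydisc B c R'"
  by (fastforce simp: polydisc_def)

lemma polydisc_shrink:
  assumes "finite B" "y \<in> polydisc B c R"
  obtains r where "r < R" "y \<in> polydisc B c r"
proof (cases "B = {}")
  case True
  then show thesis using that[of "R - 1"] assms(2) by (auto simp: polydisc_def)
next
  case False
  define r where "r = (Max ((\<lambda>b. dist (c b) (y b)) ` B) + R) / 2"
  have "Max ((\<lambda>b. dist (c b) (y b)) ` B) < R"
    using assms False by (subst Max_less_iff) (auto simp: polydisc_def)
  moreover have "dist (c b) (y b) \<le> Max ((\<lambda>b. dist (c b) (y b)) ` B)" if "b \<in> B" for b
    using assms(1) that by (intro Max_ge) auto
  ultimately have "r < R" "y \<in> polydisc B c r"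
    using assms(2) by (fastforce simp: polydisc_def r_def)+
  then show thesis using that by blast
qed

definition sep_A_differentiable ::
  "('b \<Rightarrow> 'e::euclidean_space \<Rightarrow> ('m::euclidean_space \<Rightarrow>\<^sub>L 'm)) \<Rightarrow> 'b set \<Rightarrow> ('b \<Rightarrow> 'e) \<Rightarrow> real \<Rightarrow> (('b \<Rightarrow> 'e) \<Rightarrow> 'm) \<Rightarrow> bool"
where
  "sep_A_differentiable A B c R H \<longleftrightarrow> (\<forall>y\<in>polydisc B c R. \<forall>b\<in>B.
     \<exists>v. ((\<lambda>h. H (y(b := h))) has_derivative (\<lambda>h. A b h v)) (at (y b)))"

text \<open>Boundedness on strictly smaller polydiscs is the form that passes to derivatives by
  Cauchy's estimate without loss of radius.\<close>

definition bounded_inside :: "'b set \<Rightarrow> ('b \<Rightarrow> 'e::metric_space) \<Rightarrow> real \<Rightarrow> (('b \<Rightarrow> 'e) \<Rightarrow> 'm::real_normed_vector) \<Rightarrow> bool" where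
  "bounded_inside B c R H \<longleftrightarrow> (\<forall>r<R. \<exists>M. \<forall>y\<in>polydisc B c r. norm (H y) \<le> M)"

text \<open>One Euclidean space and one direction \<open>u0\<close> serve all blocks, so that a
  point is a function from blocks to vectors; blocks of different size will be padded to
  fit.\<close>

locale elliptic_family =
  fixes A :: "'b \<Rightarrow> 'e::euclidean_space \<Rightarrow> ('m::euclidean_space \<Rightarrow>\<^sub>L 'm)" and u0 :: 'e and B0 :: "'b set"
  assumes finite_B0: "finite B0" and symbol: "b \<in> B0 \<Longrightarrow> elliptic_symbol (A b) u0"
begin

abbreviation "Adiff b \<equiv> elliptic_symbol.A_derivative_on (A b)"

text \<open>As \<open>A b u0\<close> is the identity, the derivative along \<open>u0\<close> is the
  vector that represents the full derivative in block \<open>b\<close>. As a map on total functions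
  it can be iterated with \<open>^^\<close>.\<close>

definition part :: "'b \<Rightarrow> (('b \<Rightarrow> 'e) \<Rightarrow> 'm) \<Rightarrow> ('b \<Rightarrow> 'e) \<Rightarrow> 'm" where
  "part b H y = frechet_derivative (\<lambda>h. H (y(b := h))) (at (y b)) u0"

lemma part_eqI:
  assumes "b \<in> B0" "((\<lambda>h. H (y(b := h))) has_derivative (\<lambda>h. A b h v)) (at (y b))"
  shows "part b H y = v"
proof -
  interpret elliptic_symbol "A b" u0 using symbol[OF assms(1)] .
  show ?thesis using frechet_derivative_at[OF assms(2)] unfolding part_def by (metis A_u0')
qed

lemma Adiff_part:
  assumes b: "b \<in> B0" and "Adiff b U (\<lambda>h. H (y(b := h))) G'"
  shows "Adiff b U (\<lambda>h. H (y(b := h))) (\<lambda>h. part b H (y(b := h)))"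
proof -
  interpret elliptic_symbol "A b" u0 using symbol[OF b] .
  have eq: "part b H (y(b := h)) = G' h" if "h \<in> U" for h
    using assms(2) that by (intro part_eqI[OF b]) (simp add: A_derivative_on_def)
  show ?thesis
    unfolding A_derivative_on_def
  proof
    fix h assume h: "h \<in> U"
    show "((\<lambda>h. H (y(b := h))) has_derivative (\<lambda>k. A b k (part b H (y(b := h))))) (at h)"
      unfolding eq[OF h] using assms(2) h unfolding A_derivative_on_def by (rule bspec)
  qed
qed

lemma Adiff_part_iterate:
  assumes b: "b \<in> B0" and U: "open U" and G: "Adiff b U (\<lambda>h. H (y(b := h))) G'"
  shows "Adiff b U (\<lambda>h. (part b ^^ k) H (y(b := h))) (\<lambda>h. (part b ^^ Suc k) H (y(b := h)))"
proof -
  interpret elliptic_symbol "A b" u0 using symbol[OF b] .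
  show ?thesis
  proof (induction k)
    case 0
    then show ?case using Adiff_part[OF b G] by (simp del: fun_upd_apply)
  next
    case (Suc k)
    obtain G'' where "Adiff b U (\<lambda>h. (part b ^^ Suc k) H (y(b := h))) G''"
      by (rule A_derivative_regular[OF U Suc])
    then show ?case using Adiff_part[OF b, of U "(part b ^^ Suc k) H" y] by (simp del: fun_upd_apply)
  qed
qed

lemma sep_Adiff:
  assumes "B \<subseteq> B0" "sep_A_differentiable A B c R H" "y \<in> polydisc B c R" "b \<in> B"
  shows "Adiff b (ball (c b) R) (\<lambda>h. H (y(b := h))) (\<lambda>h. part b H (y(b := h)))"
proof -
  have b: "b \<in> B0" using assms by auto
  interpret elliptic_symbol "A b" u0 using symbol[OF b] .
  have "\<exists>v. ((\<lambda>h. H (y(b := h))) has_derivative (\<lambda>h. A b h v)) (at h)" if "h \<in> ball (c b) R" for h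
    using assms(2) polydisc_upd[OF assms(3,4), of h] that assms(4)
    unfolding sep_A_differentiable_def by fastforce
  then obtain G' where "Adiff b (ball (c b) R) (\<lambda>h. H (y(b := h))) G'"
    unfolding A_derivative_on_def by metis
  then show ?thesis by (rule Adiff_part[OF b])
qed

lemma sep_A_differentiable_mono:
  assumes "sep_A_differentiable A B c R H" "polydisc B' c' R' \<subseteq> polydisc B c R" "B' \<subseteq> B"
  shows "sep_A_differentiable A B' c' R' H"
  using assms unfolding sep_A_differentiable_def by blast

lemma ball_subset_polydisc:
  assumes "y \<in> polydisc B c r" "b \<in> B"
  shows "ball (y b) (R - r) \<subseteq> ball (c b) R"
proof
  fix h assume "h \<in> ball (y b) (R - r)"
  moreover have "dist (c b) (y b) < r" using assms by (auto simp: polydisc_def)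
  ultimately show "h \<in> ball (c b) R" using dist_triangle[of "c b" h "y b"] by simp
qed

text \<open>In a block \<open>a\<close> other than \<open>b\<close>, \<open>part b H\<close> is a
  locally uniform limit of difference quotients of \<open>H\<close> along \<open>u0\<close> in block
  \<open>b\<close>: the quadratic Taylor estimate is uniform because \<open>H\<close> is bounded,
  and \<open>A_uniform_limit\<close> applies. In block \<open>b\<close> itself this is the
  regularity of the derivative, and boundedness follows from Cauchy's estimate.\<close>

theorem part_sep_A_differentiable:
  assumes B: "B \<subseteq> B0" and H: "sep_A_differentiable A B c R H" "bounded_inside B c R H" and b: "b \<in> B"
  shows "sep_A_differentiable A B c R (part b H)" "bounded_inside B c R (part b H)"
proof -
  have finB: "finite B" using B finite_B0 finite_subset by blast
  have bB: "b \<in> B0" using b B by auto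
  interpret Ab: elliptic_symbol "A b" u0 using symbol[OF bB] .
  obtain K where K: "K \<ge> 1" and T: "\<And>x R G G' M. R > 0 \<Longrightarrow> Adiff b (ball x R) G G' \<Longrightarrow>
      (\<And>y. y \<in> ball x R \<Longrightarrow> norm (G y) \<le> M) \<Longrightarrow>
      (\<forall>y\<in>ball x (R/2). norm (G' y) \<le> M * (K / R)) \<and>
      (\<forall>h. norm h < R / 2 \<longrightarrow> norm (G (x + h) - G x) \<le> M * (K * norm h / R)) \<and>
      (\<forall>h. norm h < R / 2 \<longrightarrow> norm (G (x + h) - G x - A b h (G' x)) \<le> M * (K * norm h / R)\<^sup>2)"
    by (rule Ab.A_Taylor_low) blast
  have near: "norm (part b H y) \<le> M * (K / (s - r)) \<and> (\<forall>h. norm h < (s - r) / 2 \<longrightarrow>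
      norm (H (y(b := y b + h)) - H y - A b h (part b H y)) \<le> M * (K * norm h / (s - r))\<^sup>2)"
    if rs: "r < s" "s < R" and M: "\<And>y. y \<in> polydisc B c s \<Longrightarrow> norm (H y) \<le> M" and y: "y \<in> polydisc B c r" for r s M y
  proof -
    have pos: "s - r > 0" using rs by simp
    have yR: "y \<in> polydisc B c R" using polydisc_mono[of r R B c] rs y by auto
    have sub: "ball (y b) (s - r) \<subseteq> ball (c b) s" using ball_subset_polydisc[OF y b, of s] by simp
    have sub': "ball (y b) (s - r) \<subseteq> ball (c b) R" using sub rs by (meson subset_ball less_imp_le order_trans)
    have "norm (H (y(b := h))) \<le> M" if "h \<in> ball (y b) (s - r)" for h
      using that sub polydisc_mono[of r s B c] rs y b by (intro M polydisc_upd) auto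
    from T[OF pos Ab.A_derivative_on_subset[OF sep_Adiff[OF B H(1) yR b] sub'] this]
    show ?thesis using pos by (auto dest: bspec[of _ _ "y b"])
  qed
  show "bounded_inside B c R (part b H)"
    unfolding bounded_inside_def
  proof (intro allI impI)
    fix r assume r: "r < R"
    define s where "s = (r + R) / 2"
    have s: "r < s" "s < R" using r by (simp_all add: s_def)
    obtain M where "\<And>y. y \<in> polydisc B c s \<Longrightarrow> norm (H y) \<le> M"
      using H(2) s(2) unfolding bounded_inside_def by blast
    then show "\<exists>M. \<forall>y\<in>polydisc B c r. norm (part b H y) \<le> M" using near[OF s] by blast
  qed
  show "sep_A_differentiable A B c R (part b H)"
    unfolding sep_A_differentiable_def
  proof (intro ballI)
    fix y a assume y: "y \<in> polydisc B c R" and a: "a \<in> B"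
    have aB: "a \<in> B0" using a B by auto
    interpret Aa: elliptic_symbol "A a" u0 using symbol[OF aB] .
    show "\<exists>v. ((\<lambda>h. part b H (y(a := h))) has_derivative (\<lambda>h. A a h v)) (at (y a))"
    proof (cases "a = b")
      case True
      obtain G'' where "Adiff b (ball (c b) R) (\<lambda>h. part b H (y(b := h))) G''"
        by (rule Ab.A_derivative_regular[OF open_ball sep_Adiff[OF B H(1) y b]])
      moreover have "y b \<in> ball (c b) R" using y b by (auto simp: polydisc_def)
      ultimately show ?thesis using True unfolding Ab.A_derivative_on_def by blast
    next
      case False
      obtain r where r: "r < R" "y \<in> polydisc B c r" by (rule polydisc_shrink[OF finB y])
      \<comment> \<open>Two steps of length \<open>\<delta>\<close> stay inside radius
        \<open>R\<close>: one for moving block \<open>a\<close>, one for the Taylor estimate in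
        block \<open>b\<close>.\<close>
      define \<delta> where "\<delta> = (R - r) / 4"
      define r1 where "r1 = r + \<delta>"
      define s where "s = r1 + \<delta>"
      have \<delta>: "\<delta> > 0" using r by (simp add: \<delta>_def)
      have rs: "r1 < s" "s < R" using r(1) by (simp_all add: s_def r1_def \<delta>_def field_simps)
      have sr: "s - r1 = \<delta>" by (simp add: s_def)
      obtain M where M: "\<And>y. y \<in> polydisc B c s \<Longrightarrow> norm (H y) \<le> M"
        using H(2) rs(2) unfolding bounded_inside_def by blast
      \<comment> \<open>Step widths that tend to 0 and stay below \<open>\<delta> / 2\<close>, the
        range of the Taylor estimate.\<close>
      define t where "t n = \<delta> / (2 * real (n + 2))" for n :: nat
      have t: "t n > 0" "t n < \<delta> / 2" for n
        unfolding t_def using \<delta> by (simp, intro divide_strict_left_mono) auto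
      define \<phi> where "\<phi> n h = (1 / t n) *\<^sub>R (H (y(a := h, b := y b + t n *\<^sub>R u0)) - H (y(a := h)))" for n h
      have ya: "y(a := h) \<in> polydisc B c r1" if "h \<in> ball (y a) \<delta>" for h
      proof -
        have "dist (c a) h < r1"
          using that r(2) a dist_triangle[of "c a" h "y a"] by (fastforce simp: polydisc_def r1_def)
        then show ?thesis using polydisc_mono[of r r1 B c] r(2) \<delta> a by (intro polydisc_upd) (auto simp: r1_def)
      qed
      have yb: "y(b := y b + t n *\<^sub>R u0) \<in> polydisc B c R" for n
      proof -
        have "norm (t n *\<^sub>R u0) < \<delta>" using t[of n] \<delta> Ab.u0_Basis by simp
        then have "dist (c b) (y b + t n *\<^sub>R u0) < R"
          using r b dist_triangle[of "c b" "y b + t n *\<^sub>R u0" "y b"]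
          by (fastforce simp: polydisc_def \<delta>_def dist_norm)
        then show ?thesis using y b by (intro polydisc_upd)
      qed
      show ?thesis
      proof (rule Aa.A_uniform_limit[OF \<delta>])
        fix n
        have sub: "ball (y a) \<delta> \<subseteq> ball (c a) R"
          using ball_subset_polydisc[OF r(2) a, of R] r(1) \<delta> by (auto simp: \<delta>_def)
        have com: "y(a := h, b := w) = (y(b := w))(a := h)" for h w using False by auto
        show "Adiff a (ball (y a) \<delta>) (\<phi> n)
          (\<lambda>h. (1 / t n) *\<^sub>R (part a H (y(a := h, b := y b + t n *\<^sub>R u0)) - part a H (y(a := h))))"
          unfolding \<phi>_def com
          by (intro Aa.A_derivative_on_scaleR Aa.A_derivative_on_minus
              Aa.A_derivative_on_subset[OF sep_Adiff[OF B H(1) yb a] sub]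
              Aa.A_derivative_on_subset[OF sep_Adiff[OF B H(1) y a] sub])
      next
        fix e :: real assume e: "e > 0"
        have lim: "(\<lambda>n. M * K\<^sup>2 / \<delta>\<^sup>2 * t n) \<longlonglongrightarrow> M * K\<^sup>2 / \<delta>\<^sup>2 * 0"
        proof (intro tendsto_mult_left)
          have "(\<lambda>n. \<delta> / 2 * inverse (real (n + 2))) \<longlonglongrightarrow> \<delta> / 2 * 0"
          proof (intro tendsto_mult_left)
            have "n + 2 = Suc (n + 1)" for n :: nat by simp
            then show "(\<lambda>n. inverse (real (n + 2))) \<longlonglongrightarrow> 0"
              using LIMSEQ_ignore_initial_segment[OF LIMSEQ_inverse_real_of_nat, of 1] by presburger
          qed
          then show "t \<longlonglongrightarrow> 0" unfolding t_def by (simp add: field_simps)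
        qed
        then have "\<forall>\<^sub>F n in sequentially. M * K\<^sup>2 / \<delta>\<^sup>2 * t n < e"
          using e by (intro order_tendstoD(2)[OF lim]) simp
        then obtain N where N: "\<And>n. n \<ge> N \<Longrightarrow> M * K\<^sup>2 / \<delta>\<^sup>2 * t n < e"
          unfolding eventually_sequentially by blast
        have "norm (\<phi> n h - part b H (y(a := h))) \<le> e" if n: "n \<ge> N" and h: "h \<in> ball (y a) \<delta>" for n h
        proof -
          let ?y = "y(a := h)"
          have nt: "norm (t n *\<^sub>R u0) = t n" using t(1)[of n] Ab.u0_Basis by simp
          have "norm (H (?y(b := ?y b + t n *\<^sub>R u0)) - H ?y - A b (t n *\<^sub>R u0) (part b H ?y)) \<le> M * (K * t n / \<delta>)\<^sup>2"
            using conjunct2[OF near[OF rs M ya[OF h]]] nt t(2)[of n] unfolding sr by metis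
          moreover have "A b (t n *\<^sub>R u0) (part b H ?y) = t n *\<^sub>R part b H ?y"
            by (simp add: linear_scale[OF Ab.linear_A] blinfun.scaleR_left Ab.A_u0')
          ultimately have 1: "norm (H (?y(b := ?y b + t n *\<^sub>R u0)) - H ?y - t n *\<^sub>R part b H ?y) \<le> M * (K * t n / \<delta>)\<^sup>2"
            by simp
          have "\<phi> n h - part b H ?y = (1 / t n) *\<^sub>R (H (?y(b := ?y b + t n *\<^sub>R u0)) - H ?y - t n *\<^sub>R part b H ?y)"
            using False t(1)[of n] by (simp add: \<phi>_def scaleR_diff_right)
          then have "norm (\<phi> n h - part b H ?y) = (1 / t n) * norm (H (?y(b := ?y b + t n *\<^sub>R u0)) - H ?y - t n *\<^sub>R part b H ?y)"
            using t(1)[of n] by simp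
          also have "\<dots> \<le> (1 / t n) * (M * (K * t n / \<delta>)\<^sup>2)"
            using 1 t(1)[of n] by (intro mult_left_mono) auto
          also have "\<dots> = M * K\<^sup>2 / \<delta>\<^sup>2 * t n"
            using t(1)[of n] by (simp add: power2_eq_square)
          finally show ?thesis using N[OF n] by simp
        qed
        then show "\<exists>N. \<forall>n\<ge>N. \<forall>h\<in>ball (y a) \<delta>. norm (\<phi> n h - part b H (y(a := h))) \<le> e" by blast
      qed
    qed
  qed
qed

lemma part_iterate_sep:
  assumes "B \<subseteq> B0" "sep_A_differentiable A B c R H" "bounded_inside B c R H" "b \<in> B"
  shows "sep_A_differentiable A B c R ((part b ^^ k) H) \<and> bounded_inside B c R ((part b ^^ k) H)"
  by (induction k) (use assms part_sep_A_differentiable[OF assms(1) _ _ assms(4)] in auto)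

end

lemma closed_cover_interior:
  fixes E :: "nat \<Rightarrow> 'e::euclidean_space set"
  assumes "\<And>m. closed (E m)" "s > 0" "ball x s \<subseteq> (\<Union>m. E m)"
  obtains m where "interior (E m) \<noteq> {}"
proof -
  have "\<exists>m. interior (E m) \<noteq> {}"
  proof (rule ccontr)
    assume "\<not> (\<exists>m. interior (E m) \<noteq> {})"
    then have "euclidean interior_of \<Union>(range E) = {}"
      using assms(1) by (intro Baire_category_alt) (auto simp: completely_metrizable_space_euclidean)
    moreover have "x \<in> interior (\<Union>(range E))"
      using assms(2,3) by (intro interiorI[OF open_ball]) auto
    ultimately show False by simp
  qed
  then show thesis using that by blast
qed

section \<open>A common Taylor constant, Baire's theorem and uniform coefficient bounds\<close>

context elliptic_family
begin

text \<open>A predicate that survives enlarging \<open>K\<close>, so that a sum over the finitely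
  many blocks gives one constant for all of them.\<close>

definition Taylor_constant :: "'b \<Rightarrow> real \<Rightarrow> bool" where
  "Taylor_constant b K \<longleftrightarrow> K \<ge> 1 \<and> (\<forall>h. norm (A b h) \<le> K * norm h) \<and>
    (\<forall>x R Gs M. R > 0 \<longrightarrow> (\<forall>j. Adiff b (ball x R) (Gs j) (Gs (Suc j))) \<longrightarrow> (\<forall>y \<in> ball x R. norm (Gs 0 y) \<le> M) \<longrightarrow>
      (\<forall>j. norm (Gs j x) \<le> M * fact j * (K / R) ^ j) \<and>
      (\<forall>n h. norm h < R / 2 \<longrightarrow> norm (Gs 0 (x + h) - (\<Sum>j\<le>n. (1 / fact j) *\<^sub>R ((blinfun_apply (A b h)) ^^ j) (Gs j x)))
         \<le> M * (K * norm h / R) ^ Suc n))"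

lemma Taylor_constantD:
  assumes "Taylor_constant b K"
  shows "K \<ge> 1" "norm (A b h) \<le> K * norm h"
    "R > 0 \<Longrightarrow> (\<And>j. Adiff b (ball x R) (Gs j) (Gs (Suc j))) \<Longrightarrow> (\<And>y. y \<in> ball x R \<Longrightarrow> norm (Gs 0 y) \<le> M) \<Longrightarrow>
      norm (Gs j x) \<le> M * fact j * (K / R) ^ j"
    "R > 0 \<Longrightarrow> (\<And>j. Adiff b (ball x R) (Gs j) (Gs (Suc j))) \<Longrightarrow> (\<And>y. y \<in> ball x R \<Longrightarrow> norm (Gs 0 y) \<le> M) \<Longrightarrow>
      norm k < R / 2 \<Longrightarrow> norm (Gs 0 (x + k) - (\<Sum>j\<le>n. (1 / fact j) *\<^sub>R ((blinfun_apply (A b k)) ^^ j) (Gs j x)))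
         \<le> M * (K * norm k / R) ^ Suc n"
  using assms unfolding Taylor_constant_def by simp_all

lemma Taylor_constant_mono:
  assumes T: "Taylor_constant b K" and K: "K \<le> K'"
  shows "Taylor_constant b K'"
  unfolding Taylor_constant_def
proof (intro conjI allI impI)
  have K1: "K \<ge> 1" using Taylor_constantD(1)[OF T] .
  show "1 \<le> K'" using K1 K by linarith
  fix h :: 'e show "norm (A b h) \<le> K' * norm h"
    using Taylor_constantD(2)[OF T, of h] mult_right_mono[OF K norm_ge_zero[of h]] by linarith
next
  have K1: "K \<ge> 1" using Taylor_constantD(1)[OF T] .
  fix x R Gs M assume R: "0 < R" and G: "\<forall>j. Adiff b (ball x R) (Gs j) (Gs (Suc j))"
    and M: "\<forall>y\<in>ball x R. norm (Gs 0 y) \<le> M"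
  have "norm (Gs 0 x) \<le> M" using M R by simp
  then have M0: "M \<ge> 0" by (rule order_trans[OF norm_ge_zero])
  {
    fix j
    have "norm (Gs j x) \<le> M * fact j * (K / R) ^ j"
      by (rule Taylor_constantD(3)[OF T R]) (use G M in simp_all)
    also have "\<dots> \<le> M * fact j * (K' / R) ^ j"
      using K1 K R M0 by (intro mult_left_mono power_mono divide_right_mono) auto
    finally show "norm (Gs j x) \<le> M * fact j * (K' / R) ^ j" .
  next
    fix n and h :: 'e assume h: "norm h < R / 2"
    have "norm (Gs 0 (x + h) - (\<Sum>j\<le>n. (1 / fact j) *\<^sub>R ((blinfun_apply (A b h)) ^^ j) (Gs j x)))
         \<le> M * (K * norm h / R) ^ Suc n"
      by (rule Taylor_constantD(4)[OF T R]) (use G M h in simp_all)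
    also have "\<dots> \<le> M * (K' * norm h / R) ^ Suc n"
      using K1 K R M0 by (intro mult_left_mono power_mono divide_right_mono mult_right_mono) auto
    finally show "norm (Gs 0 (x + h) - (\<Sum>j\<le>n. (1 / fact j) *\<^sub>R ((blinfun_apply (A b h)) ^^ j) (Gs j x)))
         \<le> M * (K' * norm h / R) ^ Suc n" .
  }
qed

lemma Taylor_constant_exists:
  assumes b: "b \<in> B0"
  shows "\<exists>K. Taylor_constant b K"
proof -
  interpret elliptic_symbol "A b" u0 using symbol[OF b] .
  obtain a where a: "a \<ge> 1" "\<And>h. norm (A b h) \<le> a * norm h" using norm_A_bound by blast
  obtain K where K: "K \<ge> 1" "\<And>x R Gs M. R > 0 \<Longrightarrow> \<forall>j. Adiff b (ball x R) (Gs j) (Gs (Suc j)) \<Longrightarrow>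
    \<forall>y \<in> ball x R. norm (Gs 0 y) \<le> M \<Longrightarrow>
    (\<forall>j. norm (Gs j x) \<le> M * fact j * (K / R) ^ j) \<and>
    (\<forall>j. \<forall>y \<in> ball x (R/2). norm (Gs j y) \<le> M * fact j * (K / R) ^ j) \<and>
    (\<forall>n h. norm h < R / 2 \<longrightarrow> norm (Gs 0 (x + h) - (\<Sum>j\<le>n. (1 / fact j) *\<^sub>R ((blinfun_apply (A b h)) ^^ j) (Gs j x)))
       \<le> M * (K * norm h / R) ^ Suc n)"
    by (rule A_Taylor) blast
  have "Taylor_constant b (max a K)"
    unfolding Taylor_constant_def
  proof (intro conjI allI impI)
    show "1 \<le> max a K" using a(1) by simp
    fix h :: 'e show "norm (A b h) \<le> max a K * norm h"
      using a(2)[of h] mult_right_mono[of a "max a K" "norm h"] by simp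
  next
    fix x R Gs M assume R: "0 < R" and G: "\<forall>j. Adiff b (ball x R) (Gs j) (Gs (Suc j))"
      and M: "\<forall>y\<in>ball x R. norm (Gs 0 y) \<le> M"
    have "norm (Gs 0 x) \<le> M" using M R by simp
    then have M0: "M \<ge> 0" by (rule order_trans[OF norm_ge_zero])
    note KK = K(2)[where Gs = Gs and M = M and x = x, OF R G M]
    {
      fix j
      have "norm (Gs j x) \<le> M * fact j * (K / R) ^ j" by (rule spec[OF conjunct1[OF KK]])
      also have "\<dots> \<le> M * fact j * (max a K / R) ^ j"
        using K(1) R M0 by (intro mult_left_mono power_mono divide_right_mono) auto
      finally show "norm (Gs j x) \<le> M * fact j * (max a K / R) ^ j" .
    next
      fix n and h :: 'e assume h: "norm h < R / 2"
      have "norm (Gs 0 (x + h) - (\<Sum>j\<le>n. (1 / fact j) *\<^sub>R ((blinfun_apply (A b h)) ^^ j) (Gs j x)))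
           \<le> M * (K * norm h / R) ^ Suc n"
        by (rule conjunct2[OF conjunct2[OF KK], rule_format, OF h])
      also have "\<dots> \<le> M * (max a K * norm h / R) ^ Suc n"
        using K(1) R M0 by (intro mult_left_mono power_mono divide_right_mono mult_right_mono) auto
      finally show "norm (Gs 0 (x + h) - (\<Sum>j\<le>n. (1 / fact j) *\<^sub>R ((blinfun_apply (A b h)) ^^ j) (Gs j x)))
           \<le> M * (max a K * norm h / R) ^ Suc n" .
    }
  qed
  then show ?thesis by (rule exI)
qed

lemma uniform_Taylor_constant:
  obtains K where "K \<ge> 1" and "\<And>b. b \<in> B0 \<Longrightarrow> Taylor_constant b K"
proof -
  obtain Kf where Kf: "\<And>b. b \<in> B0 \<Longrightarrow> Taylor_constant b (Kf b)"
    using Taylor_constant_exists by metis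
  define K where "K = 1 + (\<Sum>b\<in>B0. Kf b)"
  have Kf0: "0 \<le> Kf b" if "b \<in> B0" for b using Taylor_constantD(1)[OF Kf[OF that]] by linarith
  have K: "Kf b \<le> K" if "b \<in> B0" for b
    using member_le_sum[OF that, of Kf] Kf0 finite_B0 by (simp add: K_def)
  show thesis
  proof (rule that)
    show "K \<ge> 1" using Kf0 by (simp add: K_def sum_nonneg)
    show "Taylor_constant b K" if "b \<in> B0" for b using Taylor_constant_mono[OF Kf[OF that] K[OF that]] .
  qed
qed

text \<open>For a fixed position \<open>z\<close> of the other blocks the function of
  \<open>w\<close> is continuous, which makes the sets \<open>E m\<close> closed although joint
  continuity is unknown. The bound near each single \<open>w\<close> shows that they cover a ball,
  and Baire's theorem supplies one with interior points.\<close>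

lemma Baire_bound:
  assumes S: "finite S" "S \<subseteq> B0" "b \<in> B0" "b \<notin> S" and R: "R > 0"
    and H: "sep_A_differentiable A (insert b S) c R H"
    and IH: "\<And>w. dist (c b) w < R \<Longrightarrow> \<exists>\<delta>>0. \<exists>M. \<forall>y\<in>polydisc S (c(b := w)) \<delta>. norm (H y) \<le> M"
    and s: "0 < s" "s < R"
  obtains w1 \<tau> \<rho> M where "\<tau> > 0" "\<rho> > 0" "ball w1 \<tau> \<subseteq> cball (c b) s"
    "\<And>w y. w \<in> ball w1 \<tau> \<Longrightarrow> y \<in> polydisc S (c(b := w)) \<rho> \<Longrightarrow> norm (H y) \<le> M"
proof -
  \<comment> \<open>Tying the radius to the same index as the bound makes countably many sets
    suffice.\<close>
  define \<rho> where "\<rho> m = min R (1 / Suc m)" for m :: nat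
  define E where "E m = {w \<in> cball (c b) s. \<forall>z\<in>polydisc S c (\<rho> m). norm (H (z(b := w))) \<le> real m}" for m
  have BB: "insert b S \<subseteq> B0" using S by auto
  have zw: "z(b := w) \<in> polydisc S (c(b := w)) r" if "z \<in> polydisc S c r" for z w r
    using that S(4) by (auto simp: polydisc_def)
  have wz: "y(b := c b) \<in> polydisc S c r" if "y \<in> polydisc S (c(b := w)) r" for y w r
    using that S(4) by (auto simp: polydisc_def split: if_splits)
  interpret Ab: elliptic_symbol "A b" u0 using symbol[OF S(3)] .
  have cont: "continuous_on (cball (c b) s) (\<lambda>w. H (z(b := w)))" if "z \<in> polydisc S c (\<rho> m)" for z m
  proof -
    have \<rho>R: "\<rho> m \<le> R" by (simp add: \<rho>_def)
    have "dist (c a) (z a) < R" if "a \<in> insert b S" for a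
    proof (cases "a = b")
      case True
      then show ?thesis using \<open>z \<in> polydisc S c (\<rho> m)\<close> S(4) R by (simp add: polydisc_def)
    next
      case False
      then have "dist (c a) (z a) < \<rho> m" using \<open>z \<in> polydisc S c (\<rho> m)\<close> that by (simp add: polydisc_def)
      then show ?thesis using \<rho>R by linarith
    qed
    then have "z \<in> polydisc (insert b S) c R"
      using that unfolding polydisc_def by blast
    from Ab.A_derivative_on_continuous[OF sep_Adiff[OF BB H this]]
    show ?thesis by (rule continuous_on_subset) (use s in auto)
  qed
  have closed: "closed (E m)" for m
  proof -
    have eq: "E m = cball (c b) s \<inter> (\<Inter>z\<in>polydisc S c (\<rho> m). cball (c b) s \<inter> (\<lambda>w. norm (H (z(b := w)))) -` {..real m})"
      by (auto simp: E_def)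
    have cl: "closed (cball (c b) s \<inter> (\<lambda>w. norm (H (z(b := w)))) -` {..real m})" if "z \<in> polydisc S c (\<rho> m)" for z
      using cont[OF that] by (intro continuous_closed_preimage continuous_on_norm) auto
    show ?thesis unfolding eq by (intro closed_Int closed_cball closed_INT ballI cl)
  qed
  have "ball (c b) s \<subseteq> (\<Union>m. E m)"
  proof
    fix w assume w: "w \<in> ball (c b) s"
    then obtain \<delta> M where \<delta>: "\<delta> > 0" "\<And>y. y \<in> polydisc S (c(b := w)) \<delta> \<Longrightarrow> norm (H y) \<le> M"
      using IH[of w] s by auto
    obtain m1 :: nat where m1: "1 / Suc m1 < \<delta>" using \<delta>(1) nat_approx_posE by blast
    obtain m2 :: nat where m2: "M \<le> m2" using real_arch_simple by blast
    define m where "m = max m1 m2"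
    have "1 / Suc m \<le> 1 / Suc m1" by (simp add: m_def frac_le)
    then have "\<rho> m \<le> \<delta>" using m1 by (auto simp: \<rho>_def)
    then have sub: "polydisc S (c(b := w)) (\<rho> m) \<subseteq> polydisc S (c(b := w)) \<delta>" by (rule polydisc_mono)
    have "norm (H (z(b := w))) \<le> real m" if "z \<in> polydisc S c (\<rho> m)" for z
    proof -
      have "norm (H (z(b := w))) \<le> M" by (rule \<delta>(2)[OF subsetD[OF sub zw[OF that]]])
      also have "M \<le> real m" using m2 by (simp add: m_def)
      finally show ?thesis .
    qed
    moreover have "w \<in> cball (c b) s" using w by simp
    ultimately have "w \<in> E m" unfolding E_def by blast
    then show "w \<in> (\<Union>m. E m)" by (rule UN_I[OF UNIV_I])
  qed
  then obtain m where m: "interior (E m) \<noteq> {}" by (rule closed_cover_interior[OF closed s(1)])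
  then obtain w1 where "w1 \<in> interior (E m)" by blast
  then obtain \<tau> where \<tau>: "\<tau> > 0" "ball w1 \<tau> \<subseteq> E m" using mem_interior by blast
  show thesis
  proof (rule that[OF \<tau>(1), of "\<rho> m" w1 "real m"])
    show "\<rho> m > 0" using R by (simp add: \<rho>_def)
    show "ball w1 \<tau> \<subseteq> cball (c b) s" using \<tau>(2) by (auto simp: E_def)
    fix w y assume w: "w \<in> ball w1 \<tau>" and y: "y \<in> polydisc S (c(b := w)) (\<rho> m)"
    have "y b = w" using y S(4) by (auto simp: polydisc_def)
    then have eq: "(y(b := c b))(b := w) = y" by auto
    have "w \<in> E m" using w \<tau>(2) by blast
    then have "\<forall>z\<in>polydisc S c (\<rho> m). norm (H (z(b := w))) \<le> real m" unfolding E_def by blast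
    from bspec[OF this wz[OF y]] show "norm (H y) \<le> real m" unfolding eq .
  qed
qed

text \<open>The real coordinates of the blocks in \<open>S\<close>, indexed by
  \<open>S \<times> Basis\<close>, are fed into \<open>pointwise_rate_uniform\<close>; each costs a
  factor 2, whence the exponent. Taylor approximation along a real coordinate line comes from the
  expansion in the block that contains it.\<close>

lemma coefficients_uniform_rate:
  assumes S: "finite S" "S \<subseteq> B0" and r0: "r0 > 0" and pos: "\<beta> > 0" "M > 0" "M0 \<ge> 0"
    and u: "\<And>k. sep_A_differentiable A S c r0 (u k)"
    and bnd: "\<And>k z. z \<in> polydisc S c r0 \<Longrightarrow> norm (u k z) \<le> M0 * M ^ k"
    and pw: "\<And>z. z \<in> polydisc S c r0 \<Longrightarrow> \<exists>N. \<forall>k. norm (u k z) \<le> N * \<beta> ^ k"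
  shows "\<exists>r'>0. \<exists>N. \<forall>z\<in>polydisc S c r'. \<forall>k. norm (u k z) \<le> N * (2 ^ (card S * DIM('e)) * \<beta>) ^ k"
proof -
  obtain K where K: "K \<ge> 1" and T: "\<And>b. b \<in> B0 \<Longrightarrow> Taylor_constant b K"
    using uniform_Taylor_constant by blast
  define I where "I = S \<times> (Basis :: 'e set)"
  have I: "finite I" "card I = card S * DIM('e)" using S by (simp_all add: I_def card_cartesian_product)
  define point where "point \<xi> a = (if a \<in> S then c a + (\<Sum>v\<in>Basis. \<xi> (a, v) *\<^sub>R v) else c a)" for \<xi> :: "'b \<times> 'e \<Rightarrow> real" and a
  \<comment> \<open>The dimension allows for estimating a vector by its coordinates; the 16 leaves
    room for coordinate lines through points of the box to stay where the Taylor estimate on balls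
    of radius \<open>r0 / 2\<close> applies.\<close>
  define r1 where "r1 = r0 / (16 * DIM('e))"
  have D: "real DIM('e) \<ge> 1" using DIM_positive[where 'a='e] by linarith
  have r1: "r1 > 0" "real DIM('e) * r1 = r0 / 16" "r1 \<le> r0 / 16"
    using r0 D by (simp_all add: r1_def field_simps)
  have point: "point \<xi> \<in> polydisc S c (r0 / 8)" if "\<xi> \<in> coord_box I r1" for \<xi>
  proof -
    have "norm (\<Sum>v\<in>Basis. \<xi> (a, v) *\<^sub>R v) \<le> r0 / 16" if "a \<in> S" for a
    proof -
      have "norm (\<Sum>v\<in>Basis. \<xi> (a, v) *\<^sub>R v) \<le> (\<Sum>v\<in>(Basis :: 'e set). r1)"
        using \<open>\<xi> \<in> coord_box I r1\<close> that by (intro sum_norm_le) (auto simp: coord_box_def I_def)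
      then show ?thesis using r1(2) by simp
    qed
    then show ?thesis using r0 by (fastforce simp: polydisc_def point_def dist_norm)
  qed
  define F where "F k \<xi> = u k (point \<xi>)" for k \<xi>
  have line: "\<exists>y \<in> polydisc S c (r0 / 8). \<forall>t. point (\<xi>((a, v) := t)) = y(a := y a + t *\<^sub>R v)"
    if \<xi>: "\<xi> \<in> coord_box I r1" and av: "a \<in> S" "v \<in> Basis" for \<xi> a v
  proof (rule bexI[of _ "point (\<xi>((a, v) := 0))"], intro allI)
    let ?y = "point (\<xi>((a, v) := 0))"
    show "?y \<in> polydisc S c (r0 / 8)"
      using \<xi> r1 by (intro point) (auto simp: coord_box_def)
    fix t show "point (\<xi>((a, v) := t)) = ?y(a := ?y a + t *\<^sub>R v)"
    proof
      fix a'
      have "(\<Sum>w\<in>Basis. (\<xi>((a, v) := t)) (a, w) *\<^sub>R w)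
         = (\<Sum>w\<in>Basis. (\<xi>((a, v) := 0)) (a, w) *\<^sub>R w + (if w = v then t *\<^sub>R v else 0))"
        by (intro sum.cong) auto
      also have "\<dots> = (\<Sum>w\<in>Basis. (\<xi>((a, v) := 0)) (a, w) *\<^sub>R w) + t *\<^sub>R v"
        using av by (simp add: sum.distrib)
      finally show "point (\<xi>((a, v) := t)) a' = (?y(a := ?y a + t *\<^sub>R v)) a'"
        using av by (auto simp: point_def)
    qed
  qed
  have one: "continuous_on {-r1..r1} (\<lambda>t. F k (\<xi>(i := t))) \<and> Taylor_bounded (2 * K / r0) (M0 * M ^ k) r1 (\<lambda>t. F k (\<xi>(i := t)))"
    if \<xi>: "\<xi> \<in> coord_box I r1" and i: "i \<in> I" for \<xi> i k
  proof -
    obtain a v where iav: "i = (a, v)" "a \<in> S" "v \<in> Basis" using i by (auto simp: I_def)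
    obtain y where y: "y \<in> polydisc S c (r0 / 8)" "\<And>t. point (\<xi>(i := t)) = y(a := y a + t *\<^sub>R v)"
      using line[OF \<xi> iav(2,3)] unfolding iav(1) by blast
    have aB: "a \<in> B0" using iav S by auto
    interpret Aa: elliptic_symbol "A a" u0 using symbol[OF aB] .
    define Gs where "Gs j h = (part a ^^ j) (u k) (y(a := h))" for j h
    have yr: "y \<in> polydisc S c r0" using y(1) polydisc_mono[of "r0 / 8" r0 S c] r0 by auto
    have sub: "ball (y a) (r0 / 2) \<subseteq> ball (c a) r0"
      using ball_subset_polydisc[OF y(1) iav(2), of r0] r0 by (auto intro: order_trans[OF subset_ball, rotated])
    have G: "Adiff a (ball (y a) (r0 / 2)) (Gs j) (Gs (Suc j))" for j
      unfolding Gs_def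
      by (rule Aa.A_derivative_on_subset[OF Adiff_part_iterate[OF aB open_ball sep_Adiff[OF S(2) u yr iav(2)]] sub])
    have G0: "norm (Gs 0 h) \<le> M0 * M ^ k" if "h \<in> ball (y a) (r0 / 2)" for h
      using bnd[OF polydisc_upd[OF yr iav(2)], of h k] that sub by (auto simp: Gs_def)
    have Feq: "F k (\<xi>(i := t)) = Gs 0 (y a + t *\<^sub>R v)" for t
      by (simp add: F_def y(2) Gs_def)
    have inb: "norm (t *\<^sub>R v) < r0 / 4" if "\<bar>t\<bar> \<le> r1" for t
      using that r1(3) r0 iav(3) by simp
    have rem: "norm (Gs 0 (y a + h) - (\<Sum>j\<le>n. (1 / fact j) *\<^sub>R ((blinfun_apply (A a h)) ^^ j) (Gs j (y a))))
         \<le> M0 * M ^ k * (K * norm h / (r0 / 2)) ^ Suc n" if "norm h < r0 / 4" for n h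
      using that r0 by (intro Taylor_constantD(4)[where Gs = Gs, OF T[OF aB] _ G G0]) auto
    have "Taylor_bounded (2 * K / r0) (M0 * M ^ k) r1 (\<lambda>t. F k (\<xi>(i := t)))"
      unfolding Taylor_bounded_def
    proof (rule allI, rule exI[of _ "\<lambda>j. (1 / fact j) *\<^sub>R ((blinfun_apply (A a v)) ^^ j) (Gs j (y a))"], intro allI impI)
      fix n and t :: real assume t: "\<bar>t\<bar> \<le> r1"
      have e: "K * norm (t *\<^sub>R v) / (r0 / 2) = 2 * K / r0 * \<bar>t\<bar>" using iav(3) by simp
      show "norm (F k (\<xi>(i := t)) - (\<Sum>j\<le>n. t ^ j *\<^sub>R ((1 / fact j) *\<^sub>R ((blinfun_apply (A a v)) ^^ j) (Gs j (y a)))))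
          \<le> M0 * M ^ k * (2 * K / r0 * \<bar>t\<bar>) ^ Suc n"
        using rem[OF inb[OF t], of n] unfolding Feq Aa.A_power_scaleR e scaleR_scaleR
        by (simp only: mult.commute)
    qed
    moreover have "continuous_on {-r1..r1} (\<lambda>t. F k (\<xi>(i := t)))"
      unfolding Feq
    proof (rule continuous_on_compose2[where g = "Gs 0", OF Aa.A_derivative_on_continuous[OF G]])
      show "continuous_on {-r1..r1} (\<lambda>t. y a + t *\<^sub>R v)" by (intro continuous_intros)
      show "(\<lambda>t. y a + t *\<^sub>R v) ` {-r1..r1} \<subseteq> ball (y a) (r0 / 2)"
      proof
        fix h assume "h \<in> (\<lambda>t. y a + t *\<^sub>R v) ` {-r1..r1}"
        then obtain t where t: "h = y a + t *\<^sub>R v" "t \<in> {-r1..r1}" by (elim imageE)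
        then have "\<bar>t\<bar> \<le> r1" by auto
        then show "h \<in> ball (y a) (r0 / 2)" using inb[of t] r0 t(1) by (simp add: dist_norm)
      qed
    qed
    ultimately show ?thesis by blast
  qed
  have "\<exists>r'>0. \<exists>N. \<forall>\<xi>\<in>coord_box I r'. \<forall>k. norm (F k \<xi>) \<le> N * (2 ^ card I * \<beta>) ^ k"
  proof (rule pointwise_rate_uniform[where F = F and C = "2 * K / r0", OF I(1) r1(1) pos(1) _ pos(2,3)])
    show "2 * K / r0 > 0" using K r0 by simp
    show "continuous_on {-r1..r1} (\<lambda>t. F k (\<xi>(i := t)))" if "\<xi> \<in> coord_box I r1" "i \<in> I" for \<xi> i k
      using one[OF that] by blast
    show "Taylor_bounded (2 * K / r0) (M0 * M ^ k) r1 (\<lambda>t. F k (\<xi>(i := t)))" if "\<xi> \<in> coord_box I r1" "i \<in> I" for \<xi> i k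
      using one[OF that] by blast
    fix \<xi> assume "\<xi> \<in> coord_box I r1"
    then have "point \<xi> \<in> polydisc S c r0" using point polydisc_mono[of "r0 / 8" r0 S c] r0 by auto
    then show "\<exists>N. \<forall>k. norm (F k \<xi>) \<le> N * \<beta> ^ k" unfolding F_def by (rule pw)
  qed
  then obtain r' N where r': "r' > 0" "\<And>\<xi> k. \<xi> \<in> coord_box I r' \<Longrightarrow> norm (F k \<xi>) \<le> N * (2 ^ card I * \<beta>) ^ k" by blast
  have "norm (u k z) \<le> N * (2 ^ (card S * DIM('e)) * \<beta>) ^ k" if z: "z \<in> polydisc S c r'" for z k
  proof -
    define \<xi> where "\<xi> = (\<lambda>(a, v). if (a, v) \<in> I then (z a - c a) \<bullet> v else 0)"
    have "\<bar>(z a - c a) \<bullet> v\<bar> \<le> r'" if "(a, v) \<in> I" for a v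
    proof -
      have "\<bar>(z a - c a) \<bullet> v\<bar> \<le> norm (z a - c a)" using that by (intro Basis_le_norm) (auto simp: I_def)
      also have "\<dots> < r'" using z that by (auto simp: polydisc_def I_def dist_norm norm_minus_commute)
      finally show ?thesis by simp
    qed
    then have "\<xi> \<in> coord_box I r'" by (auto simp: coord_box_def \<xi>_def)
    moreover have "point \<xi> = z"
    proof
      fix a show "point \<xi> a = z a"
        using z euclidean_representation[of "z a - c a"] by (auto simp: point_def \<xi>_def I_def polydisc_def)
    qed
    ultimately show ?thesis using r'(2)[of \<xi> k] by (simp add: F_def I(2))
  qed
  then show ?thesis using r'(1) by blast
qed

end

lemma (in elliptic_symbol) A_power_scaleR_right:
  "((blinfun_apply (A h)) ^^ j) (c *\<^sub>R v) = c *\<^sub>R ((blinfun_apply (A h)) ^^ j) v"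
  by (induction j) (simp_all add: blinfun.scaleR_right)

section \<open>Local boundedness of separately differentiable functions\<close>

context elliptic_family
begin

text \<open>Block \<open>b\<close> is expanded about a point \<open>w1\<close> near which Baire's
  theorem gives a bound. That bound yields a rate \<open>K / r0\<close> for the coefficients
  \<open>u k\<close>, uniform in the other blocks but possibly far too large. For each fixed
  \<open>z\<close>, however, the slice is bounded on a ball of radius \<open>R / 4\<close>, so the
  pointwise rate is \<open>4 K / R\<close>. Made uniform, it is \<open>Q\<close> times as large, and
  the series still converges near the original centre.\<close>

lemma locally_bounded_insert:
  assumes S: "finite S" "S \<subseteq> B0" "b \<in> B0" "b \<notin> S" and R: "R > 0"
    and H: "sep_A_differentiable A (insert b S) c R H"
    and IH: "\<And>w. dist (c b) w < R \<Longrightarrow> \<exists>\<delta>>0. \<exists>M. \<forall>y\<in>polydisc S (c(b := w)) \<delta>. norm (H y) \<le> M"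
  shows "\<exists>\<delta>>0. \<exists>M. \<forall>y\<in>polydisc (insert b S) c \<delta>. norm (H y) \<le> M"
proof -
  let ?B = "insert b S"
  have BB: "?B \<subseteq> B0" and bB: "b \<in> ?B" using S by auto
  interpret Ab: elliptic_symbol "A b" u0 using symbol[OF S(3)] .
  obtain K where K: "K \<ge> 1" and T: "\<And>b. b \<in> B0 \<Longrightarrow> Taylor_constant b K"
    using uniform_Taylor_constant by blast
  note Tb = T[OF S(3)]
  define Q :: real where "Q = 2 ^ (card S * DIM('e))"
  have Q: "Q \<ge> 1" by (simp add: Q_def)
  \<comment> \<open>For \<open>norm h < 2 s\<close> this gives
    \<open>K * norm h * Q * (4 K / R) \<le> 1/2\<close>. Since \<open>Q\<close> depends only on the
    number of blocks and the dimension, \<open>s\<close> can be fixed before \<open>w1\<close> is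
    known.\<close>
  define s where "s = R / (16 * Q * K\<^sup>2)"
  have QK: "Q * K\<^sup>2 \<ge> 1" using Q K by (simp add: mult_ge1_I)
  have QK1: "Q * K\<^sup>2 \<ge> K"
  proof -
    have "1 * K \<le> (Q * K) * K" using Q K by (intro mult_right_mono) (auto simp: mult_ge1_I)
    then show ?thesis by (simp add: power2_eq_square mult_ac)
  qed
  have s: "s > 0" "16 * (Q * K\<^sup>2) * s = R" using R QK Q K by (auto simp: s_def)
  have s16: "16 * s \<le> R" "16 * (K * s) \<le> R"
  proof -
    have eq: "(Q * K\<^sup>2) * (16 * s) = R" unfolding s(2)[symmetric] by (simp only: mult_ac)
    have "1 * (16 * s) \<le> (Q * K\<^sup>2) * (16 * s)" using s(1) by (intro mult_right_mono QK) auto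
    then show "16 * s \<le> R" unfolding eq by simp
    have "K * (16 * s) \<le> (Q * K\<^sup>2) * (16 * s)" using s(1) by (intro mult_right_mono QK1) auto
    then show "16 * (K * s) \<le> R" unfolding eq by simp
  qed
  have sR: "s < R" using s16 s by linarith
  obtain w1 \<tau> \<rho> M where \<tau>: "\<tau> > 0" "\<rho> > 0" "ball w1 \<tau> \<subseteq> cball (c b) s"
    and M: "\<And>w y. w \<in> ball w1 \<tau> \<Longrightarrow> y \<in> polydisc S (c(b := w)) \<rho> \<Longrightarrow> norm (H y) \<le> M"
  proof (rule Baire_bound[OF S R H IH s(1) sR])
    fix w1 \<tau> \<rho> M assume *: "\<tau> > 0" "\<rho> > 0" "ball w1 \<tau> \<subseteq> cball (c b) s"
      "\<And>w y. w \<in> ball w1 \<tau> \<Longrightarrow> y \<in> polydisc S (c(b := w)) \<rho> \<Longrightarrow> norm (H y) \<le> M"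
    show thesis by (rule that[OF *])
  qed
  have "w1 \<in> ball w1 \<tau>" using \<tau>(1) by simp
  then have w1s: "dist (c b) w1 \<le> s" using subsetD[OF \<tau>(3)] by simp
  define c1 where "c1 = c(b := w1)"
  \<comment> \<open>Within \<open>\<tau>\<close> in block \<open>b\<close> and within
    \<open>\<rho>\<close> in the others, so the bound \<open>M\<close> holds on the whole polydisc
    around \<open>c1\<close>.\<close>
  define r0 where "r0 = min (min \<rho> \<tau>) (R / 2)"
  have r0: "r0 > 0" "r0 \<le> \<rho>" "r0 \<le> \<tau>" "r0 \<le> R / 2" using \<tau> R by (auto simp: r0_def)
  have P1: "polydisc ?B c1 r0 \<subseteq> polydisc ?B c R"
  proof
    fix y assume y: "y \<in> polydisc ?B c1 r0"
    have "dist (c a) (y a) < R" if "a \<in> ?B" for a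
    proof (cases "a = b")
      case True
      have "y b \<in> ball w1 \<tau>" using y r0 by (auto simp: polydisc_def c1_def)
      then have "dist (c b) (y b) \<le> s" using subsetD[OF \<tau>(3)] by simp
      then show ?thesis using True sR by simp
    next
      case False
      then have "dist (c a) (y a) < r0" using y that by (auto simp: polydisc_def c1_def)
      then show ?thesis using r0 R by linarith
    qed
    moreover have "y a = c a" if "a \<notin> ?B" for a using y that by (auto simp: polydisc_def c1_def)
    ultimately show "y \<in> polydisc ?B c R" by (simp add: polydisc_def)
  qed
  have P2: "polydisc S c1 r \<subseteq> polydisc ?B c1 r" if "r > 0" for r
    using that S(4) by (auto simp: polydisc_def)
  have HM: "norm (H y) \<le> M" if y: "y \<in> polydisc ?B c1 r0" for y
  proof (rule M)
    show "y b \<in> ball w1 \<tau>" using y r0 by (auto simp: polydisc_def c1_def)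
    have "dist (c a) (y a) < \<rho>" if "a \<in> S" for a
    proof -
      have "a \<noteq> b" using that S(4) by auto
      then have "dist (c a) (y a) < r0" using y that by (auto simp: polydisc_def c1_def)
      then show ?thesis using r0 by linarith
    qed
    then show "y \<in> polydisc S (c(b := y b)) \<rho>" using y S(4) by (auto simp: polydisc_def c1_def)
  qed
  have M0: "M \<ge> 0"
  proof -
    have "c1 \<in> polydisc ?B c1 r0" using r0 by (simp add: polydisc_def)
    then show ?thesis using HM norm_ge_zero order_trans by blast
  qed
  have sep1: "sep_A_differentiable A ?B c1 r0 H"
    by (rule sep_A_differentiable_mono[OF H P1 order_refl])
  have bi1: "bounded_inside ?B c1 r0 H"
    unfolding bounded_inside_def
  proof (intro allI impI exI ballI)
    fix r y assume "r < r0" "y \<in> polydisc ?B c1 r"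
    then show "norm (H y) \<le> M" using polydisc_mono[of r r0 ?B c1] by (intro HM) auto
  qed
  define u where "u k z = (1 / fact k) *\<^sub>R (part b ^^ k) H z" for k z
  have usep: "sep_A_differentiable A S c1 r0 (u k)" for k
  proof -
    have "sep_A_differentiable A S c1 r0 ((part b ^^ k) H)"
      by (rule sep_A_differentiable_mono[OF conjunct1[OF part_iterate_sep[OF BB sep1 bi1 bB]] P2[OF r0(1)]]) auto
    show ?thesis
      unfolding sep_A_differentiable_def
    proof (intro ballI)
      fix y a assume "y \<in> polydisc S c1 r0" "a \<in> S"
      then obtain v where "((\<lambda>h. (part b ^^ k) H (y(a := h))) has_derivative (\<lambda>h. A a h v)) (at (y a))"
        using \<open>sep_A_differentiable A S c1 r0 ((part b ^^ k) H)\<close> unfolding sep_A_differentiable_def by blast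
      from has_derivative_scaleR_right[OF this, of "1 / fact k"]
      have "((\<lambda>h. u k (y(a := h))) has_derivative (\<lambda>h. A a h ((1 / fact k) *\<^sub>R v))) (at (y a))"
        unfolding u_def blinfun.scaleR_right .
      then show "\<exists>v. ((\<lambda>h. u k (y(a := h))) has_derivative (\<lambda>h. A a h v)) (at (y a))" by (rule exI)
    qed
  qed
  have seq: "Adiff b (ball (c b) R) (\<lambda>h. (part b ^^ j) H (z(b := h))) (\<lambda>h. (part b ^^ Suc j) H (z(b := h)))"
    if "z \<in> polydisc S c1 r0" for z j
  proof -
    have "z \<in> polydisc ?B c R" using that P1 P2[OF r0(1)] by blast
    then show ?thesis by (rule Adiff_part_iterate[OF S(3) open_ball sep_Adiff[OF BB H _ bB]])
  qed
  have zb: "z(b := w1) = z" if "z \<in> polydisc S c1 r" for z r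
    using that S(4) by (auto simp: polydisc_def c1_def)
  have ubnd: "norm (u k z) \<le> M * (K / r0) ^ k" if z: "z \<in> polydisc S c1 r0" for k z
  proof -
    have sub: "ball w1 r0 \<subseteq> ball (c b) R"
    proof
      fix w assume "w \<in> ball w1 r0"
      then have "w \<in> ball w1 \<tau>" using r0(3) by simp
      then have "w \<in> cball (c b) s" using \<tau>(3) by blast
      then show "w \<in> ball (c b) R" using sR by simp
    qed
    have zB: "z \<in> polydisc ?B c1 r0" using z P2[OF r0(1)] by blast
    have "norm ((part b ^^ k) H (z(b := w1))) \<le> M * fact k * (K / r0) ^ k"
    proof (rule Taylor_constantD(3)[where Gs = "\<lambda>j h. (part b ^^ j) H (z(b := h))", OF Tb r0(1)])
      show "Adiff b (ball w1 r0) (\<lambda>h. (part b ^^ j) H (z(b := h))) (\<lambda>h. (part b ^^ Suc j) H (z(b := h)))" for j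
        by (rule Ab.A_derivative_on_subset[OF seq[OF z] sub])
      show "norm ((part b ^^ 0) H (z(b := h))) \<le> M" if "h \<in> ball w1 r0" for h
        using HM[OF polydisc_upd[OF zB bB]] that by (simp add: c1_def)
    qed
    then show ?thesis unfolding zb[OF z] u_def by (simp add: field_simps)
  qed
  have sub4: "cball w1 (R / 4) \<subseteq> ball (c b) R"
  proof
    fix w assume "w \<in> cball w1 (R / 4)"
    then show "w \<in> ball (c b) R" using w1s s16 R dist_triangle[of "c b" w w1] by simp
  qed
  \<comment> \<open>The constant \<open>N\<close> comes from compactness of the closed ball of
    radius \<open>R / 4\<close> in the slice through \<open>z\<close>, and its dependence on
    \<open>z\<close> is uncontrolled.\<close>
  have pt: "\<exists>N. (\<forall>k. norm (u k z) \<le> N * (4 * K / R) ^ k) \<and>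
     (\<forall>n h. norm h < R / 8 \<longrightarrow> norm (H (z(b := w1 + h)) - (\<Sum>j\<le>n. ((blinfun_apply (A b h)) ^^ j) (u j z)))
        \<le> N * (K * norm h / (R / 4)) ^ Suc n)" if z: "z \<in> polydisc S c1 r0" for z
  proof -
    let ?Gs = "\<lambda>j h. (part b ^^ j) H (z(b := h))"
    have "continuous_on (cball w1 (R / 4)) (?Gs 0)"
      using continuous_on_subset[OF Ab.A_derivative_on_continuous[OF seq[OF z]] sub4] .
    then have "bounded (?Gs 0 ` cball w1 (R / 4))"
      by (intro compact_imp_bounded compact_continuous_image compact_cball)
    then obtain N where N: "\<And>h. h \<in> cball w1 (R / 4) \<Longrightarrow> norm (?Gs 0 h) \<le> N"
      unfolding bounded_iff by blast
    have R4: "R / 4 > 0" using R by simp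
    have sub: "ball w1 (R / 4) \<subseteq> ball (c b) R" using sub4 ball_subset_cball by blast
    note D = Ab.A_derivative_on_subset[OF seq[OF z] sub]
    have N': "norm (?Gs 0 h) \<le> N" if "h \<in> ball w1 (R / 4)" for h using N that by auto
    have "norm (u k z) \<le> N * (4 * K / R) ^ k" for k
    proof -
      have "norm (?Gs k w1) \<le> N * fact k * (K / (R / 4)) ^ k"
        by (rule Taylor_constantD(3)[where Gs = ?Gs, OF Tb R4 D N'])
      then show ?thesis unfolding zb[OF z] u_def by (simp add: field_simps)
    qed
    moreover have "norm (H (z(b := w1 + h)) - (\<Sum>j\<le>n. ((blinfun_apply (A b h)) ^^ j) (u j z)))
        \<le> N * (K * norm h / (R / 4)) ^ Suc n" if h: "norm h < R / 8" for n h
    proof -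
      have "norm (?Gs 0 (w1 + h) - (\<Sum>j\<le>n. (1 / fact j) *\<^sub>R ((blinfun_apply (A b h)) ^^ j) (?Gs j w1)))
         \<le> N * (K * norm h / (R / 4)) ^ Suc n"
        by (rule Taylor_constantD(4)[where Gs = ?Gs, OF Tb R4 D N']) (use h in simp_all)
      moreover have "(1 / fact j) *\<^sub>R ((blinfun_apply (A b h)) ^^ j) v = ((blinfun_apply (A b h)) ^^ j) ((1 / fact j) *\<^sub>R v)" for j v
        by (rule Ab.A_power_scaleR_right[symmetric])
      ultimately show ?thesis unfolding zb[OF z] u_def by simp
    qed
    ultimately show ?thesis by blast
  qed
  have "\<exists>r'>0. \<exists>N. \<forall>z\<in>polydisc S c1 r'. \<forall>k. norm (u k z) \<le> N * (2 ^ (card S * DIM('e)) * (4 * K / R)) ^ k"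
  proof (rule coefficients_uniform_rate[OF S(1,2) r0(1)])
    show "4 * K / R > 0" "K / r0 > 0" using K R r0 by auto
    show "M \<ge> 0" by (rule M0)
    show "\<exists>N. \<forall>k. norm (u k z) \<le> N * (4 * K / R) ^ k" if "z \<in> polydisc S c1 r0" for z
      using pt[OF that] by blast
    show "sep_A_differentiable A S c1 r0 (u k)" for k by (rule usep)
    show "norm (u k z) \<le> M * (K / r0) ^ k" if "z \<in> polydisc S c1 r0" for k z by (rule ubnd[OF that])
  qed
  then obtain r' N where r': "r' > 0" and N: "\<And>z k. z \<in> polydisc S c1 r' \<Longrightarrow> norm (u k z) \<le> N * (Q * (4 * K / R)) ^ k"
    unfolding Q_def by blast
  define \<delta> where "\<delta> = min (min r' r0) s"
  have \<delta>: "\<delta> > 0" "\<delta> \<le> r'" "\<delta> \<le> r0" "\<delta> \<le> s" using r' r0 s by (auto simp: \<delta>_def)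
  have "norm (H y) \<le> 2 * N" if y: "y \<in> polydisc ?B c \<delta>" for y
  proof -
    define z where "z = y(b := w1)"
    define h where "h = y b - w1"
    have z: "z \<in> polydisc S c1 \<delta>" using y S(4) by (auto simp: polydisc_def c1_def z_def)
    have z': "z \<in> polydisc S c1 r'" "z \<in> polydisc S c1 r0" using z polydisc_mono \<delta>(2,3) by blast+
    have yz: "z(b := w1 + h) = y" by (auto simp: z_def h_def)
    have "dist (c b) (y b) < s" using y \<delta>(4) by (auto simp: polydisc_def)
    then have hs: "norm h < 2 * s"
      using w1s dist_triangle[of "y b" w1 "c b"] by (simp add: h_def dist_norm[symmetric] dist_commute)
    have h8: "norm h < R / 8" using hs s16 by linarith
    have Kh: "K * norm h \<le> 2 * (K * s)" using mult_left_mono[of "norm h" "2 * s" K] hs K by simp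
    obtain Nz where Nz: "\<And>n. norm (H y - (\<Sum>j\<le>n. ((blinfun_apply (A b h)) ^^ j) (u j z))) \<le> Nz * (K * norm h / (R / 4)) ^ Suc n"
    proof -
      obtain Nz where "\<forall>n h. norm h < R / 8 \<longrightarrow> norm (H (z(b := w1 + h)) - (\<Sum>j\<le>n. ((blinfun_apply (A b h)) ^^ j) (u j z)))
        \<le> Nz * (K * norm h / (R / 4)) ^ Suc n" using pt[OF z'(2)] by (elim exE conjE)
      from this[rule_format, OF h8] show thesis unfolding yz by (rule that)
    qed
    have "norm (u 0 z) \<le> N" using N[OF z'(1), of 0] by simp
    then have N0: "N \<ge> 0" by (rule order_trans[OF norm_ge_zero])
    have q1: "K * norm h / (R / 4) \<le> 1 / 2"
      using Kh s16(2) R by (simp add: divide_le_eq)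
    have q2: "(K * norm h) * (Q * (4 * K / R)) \<le> 1 / 2"
    proof -
      have "(K * norm h) * (Q * (4 * K / R)) \<le> (2 * (K * s)) * (Q * (4 * K / R))"
        using Kh Q K R by (intro mult_right_mono) auto
      also have "\<dots> = (16 * (Q * K\<^sup>2) * s) / (2 * R)" by (simp add: power2_eq_square mult_ac)
      also have "\<dots> = 1 / 2" unfolding s(2) using R by simp
      finally show ?thesis .
    qed
    have q2': "0 \<le> (K * norm h) * (Q * (4 * K / R))" using Q K R by simp
    have bnd: "norm (((blinfun_apply (A b h)) ^^ j) (u j z)) \<le> N * (1 / 2) ^ j" for j
    proof -
      have "norm (((blinfun_apply (A b h)) ^^ j) (u j z)) \<le> norm (A b h) ^ j * norm (u j z)"
        by (rule Ab.norm_A_power)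
      also have "\<dots> \<le> (K * norm h) ^ j * (N * (Q * (4 * K / R)) ^ j)"
        using Taylor_constantD(2)[OF Tb] N[OF z'(1)] K by (intro mult_mono power_mono) auto
      also have "\<dots> = N * ((K * norm h) * (Q * (4 * K / R))) ^ j" by (simp only: power_mult_distrib mult_ac)
      also have "\<dots> \<le> N * (1 / 2) ^ j" using q2 q2' N0 by (intro mult_left_mono power_mono)
      finally show ?thesis .
    qed
    \<comment> \<open>The uncontrolled \<open>Nz\<close> occurs only in a term that tends to 0 with
      \<open>n\<close>, so the limit leaves a bound by \<open>N\<close> alone, uniform in
      \<open>y\<close>.\<close>
    have "norm (H y) \<le> 2 * N + \<bar>Nz\<bar> * (1 / 2) ^ Suc n" for n
    proof -
      have "norm (\<Sum>j\<le>n. ((blinfun_apply (A b h)) ^^ j) (u j z)) \<le> (\<Sum>j\<le>n. N * (1 / 2) ^ j)"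
        by (intro sum_norm_le bnd)
      also have "\<dots> = N * (\<Sum>j\<le>n. (1 / 2) ^ j)" by (simp add: sum_distrib_left)
      also have "(\<Sum>j\<le>n. (1 / 2 :: real) ^ j) \<le> 2"
        using sum_gp_basic[of "1/2 :: real" n] by simp
      finally have 1: "norm (\<Sum>j\<le>n. ((blinfun_apply (A b h)) ^^ j) (u j z)) \<le> N * 2" using N0 by (simp add: mult_left_mono)
      have "Nz * (K * norm h / (R / 4)) ^ Suc n \<le> \<bar>Nz\<bar> * (1 / 2) ^ Suc n"
        using q1 K R by (intro mult_mono power_mono) auto
      then show ?thesis
        using Nz[of n] 1 norm_triangle_sub[of "H y" "\<Sum>j\<le>n. ((blinfun_apply (A b h)) ^^ j) (u j z)"] by linarith
    qed
    moreover have "(\<lambda>n. 2 * N + \<bar>Nz\<bar> * (1 / 2) ^ Suc n) \<longlonglongrightarrow> 2 * N + \<bar>Nz\<bar> * 0"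
      by (intro tendsto_intros LIMSEQ_Suc LIMSEQ_power_zero) simp
    ultimately have "norm (H y) \<le> 2 * N + \<bar>Nz\<bar> * 0"
      by (intro LIMSEQ_le_const[of "\<lambda>n. 2 * N + \<bar>Nz\<bar> * (1 / 2) ^ Suc n"]) auto
    then show "norm (H y) \<le> 2 * N" by simp
  qed
  then show ?thesis using \<delta>(1) by blast
qed

text \<open>The induction hypothesis is applied to every slice with block \<open>b\<close> frozen at
  some \<open>w\<close>; with no blocks left, a polydisc is a single point.\<close>

theorem sep_A_differentiable_locally_bounded:
  assumes "S \<subseteq> B0" "R > 0" "sep_A_differentiable A S c R H"
  shows "\<exists>\<delta>>0. \<exists>M. \<forall>y\<in>polydisc S c \<delta>. norm (H y) \<le> M"
proof -
  have "finite S" using assms(1) finite_B0 finite_subset by blast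
  then show ?thesis using assms
  proof (induction S arbitrary: c R rule: finite_induct)
    case empty
    have "polydisc {} c 1 = {c}" by (auto simp: polydisc_def)
    then show ?case by (intro exI[of _ "1::real"]) auto
  next
    case (insert b S)
    have Sb: "S \<subseteq> B0" "b \<in> B0" using insert.prems(1) by auto
    show ?case
    proof (rule locally_bounded_insert[OF insert.hyps(1) Sb insert.hyps(2) insert.prems(2,3)])
      fix w assume w: "dist (c b) w < R"
      have "polydisc S (c(b := w)) R \<subseteq> polydisc (insert b S) c R"
        using w insert.hyps(2) by (auto simp: polydisc_def split: if_splits)
      then have "sep_A_differentiable A S (c(b := w)) R H"
        by (rule sep_A_differentiable_mono[OF insert.prems(3) _ subset_insertI])
      then show "\<exists>\<delta>>0. \<exists>M. \<forall>y\<in>polydisc S (c(b := w)) \<delta>. norm (H y) \<le> M"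
        by (rule insert.IH[OF Sb(1) insert.prems(2)])
    qed
  qed
qed

section \<open>From local boundedness to joint differentiability by telescoping\<close>

lemma one_variable_expansion:
  assumes B: "B \<subseteq> B0" and R: "R > 0" and H: "sep_A_differentiable A B c R H"
    and M: "\<And>y. y \<in> polydisc B c R \<Longrightarrow> norm (H y) \<le> M" and K: "\<And>b. b \<in> B0 \<Longrightarrow> Taylor_constant b K"
    and y: "y \<in> polydisc B c (R / 2)" and b: "b \<in> B" and h: "norm h < R / 4"
  shows "norm (H (y(b := y b + h)) - H y) \<le> M * (2 * K * norm h / R)"
    "norm (H (y(b := y b + h)) - H y - A b h (part b H y)) \<le> M * (2 * K * norm h / R)\<^sup>2"
proof -
  have bB: "b \<in> B0" using b B by auto
  interpret Ab: elliptic_symbol "A b" u0 using symbol[OF bB] .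
  have yR: "y \<in> polydisc B c R" using y polydisc_mono[of "R / 2" R B c] R by auto
  have sub: "ball (y b) (R / 2) \<subseteq> ball (c b) R" using ball_subset_polydisc[OF y b, of R] by simp
  let ?Gs = "\<lambda>j h. (part b ^^ j) H (y(b := h))"
  have D: "Adiff b (ball (y b) (R / 2)) (?Gs j) (?Gs (Suc j))" for j
    by (rule Ab.A_derivative_on_subset[OF Adiff_part_iterate[OF bB open_ball sep_Adiff[OF B H yR b]] sub])
  have N: "norm (?Gs 0 h) \<le> M" if "h \<in> ball (y b) (R / 2)" for h
    using M[OF polydisc_upd[OF yR b, of h]] sub that by auto
  have T: "norm (?Gs 0 (y b + h) - (\<Sum>j\<le>n. (1 / fact j) *\<^sub>R ((blinfun_apply (A b h)) ^^ j) (?Gs j (y b))))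
      \<le> M * (K * norm h / (R / 2)) ^ Suc n" for n
    by (rule Taylor_constantD(4)[where Gs = ?Gs, OF K[OF bB] _ D N]) (use R h in simp_all)
  show "norm (H (y(b := y b + h)) - H y) \<le> M * (2 * K * norm h / R)"
    using T[of 0] by (simp add: mult_ac)
  have "K * norm h / (R / 2) = 2 * K * norm h / R" by simp
  then show "norm (H (y(b := y b + h)) - H y - A b h (part b H y)) \<le> M * (2 * K * norm h / R)\<^sup>2"
    using T[of 1] by (simp add: power2_eq_square diff_diff_eq del: fun_upd_apply)
qed

text \<open>The stations of a path from \<open>c\<close> to \<open>y\<close> that moves one block at
  a time: the blocks in \<open>S\<close> have already moved.\<close>

definition partial_move :: "'b set \<Rightarrow> ('b \<Rightarrow> 'e) \<Rightarrow> ('b \<Rightarrow> 'e) \<Rightarrow> 'b \<Rightarrow> 'e" where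
  "partial_move S c y b = (if b \<in> S then y b else c b)"

lemma partial_move_insert:
  "b \<notin> S \<Longrightarrow> partial_move (insert b S) c y = (partial_move S c y)(b := partial_move S c y b + (y b - c b))"
  by (auto simp: partial_move_def)

lemma partial_move_polydisc:
  "y \<in> polydisc B c r \<Longrightarrow> r > 0 \<Longrightarrow> partial_move S c y \<in> polydisc B c r"
  by (auto simp: partial_move_def polydisc_def)

text \<open>The increments along the stations add up, each bounded by the Taylor estimate of order
  0. It is meant for the first derivatives \<open>part b H\<close>.\<close>

lemma sep_A_Lipschitz:
  assumes B: "B \<subseteq> B0" and R: "R > 0" and H: "sep_A_differentiable A B c R H"
    and M: "\<And>y. y \<in> polydisc B c R \<Longrightarrow> norm (H y) \<le> M" and K: "\<And>b. b \<in> B0 \<Longrightarrow> Taylor_constant b K"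
    and y: "y \<in> polydisc B c (R / 4)" and S: "finite S" "S \<subseteq> B"
  shows "norm (H (partial_move S c y) - H c) \<le> M * (2 * K / R) * (\<Sum>b\<in>S. norm (y b - c b))"
  using S
proof (induction S rule: finite_induct)
  case empty
  have "partial_move {} c y = c" by (auto simp: partial_move_def)
  then show ?case by simp
next
  case (insert b S)
  let ?p = "partial_move S c y"
  have b: "b \<in> B" using insert.prems by simp
  have p: "?p \<in> polydisc B c (R / 2)"
    using partial_move_polydisc[OF y, of S] R polydisc_mono[of "R / 4" "R / 2" B c] by auto
  have h: "norm (y b - c b) < R / 4" using y b by (auto simp: polydisc_def dist_norm norm_minus_commute)
  have "norm (H (partial_move (insert b S) c y) - H ?p) \<le> M * (2 * K * norm (y b - c b) / R)"
    unfolding partial_move_insert[OF insert.hyps(2)]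
    by (rule one_variable_expansion(1)[OF B R H M K p b h])
  moreover have "norm (H ?p - H c) \<le> M * (2 * K / R) * (\<Sum>b\<in>S. norm (y b - c b))"
    using insert.IH insert.prems by simp
  ultimately have "norm (H (partial_move (insert b S) c y) - H c)
      \<le> M * (2 * K * norm (y b - c b) / R) + M * (2 * K / R) * (\<Sum>b\<in>S. norm (y b - c b))"
    using norm_triangle_le[of "H (partial_move (insert b S) c y) - H ?p" "H ?p - H c"] by simp
  also have "\<dots> = M * (2 * K / R) * (\<Sum>b\<in>insert b S. norm (y b - c b))"
    using insert.hyps by (simp add: algebra_simps)
  finally show ?case .
qed

text \<open>Moving block by block, each increment is linear up to a quadratic error, but with the
  derivative taken at the current station. Since \<open>part b H\<close> is again separately
  differentiable and bounded, it satisfies a Lipschitz estimate at \<open>c\<close>, so replacing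
  its value at the station by that at \<open>c\<close> costs only another quadratic error.\<close>

theorem sep_A_differentiable_expansion:
  assumes B: "B \<subseteq> B0" and R0: "R > 0" and H0: "sep_A_differentiable A B c R H"
  shows "\<exists>\<delta>>0. \<exists>C v. \<forall>y\<in>polydisc B c \<delta>.
    norm (H y - H c - (\<Sum>b\<in>B. A b (y b - c b) (v b))) \<le> C * (\<Sum>b\<in>B. norm (y b - c b))\<^sup>2"
proof -
  have finB: "finite B" using B finite_B0 finite_subset by blast
  obtain \<delta>0 M where \<delta>0: "\<delta>0 > 0" "\<And>y. y \<in> polydisc B c \<delta>0 \<Longrightarrow> norm (H y) \<le> M"
    using sep_A_differentiable_locally_bounded[OF B R0 H0] by blast
  define r where "r = min \<delta>0 R"
  have r: "r > 0" using \<delta>0 R0 by (simp add: r_def)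
  have H: "sep_A_differentiable A B c r H"
    by (rule sep_A_differentiable_mono[OF H0 polydisc_mono order_refl]) (simp add: r_def)
  have M: "norm (H y) \<le> M" if "y \<in> polydisc B c r" for y
    using that polydisc_mono[of r \<delta>0 B c] by (intro \<delta>0(2)) (auto simp: r_def)
  have cP: "c \<in> polydisc B c r'" if "r' > 0" for r' using that by (simp add: polydisc_def)
  have M0: "M \<ge> 0" using order_trans[OF norm_ge_zero M[OF cP[OF r]]] .
  have bi: "bounded_inside B c r H"
    unfolding bounded_inside_def
  proof (intro allI impI exI ballI)
    fix r1 y assume "r1 < r" "y \<in> polydisc B c r1"
    then show "norm (H y) \<le> M" using polydisc_mono[of r1 r B c] by (intro M) auto
  qed
  obtain K where K: "K \<ge> 1" "\<And>b. b \<in> B0 \<Longrightarrow> Taylor_constant b K" using uniform_Taylor_constant by blast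
  have "\<exists>N. \<forall>y\<in>polydisc B c (r / 2). norm (part b H y) \<le> N" if "b \<in> B" for b
    using part_sep_A_differentiable(2)[OF B H bi that] r unfolding bounded_inside_def by simp
  then obtain N where N: "\<And>b y. b \<in> B \<Longrightarrow> y \<in> polydisc B c (r / 2) \<Longrightarrow> norm (part b H y) \<le> N b" by metis
  \<comment> \<open>The first summand is the Taylor error of one step, the second the cost of moving
    the derivative to \<open>c\<close>; it contains \<open>r / 2\<close> because \<open>N b\<close>
    bounds \<open>part b H\<close> on the polydisc of that radius.\<close>
  define C where "C b = M * (2 * K / r)\<^sup>2 + K * (N b * (2 * K / (r / 2)))" for b
  have r2: "r / 2 > 0" using r by simp
  have N0: "N b \<ge> 0" if "b \<in> B" for b using order_trans[OF norm_ge_zero N[OF that cP[OF r2]]] .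
  have main: "norm (H (partial_move S c y) - H c - (\<Sum>b\<in>S. A b (y b - c b) (part b H c)))
      \<le> (\<Sum>b\<in>S. C b) * (\<Sum>b\<in>B. norm (y b - c b))\<^sup>2"
    if y: "y \<in> polydisc B c (r / 8)" and S: "finite S" "S \<subseteq> B" for y S
    using S
  proof (induction S rule: finite_induct)
    case empty
    have "partial_move {} c y = c" by (auto simp: partial_move_def)
    then show ?case by simp
  next
    case (insert b S)
    let ?p = "partial_move S c y" and ?\<sigma> = "\<Sum>b\<in>B. norm (y b - c b)" and ?d = "y b - c b"
    have b: "b \<in> B" and SB: "S \<subseteq> B" using insert.prems by auto
    have bB: "b \<in> B0" using b B by auto
    have p8: "?p \<in> polydisc B c (r / 8)" using partial_move_polydisc[OF y] r by simp
    have p: "?p \<in> polydisc B c (r / 2)" using p8 polydisc_mono[of "r / 8" "r / 2" B c] r by auto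
    have d8: "norm ?d < r / 8" using y b by (auto simp: polydisc_def dist_norm norm_minus_commute)
    then have d: "norm ?d < r / 4" using r by simp
    have d\<sigma>: "norm ?d \<le> ?\<sigma>" using member_le_sum[OF b, of "\<lambda>b. norm (y b - c b)"] finB by simp
    have \<sigma>0: "?\<sigma> \<ge> 0" by (simp add: sum_nonneg)
    have 1: "norm (H (partial_move (insert b S) c y) - H ?p - A b ?d (part b H ?p)) \<le> M * (2 * K / r)\<^sup>2 * ?\<sigma>\<^sup>2"
    proof -
      have "norm (H (partial_move (insert b S) c y) - H ?p - A b ?d (part b H ?p)) \<le> M * (2 * K * norm ?d / r)\<^sup>2"
        unfolding partial_move_insert[OF insert.hyps(2)]
        by (rule one_variable_expansion(2)[OF B r H M K(2) p b d])
      also have "\<dots> \<le> M * (2 * K * ?\<sigma> / r)\<^sup>2"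
        using d\<sigma> K M0 r by (intro mult_left_mono power_mono divide_right_mono) auto
      also have "\<dots> = M * (2 * K / r)\<^sup>2 * ?\<sigma>\<^sup>2" by (simp add: power_mult_distrib power_divide)
      finally show ?thesis .
    qed
    have 2: "norm (A b ?d (part b H ?p) - A b ?d (part b H c)) \<le> K * (N b * (2 * K / (r / 2))) * ?\<sigma>\<^sup>2"
    proof -
      have "norm (part b H ?p - part b H c) \<le> N b * (2 * K / (r / 2)) * (\<Sum>b\<in>S. norm (y b - c b))"
      proof (rule sep_A_Lipschitz[OF B r2 _ N[OF b] K(2) _ insert.hyps(1) SB])
        show "sep_A_differentiable A B c (r / 2) (part b H)"
          by (rule sep_A_differentiable_mono[OF part_sep_A_differentiable(1)[OF B H bi b] polydisc_mono order_refl]) (use r in simp)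
        show "y \<in> polydisc B c (r / 2 / 4)" using y by simp
      qed
      also have "\<dots> \<le> N b * (2 * K / (r / 2)) * ?\<sigma>"
        using N0[OF b] K r finB SB by (intro mult_left_mono sum_mono2) auto
      finally have *: "norm (part b H ?p - part b H c) \<le> N b * (2 * K / (r / 2)) * ?\<sigma>" .
      have "norm (A b ?d (part b H ?p) - A b ?d (part b H c)) \<le> norm (A b ?d) * norm (part b H ?p - part b H c)"
        unfolding blinfun.diff_right[symmetric] by (rule norm_blinfun)
      also have "\<dots> \<le> (K * ?\<sigma>) * (N b * (2 * K / (r / 2)) * ?\<sigma>)"
      proof (intro mult_mono *)
        show "norm (A b ?d) \<le> K * ?\<sigma>"
          using Taylor_constantD(2)[OF K(2)[OF bB], of ?d] mult_left_mono[OF d\<sigma>, of K] K(1) by linarith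
      qed (use K(1) \<sigma>0 in auto)
      finally show ?thesis by (simp add: power2_eq_square mult_ac)
    qed
    have 3: "norm (H ?p - H c - (\<Sum>b\<in>S. A b (y b - c b) (part b H c))) \<le> (\<Sum>b\<in>S. C b) * ?\<sigma>\<^sup>2"
      using insert.IH[OF SB] .
    let ?X = "H (partial_move (insert b S) c y) - H ?p - A b ?d (part b H ?p)"
    let ?Y = "A b ?d (part b H ?p) - A b ?d (part b H c)"
    let ?Z = "H ?p - H c - (\<Sum>b\<in>S. A b (y b - c b) (part b H c))"
    have eq: "H (partial_move (insert b S) c y) - H c - (\<Sum>b\<in>insert b S. A b (y b - c b) (part b H c)) = ?X + ?Y + ?Z"
      using insert.hyps by simp
    have "norm (?X + ?Y + ?Z) \<le> norm ?X + norm ?Y + norm ?Z"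
      by (rule order_trans[OF norm_triangle_ineq add_right_mono[OF norm_triangle_ineq]])
    also have "\<dots> \<le> M * (2 * K / r)\<^sup>2 * ?\<sigma>\<^sup>2 + K * (N b * (2 * K / (r / 2))) * ?\<sigma>\<^sup>2 + (\<Sum>b\<in>S. C b) * ?\<sigma>\<^sup>2"
      by (intro add_mono 1 2 3)
    also have "\<dots> = (\<Sum>b\<in>insert b S. C b) * ?\<sigma>\<^sup>2"
      unfolding sum.insert[OF insert.hyps] C_def distrib_right ..
    finally show ?case unfolding eq .
  qed
  have full: "partial_move B c y = y" if "y \<in> polydisc B c (r / 8)" for y
    using that by (auto simp: partial_move_def polydisc_def)
  show ?thesis
  proof (intro exI conjI ballI)
    show "r / 8 > 0" using r by simp
    fix y assume y: "y \<in> polydisc B c (r / 8)"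
    from main[OF y finB order_refl]
    show "norm (H y - H c - (\<Sum>b\<in>B. A b (y b - c b) (part b H c))) \<le> (\<Sum>b\<in>B. C b) * (\<Sum>b\<in>B. norm (y b - c b))\<^sup>2"
      unfolding full[OF y] .
  qed
qed

end

section \<open>Superalgebras\<close>

text \<open>Left multiplication is bounded because the dimension is finite; norm and product are
  otherwise unrelated.\<close>

definition mult_blinfun :: "'a::{real_algebra_1, euclidean_space} \<Rightarrow> 'a \<Rightarrow>\<^sub>L 'a" where
  "mult_blinfun x = Blinfun ((*) x)"

lemma mult_blinfun_apply [simp]: "blinfun_apply (mult_blinfun x) y = x * y"
proof -
  have "linear ((*) x)" by (intro linearI) (simp_all add: distrib_left)
  then show ?thesis
    unfolding mult_blinfun_def by (simp add: linear_conv_bounded_linear bounded_linear_Blinfun_apply)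
qed

text \<open>\<open>U\<close> will enumerate an orthonormal basis of the algebra, which serves as
  parameter space of every block; only the first \<open>n\<close> coordinates count. This padding
  admits blocks of different sizes in one elliptic family.\<close>

definition block_element :: "(nat \<Rightarrow> 'a::euclidean_space) \<Rightarrow> (nat \<Rightarrow> 'b::real_vector) \<Rightarrow> nat \<Rightarrow> 'a \<Rightarrow> 'b" where
  "block_element U \<alpha> n h = (\<Sum>i<n. (h \<bullet> U i) *\<^sub>R \<alpha> i)"

lemma linear_block_element: "linear (block_element U \<alpha> n)"
  unfolding block_element_def
  by (intro linearI) (simp_all add: inner_add_left scaleR_add_left sum.distrib scaleR_sum_right)

lemma basis_enum_inner:
  assumes "bij_betw U {..<DIM('a)} (Basis :: 'a::euclidean_space set)" "i < DIM('a)" "j < DIM('a)"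
  shows "U i \<bullet> U j = (if i = j then 1 else 0)"
proof -
  have "U i \<in> Basis" "U j \<in> Basis" using assms by (auto simp: bij_betw_def)
  moreover have "U i = U j \<longleftrightarrow> i = j" using assms by (auto simp: bij_betw_def inj_on_def)
  ultimately show ?thesis by (simp add: inner_Basis)
qed

lemma block_element_basis:
  assumes U: "bij_betw U {..<DIM('a)} (Basis :: 'a::euclidean_space set)" and n: "n \<le> DIM('a)" and j: "j < DIM('a)"
  shows "block_element U \<alpha> n (U j) = (if j < n then \<alpha> j else 0)"
proof -
  have "block_element U \<alpha> n (U j) = (\<Sum>i<n. if i = j then \<alpha> j else 0)"
    unfolding block_element_def
    by (intro sum.cong) (use n j in \<open>auto simp: basis_enum_inner[OF U]\<close>)
  then show ?thesis by simp
qed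

text \<open>The direction \<open>U i\<close> acts as multiplication by \<open>\<alpha> i\<close> for
  \<open>i < n\<close>, and as 0 in the padding. The sum of the squared operators over the basis is
  thus multiplication by the sum of the squares of the \<open>\<alpha> i\<close>; this is where the
  sums of squares in the two conditions become ellipticity.\<close>

lemma elliptic_symbol_block:
  fixes \<alpha> :: "nat \<Rightarrow> 'a::{real_algebra_1, euclidean_space}"
  assumes U: "bij_betw U {..<DIM('a)} (Basis :: 'a set)" and n: "0 < n" "n \<le> DIM('a)" and one: "\<alpha> 0 = 1"
    and comm: "\<And>i j. i < n \<Longrightarrow> j < n \<Longrightarrow> \<alpha> i * \<alpha> j = \<alpha> j * \<alpha> i" and sq: "(\<Sum>i<n. (\<alpha> i)\<^sup>2) = 0"
  shows "elliptic_symbol (\<lambda>h. mult_blinfun (block_element U \<alpha> n h)) (U 0)"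
proof (rule elliptic_symbol.intro)
  let ?L = "block_element U \<alpha> n"
  note lin = linear_block_element[of U \<alpha> n]
  show "linear (\<lambda>h. mult_blinfun (?L h))"
    by (intro linearI blinfun_eqI)
      (simp_all add: linear_add[OF lin] linear_scale[OF lin] blinfun.add_left blinfun.scaleR_left distrib_right)
  have LL: "?L h * ?L k = ?L k * ?L h" for h k
  proof -
    have "?L h * ?L k = (\<Sum>i<n. \<Sum>j<n. ((h \<bullet> U i) * (k \<bullet> U j)) *\<^sub>R (\<alpha> i * \<alpha> j))"
      unfolding block_element_def sum_product by (intro sum.cong refl) (simp add: mult.commute)
    also have "\<dots> = (\<Sum>i<n. \<Sum>j<n. ((h \<bullet> U i) * (k \<bullet> U j)) *\<^sub>R (\<alpha> j * \<alpha> i))"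
      using comm by (intro sum.cong) auto
    also have "\<dots> = (\<Sum>j<n. \<Sum>i<n. ((h \<bullet> U i) * (k \<bullet> U j)) *\<^sub>R (\<alpha> j * \<alpha> i))" by (rule sum.swap)
    also have "\<dots> = ?L k * ?L h"
      unfolding block_element_def sum_product by (intro sum.cong refl) (simp add: mult.commute)
    finally show ?thesis .
  qed
  show "mult_blinfun (?L h) o\<^sub>L mult_blinfun (?L k) = mult_blinfun (?L k) o\<^sub>L mult_blinfun (?L h)" for h k
    by (intro blinfun_eqI) (simp add: mult.assoc[symmetric] LL)
  have D: "0 < DIM('a)" using n by simp
  show "U 0 \<in> Basis" using U D by (auto simp: bij_betw_def)
  show "mult_blinfun (?L (U 0)) = id_blinfun"
    using block_element_basis[OF U n(2) D, of \<alpha>] n one by (intro blinfun_eqI) simp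
  show "(\<Sum>u\<in>Basis. mult_blinfun (?L u) o\<^sub>L mult_blinfun (?L u)) = 0"
  proof (intro blinfun_eqI)
    fix x :: 'a
    have "(\<Sum>u\<in>Basis. ?L u * ?L u) = (\<Sum>j<DIM('a). ?L (U j) * ?L (U j))"
      using sum.reindex_bij_betw[OF U, of "\<lambda>u. ?L u * ?L u"] by simp
    also have "\<dots> = (\<Sum>j<DIM('a). if j < n then (\<alpha> j)\<^sup>2 else 0)"
      by (intro sum.cong) (auto simp: block_element_basis[OF U n(2)] power2_eq_square)
    also have "\<dots> = (\<Sum>j\<in>{..<DIM('a)} \<inter> {j. j < n}. (\<alpha> j)\<^sup>2)" by (simp add: sum.inter_restrict)
    also have "{..<DIM('a)} \<inter> {j. j < n} = {..<n}" using n by auto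
    finally have "(\<Sum>u\<in>Basis. ?L u * ?L u) = 0" using sq by simp
    then have "(\<Sum>u\<in>Basis. ?L u * ?L u) * x = 0" by simp
    then show "blinfun_apply (\<Sum>u\<in>Basis. mult_blinfun (?L u) o\<^sub>L mult_blinfun (?L u)) x = blinfun_apply 0 x"
      by (simp add: blinfun.sum_left sum_distrib_right mult.assoc)
  qed
qed

text \<open>The slices are not open in the ambient vector type. Since \<open>S\<close> contains a
  short segment in the given direction, the derivative within \<open>S\<close> still determines the
  partial derivative.\<close>

lemma real_partial_eq_derivative:
  fixes g :: "'a::real_normed_vector ^ 'k::finite \<Rightarrow> 'b::real_normed_vector"
  assumes g: "(g has_derivative g') (at u within S)" and \<eta>: "\<eta> > 0" "\<And>t. \<bar>t\<bar> < \<eta> \<Longrightarrow> u + t *\<^sub>R axis v x \<in> S"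
  shows "real_partial g u v x = g' (axis v x)"
proof -
  let ?N = "ball 0 \<eta> :: real set"
  have 1: "((\<lambda>t. u + t *\<^sub>R axis v x) has_derivative (\<lambda>t. t *\<^sub>R axis v x)) (at 0 within ?N)"
    by (auto intro!: derivative_eq_intros)
  have "(g has_derivative g') (at (u + 0 *\<^sub>R axis v x) within (\<lambda>t. u + t *\<^sub>R axis v x) ` ?N)"
    using has_derivative_subset[OF g, of "(\<lambda>t. u + t *\<^sub>R axis v x) ` ?N"] \<eta>(2) by (auto simp: image_subset_iff)
  from has_derivative_in_compose[OF 1 this]
  have "((\<lambda>t. g (u + t *\<^sub>R axis v x)) has_derivative (\<lambda>t. g' (t *\<^sub>R axis v x))) (at 0)"
    using \<eta>(1) by (simp add: at_within_open[OF _ open_ball])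
  then have "((\<lambda>t. g (u + t *\<^sub>R axis v x)) has_vector_derivative g' (axis v x)) (at 0)"
    using linear_scale[OF has_derivative_linear[OF g]] by (simp add: has_vector_derivative_def)
  then show ?thesis unfolding real_partial_def by (rule vector_derivative_at)
qed

section \<open>Bases, blocks and coordinates of a superalgebra\<close>

locale superalgebra_bases =
  fixes L0 L1 :: "'a::{real_algebra_1, euclidean_space} set"
    and p q r :: nat and e \<epsilon> a :: "nat \<Rightarrow> 'a" and s :: "nat \<Rightarrow> nat"
  assumes csa: "comm_superalgebra L0 L1" and A0: "condition_A0 L0 p e" and A1: "condition_A1 L0 L1 q \<epsilon> r s a"
begin

lemma e_basis: "inj_on e {0..p}" "independent (e ` {0..p})" "span (e ` {0..p}) = L0"
  using A0 by (auto simp: condition_A0_def indexed_basis_def)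

lemma \<epsilon>_basis: "inj_on \<epsilon> {1..q}" "independent (\<epsilon> ` {1..q})" "span (\<epsilon> ` {1..q}) = L1"
  using A1 by (auto simp: condition_A1_def indexed_basis_def)

lemma s_less: "1 \<le> k \<Longrightarrow> k < k' \<Longrightarrow> k' \<le> r + 1 \<Longrightarrow> s k < s k'"
  using A1 unfolding condition_A1_def strict_mono_on_def by auto

lemma s_le: "1 \<le> k \<Longrightarrow> k \<le> k' \<Longrightarrow> k' \<le> r + 1 \<Longrightarrow> s k \<le> s k'"
  using s_less[of k k'] by (cases "k = k'") auto

lemma s_ends: "s 1 = 1" "s (r + 1) = q + 1"
  using A1 by (auto simp: condition_A1_def)

lemma block_range: "k \<in> {1..r} \<Longrightarrow> t \<in> {s k..<s (k + 1)} \<Longrightarrow> t \<in> {1..q}"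
  using s_le[of 1 k] s_le[of "k + 1" "r + 1"] s_ends by auto

lemma odd_block_card:
  assumes k: "k \<in> {1..r}"
  shows "s (k + 1) - s k \<le> DIM('a)"
proof -
  have sub: "{s k..<s (k + 1)} \<subseteq> {1..q}" using block_range[OF k] by blast
  have "card (\<epsilon> ` {s k..<s (k + 1)}) \<le> card (\<epsilon> ` {1..q})"
    by (intro card_mono finite_imageI image_mono sub finite_atLeastAtMost)
  also have "\<dots> \<le> DIM('a)" using independent_bound[OF \<epsilon>_basis(2)] by simp
  finally show ?thesis unfolding card_image[OF inj_on_subset[OF \<epsilon>_basis(1) sub]] by simp
qed

lemma block_unique:
  assumes "k \<in> {1..r}" "k' \<in> {1..r}" "t \<in> {s k..<s (k + 1)}" "t \<in> {s k'..<s (k' + 1)}"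
  shows "k = k'"
proof (rule ccontr)
  assume "k \<noteq> k'"
  then consider "k + 1 \<le> k'" | "k' + 1 \<le> k" by linarith
  then show False
    by cases (use assms s_le[of "k + 1" k'] s_le[of "k' + 1" k] in auto)
qed

lemma block_exists:
  assumes t: "t \<in> {1..q}"
  obtains k where "k \<in> {1..r}" "t \<in> {s k..<s (k + 1)}"
proof -
  define P where "P k \<longleftrightarrow> 1 \<le> k \<and> k \<le> r + 1 \<and> t < s k" for k
  have "P (r + 1)" using t s_ends by (auto simp: P_def)
  \<comment> \<open>The first \<open>s k'\<close> beyond \<open>t\<close> is the end of the block
    that contains \<open>t\<close>, so the block has index \<open>k' - 1\<close>.\<close>
  define k' where "k' = (LEAST k. P k)"
  have P: "P k'" unfolding k'_def by (rule LeastI) fact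
  have "k' \<noteq> 1" using P t s_ends by (auto simp: P_def)
  then have k: "1 \<le> k' - 1" "k' - 1 < k'" using P by (auto simp: P_def)
  then have "\<not> P (k' - 1)" unfolding k'_def using not_less_Least by metis
  then have "s (k' - 1) \<le> t" using k P by (auto simp: P_def)
  then show thesis using that[of "k' - 1"] k P by (auto simp: P_def)
qed

text \<open>An even variable is a single block, with dummy index 0; an odd variable has one block
  for each of the \<open>r\<close> groups of basis vectors, and none if
  \<open>r = 0\<close>.\<close>

definition blocks :: "'k::finite set \<Rightarrow> ('k \<times> nat) set" where
  "blocks E = E \<times> {0} \<union> (- E) \<times> {1..r}"

definition block_size :: "'k set \<Rightarrow> 'k \<times> nat \<Rightarrow> nat" where
  "block_size E b = (if fst b \<in> E then p + 1 else s (snd b + 1) - s (snd b))"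

definition block_vector :: "'k set \<Rightarrow> 'k \<times> nat \<Rightarrow> nat \<Rightarrow> 'a" where
  "block_vector E b i = (if fst b \<in> E then e i else \<epsilon> (s (snd b) + i))"

text \<open>In an even block the coefficients are the basis vectors themselves. In an odd block the
  directions are the odd elements \<open>\<epsilon>\<close>, whereas the operators are
  multiplications by the even elements \<open>a\<close>, which commute.\<close>

definition block_coeff :: "'k set \<Rightarrow> 'k \<times> nat \<Rightarrow> nat \<Rightarrow> 'a" where
  "block_coeff E b i = (if fst b \<in> E then e i else a (s (snd b) + i))"

lemma finite_blocks: "finite (blocks (E :: 'k::finite set))"
  by (simp add: blocks_def)

lemma e_in: "i \<le> p \<Longrightarrow> e i \<in> L0"
  using span_base[of "e i" "e ` {0..p}"] e_basis(3) by auto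

lemma even_commute: "x \<in> L0 \<Longrightarrow> y \<in> L0 \<Longrightarrow> x * y = y * x"
  using csa by (auto simp: comm_superalgebra_def)

lemma block_facts:
  assumes b: "b \<in> blocks (E :: 'k::finite set)"
  shows "0 < block_size E b" "block_size E b \<le> DIM('a)" "block_coeff E b 0 = 1"
    "i < block_size E b \<Longrightarrow> j < block_size E b \<Longrightarrow> block_coeff E b i * block_coeff E b j = block_coeff E b j * block_coeff E b i"
    "(\<Sum>i<block_size E b. (block_coeff E b i)\<^sup>2) = 0"
    "block_vector E b i \<in> (if fst b \<in> E then L0 else L1) \<or> i \<ge> block_size E b"
proof -
  obtain v k where vk: "b = (v, k)" by (cases b)
  have "0 < block_size E b \<and> block_size E b \<le> DIM('a) \<and> block_coeff E b 0 = 1 \<and>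
    (\<forall>i j. i < block_size E b \<longrightarrow> j < block_size E b \<longrightarrow> block_coeff E b i * block_coeff E b j = block_coeff E b j * block_coeff E b i) \<and>
    (\<Sum>i<block_size E b. (block_coeff E b i)\<^sup>2) = 0 \<and>
    (\<forall>i. block_vector E b i \<in> (if fst b \<in> E then L0 else L1) \<or> i \<ge> block_size E b)"
  proof (cases "v \<in> E")
    case True
    have "card (e ` {0..p}) \<le> DIM('a)" using independent_bound[OF e_basis(2)] by simp
    then have "p + 1 \<le> DIM('a)" using card_image[OF e_basis(1)] by simp
    moreover have "e 0 = 1" using A0 by (simp add: condition_A0_def)
    moreover have "(\<Sum>i<p + 1. (e i)\<^sup>2) = 0"
      using A0 by (simp add: condition_A0_def atLeast0AtMost lessThan_Suc_atMost)
    ultimately show ?thesis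
      using True even_commute e_in by (auto simp: vk block_size_def block_coeff_def block_vector_def)
  next
    case False
    then have k: "k \<in> {1..r}" using b by (auto simp: vk blocks_def)
    have sk: "s k < s (k + 1)" using k by (intro s_less) auto
    have rng: "s k + i \<in> {s k..<s (k + 1)}" if "i < s (k + 1) - s k" for i using that by auto
    note c = odd_block_card[OF k]
    have "a (s k) = 1" using A1 k by (auto simp: condition_A1_def)
    moreover have "(\<Sum>i<s (k + 1) - s k. (a (s k + i))\<^sup>2) = 0"
    proof -
      have "(\<Sum>i<s (k + 1) - s k. (a (s k + i))\<^sup>2) = (\<Sum>j\<in>{s k..<s (k + 1)}. (a j)\<^sup>2)"
        by (rule sum.reindex_bij_witness[of _ "\<lambda>j. j - s k" "\<lambda>i. s k + i"]) auto
      then show ?thesis using A1 k by (simp add: condition_A1_def)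
    qed
    moreover have "a (s k + i) \<in> L0" if "i < s (k + 1) - s k" for i
      using A1 block_range[OF k rng[OF that]] by (auto simp: condition_A1_def)
    moreover have "\<epsilon> (s k + i) \<in> L1" if "i < s (k + 1) - s k" for i
      using span_base[of "\<epsilon> (s k + i)" "\<epsilon> ` {1..q}"] \<epsilon>_basis(3) block_range[OF k rng[OF that]] by blast
    ultimately show ?thesis
      using False c sk even_commute by (auto simp: vk block_size_def block_coeff_def block_vector_def not_le)
  qed
  then show "0 < block_size E b" "block_size E b \<le> DIM('a)" "block_coeff E b 0 = 1"
    "i < block_size E b \<Longrightarrow> j < block_size E b \<Longrightarrow> block_coeff E b i * block_coeff E b j = block_coeff E b j * block_coeff E b i"
    "(\<Sum>i<block_size E b. (block_coeff E b i)\<^sup>2) = 0"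
    "block_vector E b i \<in> (if fst b \<in> E then L0 else L1) \<or> i \<ge> block_size E b"
    by blast+
qed

text \<open>\<open>\<Phi>\<close> is a linear extension of \<open>e j \<mapsto> U j\<close>; its
  values outside \<open>L0\<close> are arbitrary.\<close>

lemma even_coordinates:
  fixes U :: "nat \<Rightarrow> 'a"
  assumes U: "bij_betw U {..<DIM('a)} Basis"
  obtains \<Phi> :: "'a \<Rightarrow> 'a" where "linear \<Phi>" "\<And>x. x \<in> L0 \<Longrightarrow> block_element U e (p + 1) (\<Phi> x) = x"
proof -
  have "card (e ` {0..p}) \<le> DIM('a)" using independent_bound[OF e_basis(2)] by simp
  then have pD: "p + 1 \<le> DIM('a)" using card_image[OF e_basis(1)] by simp
  obtain \<Phi> :: "'a \<Rightarrow> 'a" where \<Phi>: "linear \<Phi>" "\<forall>x\<in>e ` {0..p}. \<Phi> x = U (the_inv_into {0..p} e x)"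
    using linear_independent_extend[OF e_basis(2), where f = "\<lambda>x. U (the_inv_into {0..p} e x)"] by (elim exE conjE)
  have \<Phi>e: "\<Phi> (e j) = U j" if "j \<le> p" for j
    using \<Phi>(2) that the_inv_into_f_f[OF e_basis(1), of j] by simp
  have lin: "linear (\<lambda>x. block_element U e (p + 1) (\<Phi> x))"
    using linear_compose[OF \<Phi>(1) linear_block_element] by (simp add: o_def)
  have "block_element U e (p + 1) (\<Phi> x) = x" if "x \<in> L0" for x
  proof (rule linear_eq_on_span[OF lin linear_id[unfolded id_def]])
    show "x \<in> span (e ` {0..p})" using that e_basis(3) by simp
    fix z assume "z \<in> e ` {0..p}"
    then obtain j where j: "j \<le> p" "z = e j" by auto
    then show "block_element U e (p + 1) (\<Phi> z) = z"
      using \<Phi>e block_element_basis[OF U pD, of j e] pD by simp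
  qed
  then show thesis using that[of \<Phi>] \<Phi>(1) by simp
qed

text \<open>\<open>\<Phi> k\<close> sends the basis vectors of group \<open>k\<close> to the
  corresponding \<open>U i\<close> and those of the other groups to 0, so the sum over the groups
  reassembles an odd element.\<close>

lemma odd_coordinates:
  fixes U :: "nat \<Rightarrow> 'a"
  assumes U: "bij_betw U {..<DIM('a)} Basis"
  obtains \<Phi> :: "nat \<Rightarrow> 'a \<Rightarrow> 'a" where "\<And>k. linear (\<Phi> k)"
    "\<And>x. x \<in> L1 \<Longrightarrow> (\<Sum>k=1..r. block_element U (\<lambda>i. \<epsilon> (s k + i)) (s (k + 1) - s k) (\<Phi> k x)) = x"
proof -
  define index where "index = the_inv_into {1..q} \<epsilon>"
  have index: "index (\<epsilon> t) = t" if "t \<in> {1..q}" for t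
    using the_inv_into_f_f[OF \<epsilon>_basis(1) that] by (simp add: index_def)
  define F where "F k x = (if index x \<in> {s k..<s (k + 1)} then U (index x - s k) else 0)" for k x
  define \<Phi> :: "nat \<Rightarrow> 'a \<Rightarrow> 'a"
    where "\<Phi> k = (SOME \<phi>. linear \<phi> \<and> (\<forall>x\<in>\<epsilon> ` {1..q}. \<phi> x = F k x))" for k
  have "linear (\<Phi> k) \<and> (\<forall>x\<in>\<epsilon> ` {1..q}. \<Phi> k x = F k x)" for k
    unfolding \<Phi>_def by (rule someI_ex[OF linear_independent_extend[OF \<epsilon>_basis(2), where f = "F k"]])
  then have \<Phi>: "\<And>k. linear (\<Phi> k)" "\<And>k t. t \<in> {1..q} \<Longrightarrow> \<Phi> k (\<epsilon> t) = F k (\<epsilon> t)"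
    by simp_all
  let ?X = "\<lambda>k. block_element U (\<lambda>i. \<epsilon> (s k + i)) (s (k + 1) - s k)"
  have lin: "linear (\<lambda>x. \<Sum>k=1..r. ?X k (\<Phi> k x))"
  proof (intro linear_compose_sum ballI)
    show "linear (\<lambda>x. ?X k (\<Phi> k x))" for k
      using linear_compose[OF \<Phi>(1)[of k] linear_block_element] by (simp add: o_def)
  qed
  have "(\<Sum>k=1..r. ?X k (\<Phi> k x)) = x" if "x \<in> L1" for x
  proof (rule linear_eq_on_span[OF lin linear_id[unfolded id_def]])
    show "x \<in> span (\<epsilon> ` {1..q})" using that \<epsilon>_basis(3) by simp
    fix z assume "z \<in> \<epsilon> ` {1..q}"
    then obtain t where t: "t \<in> {1..q}" "z = \<epsilon> t" by auto
    obtain k where k: "k \<in> {1..r}" "t \<in> {s k..<s (k + 1)}" using block_exists[OF t(1)] by blast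
    have "?X k' (\<Phi> k' z) = (if k' = k then z else 0)" if k': "k' \<in> {1..r}" for k'
    proof (cases "k' = k")
      case True
      note c = odd_block_card[OF k(1)]
      have "\<Phi> k z = U (t - s k)" using \<Phi>(2)[OF t(1)] index[OF t(1)] k(2) t(2) by (simp add: F_def)
      moreover have "t - s k < s (k + 1) - s k" using k(2) by auto
      ultimately show ?thesis
        using True block_element_basis[OF U c, of "t - s k" "\<lambda>i. \<epsilon> (s k + i)"] c k(2) t(2) by simp
    next
      case False
      then have "t \<notin> {s k'..<s (k' + 1)}" using block_unique[OF k(1) k' k(2)] by blast
      then have "F k' (\<epsilon> t) = 0" unfolding F_def index[OF t(1)] by (rule if_not_P)
      then have "\<Phi> k' z = 0" unfolding t(2) \<Phi>(2)[OF t(1)] .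
      then show ?thesis using False by (simp add: block_element_def)
    qed
    then have "(\<Sum>k'=1..r. ?X k' (\<Phi> k' z)) = (\<Sum>k'=1..r. if k' = k then z else 0)" by (intro sum.cong) auto
    then show "(\<Sum>k'=1..r. ?X k' (\<Phi> k' z)) = z" using k(1) by simp
  qed
  with \<Phi>(1) show thesis by (rule that)
qed

text \<open>Places the parameters of block \<open>b\<close> in the superspace. Padding coordinates
  are sent to 0, so the map need not be injective.\<close>

definition embed :: "(nat \<Rightarrow> 'a) \<Rightarrow> 'k::finite set \<Rightarrow> 'k \<times> nat \<Rightarrow> 'a \<Rightarrow> 'a ^ 'k" where
  "embed U E b w = axis (fst b) (block_element U (block_vector E b) (block_size E b) w)"

lemma linear_embed: "linear (embed U E b)"
proof -
  note lin = linear_block_element[of U "block_vector E b" "block_size E b"]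
  show ?thesis
    unfolding embed_def by (intro linearI) (simp_all add: vec_eq_iff axis_def linear_add[OF lin] linear_scale[OF lin])
qed

lemma embed_in: "b \<in> blocks E \<Longrightarrow> embed U E b w \<in> superspace L0 L1 E"
proof -
  assume b: "b \<in> blocks E"
  have sub: "subspace (if fst b \<in> E then L0 else L1)" and z: "0 \<in> L0" "0 \<in> L1"
    using csa subspace_0 by (auto simp: comm_superalgebra_def)
  have "block_element U (block_vector E b) (block_size E b) w \<in> (if fst b \<in> E then L0 else L1)"
    unfolding block_element_def
    by (intro subspace_sum[OF sub] subspace_scale[OF sub]) (use block_facts(6)[OF b] in force)
  then show ?thesis using z by (auto simp: superspace_def embed_def axis_def split: if_splits)
qed

lemma superspace_subspace: "subspace (superspace L0 L1 E)"
proof -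
  have "subspace L0" "subspace L1" using csa by (auto simp: comm_superalgebra_def)
  then show ?thesis
    unfolding superspace_def subspace_def by (auto split: if_splits)
qed

text \<open>A linear right inverse of the sum of the embeddings, by which a displacement in the
  superspace is lifted to block parameters.\<close>

lemma superspace_coordinates:
  fixes U :: "nat \<Rightarrow> 'a" and E :: "'k::finite set"
  assumes U: "bij_betw U {..<DIM('a)} Basis"
  obtains \<Phi> :: "'k \<times> nat \<Rightarrow> 'a \<Rightarrow> 'a" where "\<And>b. linear (\<Phi> b)"
    "\<And>h. h \<in> superspace L0 L1 E \<Longrightarrow> (\<Sum>b\<in>blocks E. embed U E b (\<Phi> b (h $ fst b))) = h"
proof -
  obtain \<Phi>0 :: "'a \<Rightarrow> 'a" where \<Phi>0: "linear \<Phi>0" "\<And>x. x \<in> L0 \<Longrightarrow> block_element U e (p + 1) (\<Phi>0 x) = x"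
  proof (rule even_coordinates[OF U])
    fix \<Phi> :: "'a \<Rightarrow> 'a" assume *: "linear \<Phi>" "\<And>x. x \<in> L0 \<Longrightarrow> block_element U e (p + 1) (\<Phi> x) = x"
    show thesis by (rule that[OF *])
  qed
  obtain \<Phi>1 :: "nat \<Rightarrow> 'a \<Rightarrow> 'a" where \<Phi>1: "\<And>k. linear (\<Phi>1 k)"
    "\<And>x. x \<in> L1 \<Longrightarrow> (\<Sum>k=1..r. block_element U (\<lambda>i. \<epsilon> (s k + i)) (s (k + 1) - s k) (\<Phi>1 k x)) = x"
  proof (rule odd_coordinates[OF U])
    fix \<Phi> :: "nat \<Rightarrow> 'a \<Rightarrow> 'a" assume *: "\<And>k. linear (\<Phi> k)"
      "\<And>x. x \<in> L1 \<Longrightarrow> (\<Sum>k=1..r. block_element U (\<lambda>i. \<epsilon> (s k + i)) (s (k + 1) - s k) (\<Phi> k x)) = x"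
    show thesis by (rule that[OF *])
  qed
  define \<Phi> where "\<Phi> b = (if fst b \<in> E then \<Phi>0 else \<Phi>1 (snd b))" for b :: "'k \<times> nat"
  have "(\<Sum>b\<in>blocks E. embed U E b (\<Phi> b (h $ fst b))) $ v = h $ v" if h: "h \<in> superspace L0 L1 E" for h v
  proof -
    let ?X = "\<lambda>b. block_element U (block_vector E b) (block_size E b) (\<Phi> b (h $ fst b))"
    have hv: "h $ v \<in> (if v \<in> E then L0 else L1)" using h unfolding superspace_def by blast
    have "(\<Sum>b\<in>blocks E. embed U E b (\<Phi> b (h $ fst b))) $ v = (\<Sum>b\<in>blocks E. if fst b = v then ?X b else 0)"
      unfolding sum_component by (intro sum.cong) (auto simp: embed_def axis_def)
    also have "\<dots> = (\<Sum>b\<in>{b\<in>blocks E. fst b = v}. ?X b)" by (rule sum.inter_filter[symmetric, OF finite_blocks])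
    also have "\<dots> = h $ v"
    proof (cases "v \<in> E")
      case True
      have "{b\<in>blocks E. fst b = v} = {(v, 0)}" using True by (auto simp: blocks_def)
      then show ?thesis
        using True \<Phi>0(2)[of "h $ v"] hv
        by (simp add: \<Phi>_def block_size_def block_vector_def[abs_def])
    next
      case False
      have "{b\<in>blocks E. fst b = v} = Pair v ` {1..r}" using False by (auto simp: blocks_def)
      then have "(\<Sum>b\<in>{b\<in>blocks E. fst b = v}. ?X b) = (\<Sum>k=1..r. ?X (v, k))"
        by (simp add: sum.reindex inj_on_def)
      moreover have "h $ v \<in> L1" using hv False by simp
      ultimately show ?thesis
        using False \<Phi>1(2)[of "h $ v"] by (simp add: \<Phi>_def block_size_def block_vector_def[abs_def])
    qed
    finally show ?thesis .
  qed
  then have eq: "(\<Sum>b\<in>blocks E. embed U E b (\<Phi> b (h $ fst b))) = h" if "h \<in> superspace L0 L1 E" for h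
    unfolding vec_eq_iff using that by blast
  have "linear (\<Phi> b)" for b using \<Phi>0(1) \<Phi>1(1) by (simp add: \<Phi>_def)
  from this eq show thesis by (rule that)
qed

text \<open>Evaluating the form on the tangent vector \<open>e i\<close> leaves a single term. For
  \<open>i = 0\<close>, which does not occur in the form, the relation holds because
  \<open>e 0 = 1\<close>.\<close>

lemma even_partials:
  assumes "\<And>h. h \<in> superspace L0 L1 UNIV \<Longrightarrow> d_second p e q \<epsilon> r s a UNIV g (u :: 'a ^ 1) h = 0" and i: "i \<le> p"
  shows "real_partial g u 1 (e i) = e i * real_partial g u 1 (e 0)"
proof (cases "i = 0")
  case True
  have "e 0 = 1" using A0 by (simp add: condition_A0_def)
  then show ?thesis using True by simp
next
  case False
  let ?Y = "\<lambda>j. real_partial g u 1 (e j) - e j * real_partial g u 1 (e 0)"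
  have "(\<chi> _. e i) \<in> superspace L0 L1 (UNIV :: 1 set)" using e_in[OF i] by (simp add: superspace_def)
  from assms(1)[OF this]
  have "(\<Sum>j=1..p. representation (e ` {0..p}) (e i) (e j) *\<^sub>R ?Y j) = 0"
    by (simp add: d_second_def UNIV_1)
  moreover have "representation (e ` {0..p}) (e i) (e j) *\<^sub>R ?Y j = (if j = i then ?Y i else 0)" if "j \<in> {1..p}" for j
  proof -
    have eq: "e j = e i \<longleftrightarrow> j = i" using inj_on_eq_iff[OF e_basis(1), of j i] i that by simp
    have "representation (e ` {0..p}) (e i) = (\<lambda>v. if v = e i then 1 else 0)"
      by (rule representation_basis[OF e_basis(2)]) (use i in simp)
    then show ?thesis using eq by (cases "j = i") simp_all
  qed
  ultimately have "(\<Sum>j=1..p. if j = i then ?Y i else 0) = 0" by simp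
  then show ?thesis using False i by simp
qed

text \<open>The tangent vector \<open>\<epsilon> t\<close> singles out one term, as \<open>t\<close>
  lies in only one group. The case \<open>t = s k\<close>, absent from the form, holds because
  \<open>a (s k) = 1\<close>.\<close>

lemma odd_partials:
  assumes "\<And>h. h \<in> superspace L0 L1 {} \<Longrightarrow> d_second p e q \<epsilon> r s a {} g (u :: 'a ^ 1) h = 0"
    and k: "k \<in> {1..r}" and t: "t \<in> {s k..<s (k + 1)}"
  shows "real_partial g u 1 (\<epsilon> t) = a t * real_partial g u 1 (\<epsilon> (s k))"
proof (cases "t = s k")
  case True
  have "a (s k) = 1" using A1 k by (auto simp: condition_A1_def)
  then show ?thesis using True by simp
next
  case False
  let ?Y = "\<lambda>k t. real_partial g u 1 (\<epsilon> t) - a t * real_partial g u 1 (\<epsilon> (s k))"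
  have tq: "t \<in> {1..q}" using block_range[OF k t] .
  have "\<epsilon> t \<in> L1" using span_base[of "\<epsilon> t" "\<epsilon> ` {1..q}"] \<epsilon>_basis(3) tq by auto
  then have "(\<chi> _. \<epsilon> t) \<in> superspace L0 L1 ({} :: 1 set)" by (simp add: superspace_def)
  from assms(1)[OF this]
  have "(\<Sum>k'=1..r. \<Sum>t'\<in>{s k' + 1..<s (k' + 1)}. representation (\<epsilon> ` {1..q}) (\<epsilon> t) (\<epsilon> t') *\<^sub>R ?Y k' t') = 0"
    by (simp add: d_second_def UNIV_1)
  moreover have "(\<Sum>t'\<in>{s k' + 1..<s (k' + 1)}. representation (\<epsilon> ` {1..q}) (\<epsilon> t) (\<epsilon> t') *\<^sub>R ?Y k' t')
      = (if k' = k then ?Y k t else 0)" if k': "k' \<in> {1..r}" for k'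
  proof -
    have "representation (\<epsilon> ` {1..q}) (\<epsilon> t) (\<epsilon> t') *\<^sub>R ?Y k' t' = (if t' = t then ?Y k' t else 0)"
      if "t' \<in> {s k' + 1..<s (k' + 1)}" for t'
    proof -
      have "t' \<in> {1..q}" using that by (intro block_range[OF k']) auto
      then have "\<epsilon> t' = \<epsilon> t \<longleftrightarrow> t' = t" by (rule inj_on_eq_iff[OF \<epsilon>_basis(1) _ tq])
      moreover have "representation (\<epsilon> ` {1..q}) (\<epsilon> t) = (\<lambda>v. if v = \<epsilon> t then 1 else 0)"
        by (rule representation_basis[OF \<epsilon>_basis(2) imageI[OF tq]])
      ultimately show ?thesis by (cases "t' = t") simp_all
    qed
    then have "(\<Sum>t'\<in>{s k' + 1..<s (k' + 1)}. representation (\<epsilon> ` {1..q}) (\<epsilon> t) (\<epsilon> t') *\<^sub>R ?Y k' t')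
      = (\<Sum>t'\<in>{s k' + 1..<s (k' + 1)}. if t' = t then ?Y k' t else 0)" by (intro sum.cong) auto
    also have "\<dots> = (if t \<in> {s k' + 1..<s (k' + 1)} then ?Y k' t else 0)" by simp
    also have "\<dots> = (if k' = k then ?Y k t else 0)"
    proof (cases "k' = k")
      case True
      then show ?thesis using t False by simp
    next
      case neq: False
      then have "t \<notin> {s k'..<s (k' + 1)}" using block_unique[OF k k' t] by blast
      then have "t \<notin> {s k' + 1..<s (k' + 1)}" by simp
      then show ?thesis using neq by (simp only: if_False)
    qed
    finally show ?thesis .
  qed
  ultimately have "(\<Sum>k'=1..r. if k' = k then ?Y k t else 0) = 0" by simp
  then show ?thesis using k by simp
qed

end

section \<open>From separate qS-differentiability to block derivatives and joint
  differentiability\<close>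

lemma linear_axis: "linear (axis v :: 'a::real_vector \<Rightarrow> 'a ^ 'k::finite)"
  by (intro linearI) (simp_all add: vec_eq_iff axis_def)

context superalgebra_bases
begin

text \<open>The relations between the partial derivatives express all of them, along one block, as
  multiples of a single vector \<open>w\<close>. In an odd variable only one group is moved at a
  time, since \<open>d''\<close> does not relate different groups.\<close>

lemma block_slice_derivative:
  fixes E :: "'k::finite set"
  assumes U: "bij_betw U {..<DIM('a)} Basis"
    and D: "openin (top_of_set (superspace L0 L1 E)) D"
    and sep: "separately_qS_differentiable_on L0 L1 p e q \<epsilon> r s a E f D"
    and x: "x \<in> D" and b: "b \<in> blocks E"
  shows "\<exists>w. ((\<lambda>h. f (x + embed U E b h)) has_derivative
    (\<lambda>h. mult_blinfun (block_element U (block_coeff E b) (block_size E b) h) w)) (at 0)"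
proof -
  obtain v k where vk: "b = (v, k)" by (cases b)
  define E' :: "1 set" where "E' = (if v \<in> E then UNIV else {})"
  define L where "L = (if v \<in> E then L0 else L1)"
  define g where "g u = f (replace_var x v u)" for u
  define S where "S = {u. replace_var x v u \<in> D}"
  define u0 :: "'a ^ 1" where "u0 = (\<chi> _. x $ v)"
  define z where "z = block_vector E b"
  define n where "n = block_size E b"
  obtain T where T: "open T" "D = superspace L0 L1 E \<inter> T" using D by (auto simp: openin_open)
  have xs: "x \<in> superspace L0 L1 E" "x \<in> T" using x T(2) by auto
  have rv: "replace_var x v (u0 + axis 1 y) = x + axis v y" for y
    by (simp add: vec_eq_iff replace_var_def u0_def axis_def)
  have lax: "linear (axis v :: 'a \<Rightarrow> 'a ^ 'k)" "linear (axis 1 :: 'a \<Rightarrow> 'a ^ 1)" by (rule linear_axis)+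
  have subsp: "0 \<in> L0" "0 \<in> L1" using csa subspace_0 by (auto simp: comm_superalgebra_def)
  have axs: "axis v y \<in> superspace L0 L1 E" if "y \<in> L" for y
    using that subsp by (auto simp: superspace_def axis_def L_def)
  have inS: "u0 + axis 1 y \<in> S" if "y \<in> L" "x + axis v y \<in> T" for y
    using subspace_add[OF superspace_subspace xs(1) axs[OF that(1)]] that(2) T(2) by (simp add: S_def rv)
  have "qS_differentiable_on L0 L1 p e q \<epsilon> r s a E' g S"
    using sep xs(1) unfolding separately_qS_differentiable_on_def g_def S_def E'_def by blast
  moreover have "u0 \<in> S"
    using inS[of 0] subsp xs(2) linear_0[OF lax(1)] linear_0[OF lax(2)] by (simp add: L_def split: if_splits)
  ultimately have gd: "g differentiable (at u0 within S)"
    and g2: "\<And>h. h \<in> superspace L0 L1 E' \<Longrightarrow> d_second p e q \<epsilon> r s a E' g u0 h = 0"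
    by (auto simp: qS_differentiable_on_def)
  obtain g' where g': "(g has_derivative g') (at u0 within S)" using gd by (auto simp: differentiable_def)
  have lg: "linear (\<lambda>y. g' (axis 1 y))"
    using linear_compose[OF lax(2) has_derivative_linear[OF g']] by (simp add: o_def)
  have partial: "real_partial g u0 1 y = g' (axis 1 y)" if y: "y \<in> L" for y
  proof -
    have "open ((\<lambda>t. x + t *\<^sub>R axis v y) -` T)"
      by (intro open_vimage T continuous_intros)
    moreover have "0 \<in> (\<lambda>t. x + t *\<^sub>R axis v y) -` T" using xs by simp
    ultimately obtain \<eta> where \<eta>: "\<eta> > 0" "ball 0 \<eta> \<subseteq> (\<lambda>t. x + t *\<^sub>R axis v y) -` T"
      using openE by blast
    show ?thesis
    proof (rule real_partial_eq_derivative[OF g' \<eta>(1)])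
      fix t :: real assume "\<bar>t\<bar> < \<eta>"
      then have "x + t *\<^sub>R axis v y \<in> T" using \<eta>(2) by auto
      moreover have "t *\<^sub>R y \<in> L" using y csa subspace_scale by (auto simp: L_def comm_superalgebra_def)
      ultimately show "u0 + t *\<^sub>R axis 1 y \<in> S"
        using inS[of "t *\<^sub>R y"] by (simp add: linear_scale[OF lax(1)] linear_scale[OF lax(2)])
    qed
  qed
  have zL: "z i \<in> L" if "i < n" for i
    using block_facts(6)[OF b, of i] that by (auto simp: L_def z_def n_def vk)
  have n0: "0 < n" using block_facts(1)[OF b] by (simp add: n_def)
  \<comment> \<open>The derivative along the leading vector of the block, \<open>e 0\<close> or
    \<open>\<epsilon> (s k)\<close>, to which the form compares the others.\<close>
  define w where "w = g' (axis 1 (z 0))"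
  have rel: "g' (axis 1 (z i)) = block_coeff E b i * w" if i: "i < n" for i
  proof -
    have "real_partial g u0 1 (z i) = block_coeff E b i * real_partial g u0 1 (z 0)"
    proof (cases "v \<in> E")
      case True
      have "real_partial g u0 1 (e i) = e i * real_partial g u0 1 (e 0)"
      proof (rule even_partials)
        show "d_second p e q \<epsilon> r s a UNIV g u0 h = 0" if "h \<in> superspace L0 L1 UNIV" for h
          using g2[of h] that True by (simp add: E'_def)
        show "i \<le> p" using i True by (simp add: n_def block_size_def vk)
      qed
      then show ?thesis using True by (simp add: z_def block_vector_def block_coeff_def vk)
    next
      case False
      then have k: "k \<in> {1..r}" using b by (auto simp: vk blocks_def)
      have "real_partial g u0 1 (\<epsilon> (s k + i)) = a (s k + i) * real_partial g u0 1 (\<epsilon> (s k))"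
      proof (rule odd_partials[OF _ k])
        show "d_second p e q \<epsilon> r s a {} g u0 h = 0" if "h \<in> superspace L0 L1 {}" for h
          using g2[of h] that False by (simp add: E'_def)
        show "s k + i \<in> {s k..<s (k + 1)}" using i False by (auto simp: n_def block_size_def vk)
      qed
      then show ?thesis using False by (simp add: z_def block_vector_def block_coeff_def vk)
    qed
    then show ?thesis using partial[OF zL[OF i]] partial[OF zL[OF n0]] by (simp add: w_def)
  qed
  let ?be = "block_element U z n"
  have beL: "?be h \<in> L" for h
  proof -
    have "subspace L" using csa by (simp add: L_def comm_superalgebra_def)
    then show ?thesis unfolding block_element_def using zL by (intro subspace_sum subspace_scale) auto
  qed
  have emb: "embed U E b h = axis v (?be h)" for h by (simp add: embed_def vk z_def n_def)
  have bl: "bounded_linear (\<lambda>h. axis 1 (?be h) :: 'a ^ 1)"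
    using linear_compose[OF linear_block_element lax(2), of U z n] by (simp add: linear_conv_bounded_linear o_def)
  have bl': "bounded_linear (\<lambda>h. axis v (?be h))"
    using linear_compose[OF linear_block_element lax(1), of U z n] by (simp add: linear_conv_bounded_linear o_def)
  \<comment> \<open>Block parameters that stay in \<open>T\<close>. They form an open set, so the
    derivative within the slice becomes an ordinary derivative at 0 in the parameter space.\<close>
  define N where "N = (\<lambda>h. x + axis v (?be h)) -` T"
  have N: "open N" unfolding N_def
    by (intro open_vimage T continuous_on_add continuous_on_const linear_continuous_on bl')
  have be0: "?be 0 = 0" by (simp add: block_element_def)
  have N0: "0 \<in> N" using xs by (simp add: N_def be0 linear_0[OF lax(1)])
  have 1: "((\<lambda>h. u0 + axis 1 (?be h)) has_derivative (\<lambda>h. axis 1 (?be h))) (at 0 within N)"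
    using bounded_linear_imp_has_derivative[OF bl] by (auto intro!: derivative_eq_intros)
  have "(g has_derivative g') (at (u0 + axis 1 (?be 0)) within (\<lambda>h. u0 + axis 1 (?be h)) ` N)"
    unfolding be0 linear_0[OF lax(2)] add_0_right
    by (rule has_derivative_subset[OF g']) (use inS beL in \<open>auto simp: N_def\<close>)
  from has_derivative_in_compose[OF 1 this]
  have "((\<lambda>h. g (u0 + axis 1 (?be h))) has_derivative (\<lambda>h. g' (axis 1 (?be h)))) (at 0)"
    unfolding at_within_open[OF N0 N] .
  moreover have "g (u0 + axis 1 (?be h)) = f (x + embed U E b h)" for h by (simp add: g_def rv emb)
  moreover have "g' (axis 1 (?be h)) = mult_blinfun (block_element U (block_coeff E b) (block_size E b) h) w" for h
  proof -
    have "g' (axis 1 (?be h)) = (\<Sum>i<n. (h \<bullet> U i) *\<^sub>R g' (axis 1 (z i)))"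
      unfolding block_element_def linear_sum[OF lg] linear_scale[OF lg] ..
    also have "\<dots> = (\<Sum>i<n. (h \<bullet> U i) *\<^sub>R (block_coeff E b i * w))" using rel by (intro sum.cong) auto
    also have "\<dots> = mult_blinfun (block_element U (block_coeff E b) (block_size E b) h) w"
      by (simp add: block_element_def sum_distrib_right n_def)
    finally show ?thesis .
  qed
  ultimately show ?thesis by (intro exI[of _ w]) simp
qed

text \<open>\<open>P\<close> pulls \<open>f\<close> back to a polydisc of block parameters, where
  the quadratic expansion holds; \<open>coord\<close> lifts displacements linearly, so the error
  remains quadratic in \<open>x - x0\<close>.\<close>

theorem separately_qS_imp_differentiable:
  fixes E :: "'k::finite set" and f :: "'a ^ 'k \<Rightarrow> 'a"
  assumes D: "openin (top_of_set (superspace L0 L1 E)) D"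
    and sep: "separately_qS_differentiable_on L0 L1 p e q \<epsilon> r s a E f D" and x0: "x0 \<in> D"
  shows "f differentiable (at x0 within D)"
proof -
  obtain U :: "nat \<Rightarrow> 'a" where U: "bij_betw U {..<DIM('a)} Basis"
    using ex_bij_betw_nat_finite[OF finite_Basis] unfolding atLeast0LessThan by (elim exE)
  define B where "B = blocks E"
  define A where "A b h = mult_blinfun (block_element U (block_coeff E b) (block_size E b) h)" for b h
  define J where "J = embed U E"
  have finB: "finite B" by (simp add: B_def finite_blocks)
  interpret elliptic_family A "U 0" B
  proof (rule elliptic_family.intro[OF finB])
    fix b assume "b \<in> B"
    then have b: "b \<in> blocks E" by (simp add: B_def)
    show "elliptic_symbol (A b) (U 0)"
      unfolding A_def
      by (rule elliptic_symbol_block[OF U block_facts(1,2,3)[OF b] block_facts(4)[OF b] block_facts(5)[OF b]])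
  qed
  obtain \<Phi> :: "'k \<times> nat \<Rightarrow> 'a \<Rightarrow> 'a" where \<Phi>: "\<And>b. linear (\<Phi> b)"
    "\<And>h. h \<in> superspace L0 L1 E \<Longrightarrow> (\<Sum>b\<in>blocks E. embed U E b (\<Phi> b (h $ fst b))) = h"
  proof (rule superspace_coordinates[OF U])
    fix \<Phi> :: "'k \<times> nat \<Rightarrow> 'a \<Rightarrow> 'a" assume *: "\<And>b. linear (\<Phi> b)"
      "\<And>h. h \<in> superspace L0 L1 E \<Longrightarrow> (\<Sum>b\<in>blocks E. embed U E b (\<Phi> b (h $ fst b))) = h"
    show thesis by (rule that[OF *])
  qed
  have linJ: "linear (J b)" for b unfolding J_def by (rule linear_embed)
  obtain T where T: "open T" "D = superspace L0 L1 E \<inter> T" using D by (auto simp: openin_open)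
  obtain \<eta> where \<eta>: "\<eta> > 0" "ball x0 \<eta> \<subseteq> T" using T x0 openE by blast
  define KJ where "KJ b = onorm (J b)" for b
  have blJ: "bounded_linear (J b)" for b using linJ[of b] by (simp add: linear_conv_bounded_linear)
  have KJ: "norm (J b w) \<le> norm w * KJ b" "KJ b \<ge> 0" for b w
    using onorm[OF blJ, of b w] onorm_pos_le[OF blJ, of b] by (simp_all add: KJ_def mult.commute)
  \<comment> \<open>Chosen so that \<open>P\<close> displaces \<open>x0\<close> by less than
    \<open>\<eta>\<close>; the summand 1 makes the inequality strict and the denominator
    positive.\<close>
  define R where "R = \<eta> / (1 + (\<Sum>b\<in>B. KJ b))"
  have KJ0: "(\<Sum>b\<in>B. KJ b) \<ge> 0" using KJ(2) by (simp add: sum_nonneg)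
  have R: "R > 0" using \<eta> KJ0 by (simp add: R_def)
  define P where "P y = x0 + (\<Sum>b\<in>B. J b (y b))" for y
  define c where "c = (\<lambda>_ :: 'k \<times> nat. 0 :: 'a)"
  define H where "H y = f (P y)" for y
  have x0s: "x0 \<in> superspace L0 L1 E" using x0 T by auto
  have PD: "P y \<in> D" if y: "y \<in> polydisc B c R" for y
  proof -
    have "norm (\<Sum>b\<in>B. J b (y b)) \<le> (\<Sum>b\<in>B. R * KJ b)"
    proof (rule sum_norm_le)
      fix b assume "b \<in> B"
      then have "norm (y b) \<le> R" using y by (auto simp: polydisc_def c_def dist_norm less_imp_le)
      then have "norm (y b) * KJ b \<le> R * KJ b" by (rule mult_right_mono) (rule KJ(2))
      then show "norm (J b (y b)) \<le> R * KJ b" using KJ(1)[of b "y b"] by linarith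
    qed
    also have "\<dots> = R * (\<Sum>b\<in>B. KJ b)" by (simp add: sum_distrib_left)
    also have "\<dots> < R * (1 + (\<Sum>b\<in>B. KJ b))" using R by (intro mult_strict_left_mono) auto
    also have "\<dots> = \<eta>" using KJ0 by (simp add: R_def)
    finally have "P y \<in> ball x0 \<eta>" by (simp add: P_def dist_norm)
    moreover have "P y \<in> superspace L0 L1 E"
      unfolding P_def J_def B_def
      by (intro subspace_add[OF superspace_subspace x0s] subspace_sum[OF superspace_subspace] embed_in)
    ultimately show ?thesis using T \<eta>(2) by blast
  qed
  have Pupd: "P (y(b := h)) = P y + J b (h - y b)" if "b \<in> B" for y b h
  proof -
    have "(\<Sum>b'\<in>B. J b' ((y(b := h)) b')) = (\<Sum>b'\<in>B. J b' (y b') + (if b' = b then J b (h - y b) else 0))"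
      by (intro sum.cong) (auto simp: linear_diff[OF linJ])
    also have "\<dots> = (\<Sum>b'\<in>B. J b' (y b')) + J b (h - y b)"
      using that finB by (simp add: sum.distrib)
    finally show ?thesis by (simp add: P_def add.assoc)
  qed
  have sepA: "sep_A_differentiable A B c R H"
    unfolding sep_A_differentiable_def
  proof (intro ballI)
    fix y b assume y: "y \<in> polydisc B c R" and b: "b \<in> B"
    have bE: "b \<in> blocks E" using b by (simp add: B_def)
    obtain w where w: "((\<lambda>h. f (P y + J b h)) has_derivative (\<lambda>h. A b h w)) (at 0)"
      using block_slice_derivative[OF U D sep PD[OF y] bE] unfolding A_def J_def by (elim exE)
    have "((\<lambda>h. h - y b) has_derivative (\<lambda>h. h)) (at (y b))" by (auto intro!: derivative_eq_intros)
    from diff_chain_at[OF this, of "\<lambda>h. f (P y + J b h)" "\<lambda>h. A b h w"] w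
    have "((\<lambda>h. f (P y + J b (h - y b))) has_derivative (\<lambda>h. A b h w)) (at (y b))"
      by (simp add: o_def)
    then show "\<exists>v. ((\<lambda>h. H (y(b := h))) has_derivative (\<lambda>h. A b h v)) (at (y b))"
      unfolding H_def Pupd[OF b] by (rule exI)
  qed
  obtain \<delta> C V where \<delta>: "\<delta> > 0" and exp: "\<forall>y\<in>polydisc B c \<delta>.
     norm (H y - H c - (\<Sum>b\<in>B. A b (y b - c b) (V b))) \<le> C * (\<Sum>b\<in>B. norm (y b - c b))\<^sup>2"
    using sep_A_differentiable_expansion[OF order_refl R sepA] by (elim exE conjE)
  define \<delta>' where "\<delta>' = min \<delta> R"
  have \<delta>': "\<delta>' > 0" using \<delta> R by (simp add: \<delta>'_def)
  have Hc: "H c = f x0" by (simp add: H_def P_def c_def linear_0[OF linJ])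
  \<comment> \<open>Set to 0 off \<open>B\<close>, where points of a polydisc agree with its centre,
    here 0.\<close>
  define coord where "coord h b = (if b \<in> B then \<Phi> b (h $ fst b) else 0)" for h :: "'a ^ 'k" and b
  have lc: "linear (\<lambda>h. coord h b)" for b
  proof (cases "b \<in> B")
    case True
    have "linear (\<lambda>h :: 'a ^ 'k. h $ fst b)" by (intro linearI) auto
    from linear_compose[OF this \<Phi>(1)[of b]] True show ?thesis by (simp add: coord_def o_def)
  qed (simp add: coord_def linear_zero)
  define KC where "KC b = onorm (\<lambda>h. coord h b)" for b
  have blc: "bounded_linear (\<lambda>h. coord h b)" for b using lc[of b] by (simp add: linear_conv_bounded_linear)
  have KC: "norm (coord h b) \<le> norm h * KC b" "KC b \<ge> 0" for b h
    using onorm[OF blc, of h b] onorm_pos_le[OF blc, of b] by (simp_all add: KC_def mult.commute)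
  define K where "K = 1 + (\<Sum>b\<in>B. KC b)"
  have K: "K \<ge> 1" using KC(2) by (simp add: K_def sum_nonneg)
  have KCK: "KC b \<le> K" if "b \<in> B" for b
    using member_le_sum[OF that, of KC] KC(2) finB by (simp add: K_def)
  have coord_bound: "norm (coord h b) \<le> K * norm h" if "b \<in> B" for h b
  proof -
    have "norm h * KC b \<le> norm h * K" by (intro mult_left_mono KCK that norm_ge_zero)
    then show ?thesis using KC(1)[of h b] by (simp add: mult.commute)
  qed
  have coord_sum: "(\<Sum>b\<in>B. norm (coord h b)) \<le> K * norm h" for h
  proof -
    have "(\<Sum>b\<in>B. norm (coord h b)) \<le> (\<Sum>b\<in>B. norm h * KC b)" by (intro sum_mono KC)
    also have "\<dots> = norm h * (\<Sum>b\<in>B. KC b)" by (simp add: sum_distrib_left)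
    also have "\<dots> \<le> K * norm h" by (simp add: K_def algebra_simps)
    finally show ?thesis .
  qed
  define f' where "f' h = (\<Sum>b\<in>B. A b (coord h b) (V b))" for h
  have "(f has_derivative f') (at x0 within D)"
    unfolding has_derivative_within_alt
  proof (intro conjI allI impI)
    have "bounded_linear (\<lambda>h. A b (coord h b) (V b))" if "b \<in> B" for b
    proof -
      have 1: "bounded_linear (A b)" by (rule elliptic_symbol.bounded_linear_A[OF symbol[OF that]])
      show ?thesis
        by (rule bounded_linear_compose[OF blinfun.bounded_linear_left bounded_linear_compose[OF 1 blc]])
    qed
    then show "bounded_linear f'" unfolding f'_def by (intro bounded_linear_sum)
    fix \<epsilon>' :: real assume \<epsilon>': "\<epsilon>' > 0"
    \<comment> \<open>The first bound places the lifted displacement in the polydisc, the second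
      turns the quadratic error into \<open>\<epsilon>'\<close> times the distance.\<close>
    define d where "d = min (\<delta>' / K) (\<epsilon>' / ((\<bar>C\<bar> + 1) * K\<^sup>2))"
    have d: "d > 0" using \<delta>' K \<epsilon>' by (simp add: d_def)
    have "norm (f x - f x0 - f' (x - x0)) \<le> \<epsilon>' * norm (x - x0)" if x: "x \<in> D" and xd: "norm (x - x0) < d" for x
    proof -
      let ?y = "coord (x - x0)"
      have xs: "x - x0 \<in> superspace L0 L1 E"
        using x T x0s subspace_diff[OF superspace_subspace] by blast
      have "(\<Sum>b\<in>B. J b (?y b)) = x - x0"
        using \<Phi>(2)[OF xs] by (simp add: J_def B_def coord_def)
      then have Hy: "H ?y = f x" by (simp add: H_def P_def)
      have "K * norm (x - x0) < \<delta>'"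
      proof -
        have "norm (x - x0) < \<delta>' / K" using xd by (simp add: d_def)
        then show ?thesis using K by (simp add: less_divide_eq mult.commute)
      qed
      then have "norm (?y b) < \<delta>" if "b \<in> B" for b using coord_bound[OF that, of "x - x0"] by (simp add: \<delta>'_def)
      then have "?y \<in> polydisc B c \<delta>" by (auto simp: polydisc_def c_def dist_norm coord_def)
      from bspec[OF exp this]
      have "norm (f x - f x0 - f' (x - x0)) \<le> C * (\<Sum>b\<in>B. norm (?y b))\<^sup>2"
        by (simp add: Hy Hc[unfolded c_def] c_def f'_def)
      also have "\<dots> \<le> \<bar>C\<bar> * (\<Sum>b\<in>B. norm (?y b))\<^sup>2" by (intro mult_right_mono) auto
      also have "\<dots> \<le> \<bar>C\<bar> * (K * norm (x - x0))\<^sup>2"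
        using coord_sum by (intro mult_left_mono power_mono sum_nonneg) auto
      also have "\<dots> = (\<bar>C\<bar> * K\<^sup>2 * norm (x - x0)) * norm (x - x0)" by (simp add: power2_eq_square mult_ac)
      also have "\<dots> \<le> \<epsilon>' * norm (x - x0)"
      proof (rule mult_right_mono)
        have CK: "(\<bar>C\<bar> + 1) * K\<^sup>2 > 0" using K by (simp add: add_nonneg_pos)
        have "norm (x - x0) \<le> \<epsilon>' / ((\<bar>C\<bar> + 1) * K\<^sup>2)" using xd by (simp add: d_def)
        then have "(\<bar>C\<bar> + 1) * K\<^sup>2 * norm (x - x0) \<le> \<epsilon>'"
          using CK by (simp add: le_divide_eq mult.commute)
        moreover have "\<bar>C\<bar> * K\<^sup>2 * norm (x - x0) \<le> (\<bar>C\<bar> + 1) * K\<^sup>2 * norm (x - x0)"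
          by (intro mult_right_mono) auto
        ultimately show "\<bar>C\<bar> * K\<^sup>2 * norm (x - x0) \<le> \<epsilon>'" by linarith
      qed simp
      finally show ?thesis .
    qed
    then show "\<exists>d>0. \<forall>x\<in>D. norm (x - x0) < d \<longrightarrow> norm (f x - f x0 - f' (x - x0)) \<le> \<epsilon>' * norm (x - x0)"
      using d by blast
  qed
  then show ?thesis by (auto simp: differentiable_def)
qed

end

section \<open>The form \<open>d''\<close> as a sum over one-variable slices\<close>

lemma real_partial_slice:
  "real_partial (\<lambda>u. f (replace_var x v u)) (\<chi> _. x $ v) 1 y = real_partial f x v y"
proof -
  have "replace_var x v ((\<chi> _. x $ v) + t *\<^sub>R axis 1 y) = x + t *\<^sub>R axis v y" for t
    by (simp add: vec_eq_iff replace_var_def axis_def)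
  then show ?thesis by (simp add: real_partial_def)
qed

text \<open>A real partial derivative is taken along a line, and a line in the direction of one
  variable lies in the slice of that variable; so the identity holds pointwise for every
  \<open>f\<close>.\<close>

lemma d_second_sum_slices:
  fixes E :: "'k::finite set" and f :: "'a::{real_algebra_1, euclidean_space} ^ 'k \<Rightarrow> 'a"
  shows "d_second p e q \<epsilon> r s a E f x h = (\<Sum>v\<in>UNIV. d_second p e q \<epsilon> r s a (if v \<in> E then UNIV else {})
    (\<lambda>u. f (replace_var x v u)) (\<chi> _. x $ v :: 'a ^ 1) (\<chi> _. h $ v))"
proof -
  define F where "F v = d_second p e q \<epsilon> r s a (if v \<in> E then UNIV else {})
    (\<lambda>u. f (replace_var x v u)) (\<chi> _. x $ v :: 'a ^ 1) (\<chi> _. h $ v)" for v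
  have even: "F v = (\<Sum>j=1..p. representation (e ` {0..p}) (h $ v) (e j) *\<^sub>R
      (real_partial f x v (e j) - e j * real_partial f x v (e 0)))" if "v \<in> E" for v
    using that by (simp add: F_def d_second_def UNIV_1 real_partial_slice[of f x v])
  have odd: "F v = (\<Sum>k=1..r. \<Sum>t\<in>{s k + 1..<s (k+1)}. representation (\<epsilon> ` {1..q}) (h $ v) (\<epsilon> t) *\<^sub>R
      (real_partial f x v (\<epsilon> t) - a t * real_partial f x v (\<epsilon> (s k))))" if "v \<in> - E" for v
    using that by (simp add: F_def d_second_def UNIV_1 real_partial_slice[of f x v])
  have "sum F (E \<union> - E) = sum F E + sum F (- E)" by (rule sum.union_disjoint) auto
  then have "sum F UNIV = sum F E + sum F (- E)" by (simp only: Compl_partition)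
  also have "\<dots> = d_second p e q \<epsilon> r s a E f x h"
    unfolding d_second_def by (intro arg_cong2[where f = "(+)"] sum.cong refl even odd)
  finally show ?thesis unfolding F_def by (rule sym)
qed

theorem mainTheorem2:
  fixes L0 L1 :: "'a::{real_algebra_1, euclidean_space} set"
    and p q r :: nat
    and e \<epsilon> a :: "nat \<Rightarrow> 'a"
    and s :: "nat \<Rightarrow> nat"
    and E :: "'k::finite set"
    and D :: "('a ^ 'k) set"
    and f :: "'a ^ 'k \<Rightarrow> 'a"
  assumes "comm_superalgebra L0 L1"
    and "condition_A0 L0 p e"
    and "condition_A1 L0 L1 q \<epsilon> r s a"
    and "openin (top_of_set (superspace L0 L1 E)) D"
    and "connected D"
    and "separately_qS_differentiable_on L0 L1 p e q \<epsilon> r s a E f D"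
  shows "qS_differentiable_on L0 L1 p e q \<epsilon> r s a E f D"
proof -
  interpret superalgebra_bases L0 L1 p q r e \<epsilon> a s
    using assms(1-3) by (rule superalgebra_bases.intro)
  have d2: "d_second p e q \<epsilon> r s a E f x h = 0" if x: "x \<in> D" and h: "h \<in> superspace L0 L1 E" for x h
  proof (subst d_second_sum_slices, rule sum.neutral, rule ballI)
    fix v
    have xs: "x \<in> superspace L0 L1 E" using x assms(4) openin_imp_subset by blast
    have "replace_var x v (\<chi> _. x $ v) = x" by (simp add: vec_eq_iff replace_var_def)
    then have 1: "(\<chi> _. x $ v) \<in> {u. replace_var x v u \<in> D}" using x by simp
    have 2: "(\<chi> _. h $ v) \<in> superspace L0 L1 (if v \<in> E then UNIV else {} :: 1 set)"
    proof -
      have "h $ v \<in> (if v \<in> E then L0 else L1)" using h unfolding superspace_def by blast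
      then show ?thesis by (simp add: superspace_def split: if_splits)
    qed
    have "qS_differentiable_on L0 L1 p e q \<epsilon> r s a (if v \<in> E then UNIV else {})
        (\<lambda>u. f (replace_var x v u)) {u. replace_var x v u \<in> D}"
      by (rule bspec[OF spec[OF assms(6)[unfolded separately_qS_differentiable_on_def]] xs])
    from bspec[OF bspec[OF conjunct2[OF this[unfolded qS_differentiable_on_def]] 1] 2]
    show "d_second p e q \<epsilon> r s a (if v \<in> E then UNIV else {})
        (\<lambda>u. f (replace_var x v u)) (\<chi> _. x $ v :: 'a ^ 1) (\<chi> _. h $ v) = 0" .
  qed
  show ?thesis
    unfolding qS_differentiable_on_def
    by (intro conjI ballI separately_qS_imp_differentiable[OF assms(4,6)] d2)
qed

end
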